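(* Let $\Sigma$ be a really full rank seed which is sink-recurrent at $s\in\Gamma_\Sigma$, and let $x_s$ be the corresponding cluster variable on the cluster variety $\mathcal{A}(\Sigma)$ (over a base field $k$). Then the vanishing locus $V(x_s)\subset\mathcal{A}(\Sigma)$ is isomorphic to $\mathbb{A}^1\times\mathcal{A}(\Sigma^{/s})$.
   Context: Seeds. A seed $\Sigma$ consists of a vertex set $V=[n+m]$ partitioned into $n$ mutable vertices $V\setminus F=[n]$ and $m$ frozen vertices $F$, positive integers $d_i$, and an $(n+m)\times n$ integer matrix $\tilde E$ (rows indexed by $V$, columns by $V\setminus F$) with $d_j\tilde E_{ij}=-d_i\tilde E_{ji}$ for mutable $i,j$. To a seed one attaches a cluster: algebraically independent generators $(x_i)_{i\in V}$ of $\mathbb{Q}(x_1,\dots,x_{n+m})$. With $[a]_+=\max(a,0)$, mutation at a mutable vertex $k$ replaces $x_k$ by $x_k'$, where $x_kx_k'=\prod_{i\in V}x_i^{[\tilde E_{ik}]_+}+\prod_{i\in V}x_i^{[-\tilde E_{ik}]_+}$, keeps the other variables, and replaces $\tilde E$ by $\tilde E'$ with $\tilde E'_{ij}=-\tilde E_{ij}$ if $k\in\{i,j\}$ and $\tilde E'_{ij}=\tilde E_{ij}+[\tilde E_{ik}]_+[\tilde E_{kj}]_+-[-\tilde E_{ik}]_+[-\tilde E_{kj}]_+$ otherwise. The cluster algebra of $\Sigma$ is the $\mathbb{Z}$-subalgebra of $\mathbb{Q}(x_1,\dots,x_{n+m})$ generated by all cluster variables of all seeds obtained by iterated mutation and by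 $x_f^{\pm1}$, $f\in F$; the cluster variety $\mathcal{A}(\Sigma)$ is its spectrum (over a field $k$: the base change to $k$). $\Sigma$ is really full rank (RFR) if the rows of $\tilde E$ span $\mathbb{Z}^n$. $\Gamma_\Sigma$ is the directed graph on $V\setminus F$ with an arrow $i\to j$ whenever $\tilde E_{ij}>0$. A vertex $s\in\Gamma_\Sigma$ is a sink if $\tilde E_{vs}\ge0$ for all $v\in V\setminus F$; $N_{in}(s)$ is the set of mutable $v$ with an arrow $v\to s$. For $I\subset V\setminus F$, $\Sigma^{\backslash I}$ is the seed obtained by freezing all vertices of $I$ (deleting the columns in $I$, keeping the rows). Sink-recurrence. The class of sink-recurrent seeds is the smallest class such that: (a) every seed with $\Gamma_\Sigma$ discrete is sink-recurrent; (b) every seed mutation equivalent to a sink-recurrent seed is sink-recurrent; (c) if $s$ is a sink of $\Gamma_\Sigma$ and both $\Sigma^{\backslash s}$ and $\Sigma^{\backslash N_{in}(s)\cup\{s\}}$ are sink-recurrent, then $\Sigma$ is sink-recurrent. In the situation of (c), $\Sigma$ is said to be sink-recurrent at $s$. Deletion at a sink $s$. Let $\tilde E$ now denote the exchange matrix of $\Sigma^{\backslash N_{in}(s)}$. Its row indexed by $s$ is zero; delete this row to get $\tilde E^{red}$. Let $\chi_s=\tilde E^{red}(e_s)\in\mathbb{Z}^{n+m-1}$ be the column of $s$; it is supported on frozen coordinates of $\Sigma^{\backslash N_{in}(s)}$. Delete the column of $s$ and compose with the quotient of the target $\mathbb{Z}^{n+m-1}\to\mathbb{Z}^{n+m-1}/\mathbb{Z}\chi_s\cong\mathbb{Z}^{n+m-2}$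 (only frozen coordinates are affected; choose a basis of the resulting frozen quotient lattice) to get an $(n+m-2)\times(n-|N_{in}(s)|-1)$ matrix $\tilde E^{/s}$. Then $\Sigma^{/s}=(\tilde E^{/s},\{d_i\}_{i\ne s})$. *)

theory Defs
  imports
    "HOL-Library.Poly_Mapping"
    "HOL-Library.FuncSet"
    "HOL-Computational_Algebra.Fraction_Field"
    "HOL-Algebra.Algebra"
    "HOL-Algebra.Algebraic_Closure_Type"
    "HOL-Analysis.Abstract_Topology"
begin

section \<open>Commutative algebras over a commutative ring\<close>

text \<open>An \<open>R\<close>-algebra is a ring together with the ring homomorphism from \<open>R\<close> to it.\<close>

record ('r, 'a) calg = "'a ring" +
  scalar_map :: "'r \<Rightarrow> 'a"

definition with_scalar_map :: "('a, 'm) ring_scheme \<Rightarrow> ('r \<Rightarrow> 'a) \<Rightarrow> ('r, 'a) calg" where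
  "with_scalar_map A \<phi> =
     \<lparr> carrier = carrier A, monoid.mult = monoid.mult A, one = \<one>\<^bsub>A\<^esub>,
       ring.zero = \<zero>\<^bsub>A\<^esub>, add = add A,
       scalar_map = \<phi> \<rparr>"

definition int_alg :: "('a, 'm) ring_scheme \<Rightarrow> (int, 'a) calg" where
  "int_alg A = with_scalar_map A (\<lambda>n. [n] \<cdot>\<^bsub>A\<^esub> \<one>\<^bsub>A\<^esub>)"

definition quotient_alg :: "('r, 'a) calg \<Rightarrow> 'a \<Rightarrow> ('r, 'a set) calg" where
  "quotient_alg A f =
     with_scalar_map (A Quot (PIdl\<^bsub>A\<^esub> f)) (\<lambda>c. (PIdl\<^bsub>A\<^esub> f) +>\<^bsub>A\<^esub> scalar_map A c)"

definition poly_alg :: "('k, 'm) ring_scheme \<Rightarrow> ('k, nat \<Rightarrow> 'k) calg" where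
  "poly_alg k = with_scalar_map (UP k) (\<lambda>c. up_ring.monom (UP k) c 0)"

text \<open>
  The tensor product \<open>A \<otimes>\<^sub>R B\<close> of commutative \<open>R\<close>-algebras: the free abelian group on
  \<open>A \<times> B\<close>, multiplied by the bilinear extension of \<open>(a, b) (a', b') = (a a', b b')\<close>, modulo the
  bilinearity relations. Those relations are stable under multiplication by pairs, so the ideal
  they generate is the subgroup they generate.
\<close>

definition pair_ring ::
  "('a, 'm) ring_scheme \<Rightarrow> ('b, 'n) ring_scheme \<Rightarrow> (('a \<times> 'b) \<Rightarrow>\<^sub>0 int) ring" where
  "pair_ring A B =
     \<lparr> carrier = {p. Poly_Mapping.keys p \<subseteq> carrier A \<times> carrier B},
       monoid.mult = (\<lambda>p q. \<Sum>u\<in>Poly_Mapping.keys p. \<Sum>v\<in>Poly_Mapping.keys q.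
                 Poly_Mapping.single (fst u \<otimes>\<^bsub>A\<^esub> fst v, snd u \<otimes>\<^bsub>B\<^esub> snd v)
                   (Poly_Mapping.lookup p u * Poly_Mapping.lookup q v)),
       one = Poly_Mapping.single (\<one>\<^bsub>A\<^esub>, \<one>\<^bsub>B\<^esub>) 1,
       ring.zero = 0,
       add = (+) \<rparr>"

abbreviation pair_gen :: "'a \<Rightarrow> 'b \<Rightarrow> ('a \<times> 'b) \<Rightarrow>\<^sub>0 int" where
  "pair_gen a b \<equiv> Poly_Mapping.single (a, b) 1"

definition bilinear_relations ::
  "('r, 'l) ring_scheme \<Rightarrow> ('r, 'a) calg \<Rightarrow> ('r, 'b) calg \<Rightarrow> (('a \<times> 'b) \<Rightarrow>\<^sub>0 int) set" where
  "bilinear_relations R A B =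
     {pair_gen (a \<oplus>\<^bsub>A\<^esub> a') b - pair_gen a b - pair_gen a' b | a a' b.
        a \<in> carrier A \<and> a' \<in> carrier A \<and> b \<in> carrier B} \<union>
     {pair_gen a (b \<oplus>\<^bsub>B\<^esub> b') - pair_gen a b - pair_gen a b' | a b b'.
        a \<in> carrier A \<and> b \<in> carrier B \<and> b' \<in> carrier B} \<union>
     {pair_gen (scalar_map A r \<otimes>\<^bsub>A\<^esub> a) b - pair_gen a (scalar_map B r \<otimes>\<^bsub>B\<^esub> b) | r a b.
        r \<in> carrier R \<and> a \<in> carrier A \<and> b \<in> carrier B}"

definition tensor_ideal ::
  "('r, 'l) ring_scheme \<Rightarrow> ('r, 'a) calg \<Rightarrow> ('r, 'b) calg \<Rightarrow> (('a \<times> 'b) \<Rightarrow>\<^sub>0 int) set" where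
  "tensor_ideal R A B = Idl\<^bsub>pair_ring A B\<^esub> (bilinear_relations R A B)"

definition pure_tensor ::
  "('r, 'l) ring_scheme \<Rightarrow> ('r, 'a) calg \<Rightarrow> ('r, 'b) calg \<Rightarrow> 'a \<Rightarrow> 'b \<Rightarrow>
    (('a \<times> 'b) \<Rightarrow>\<^sub>0 int) set" where
  "pure_tensor R A B a b = tensor_ideal R A B +>\<^bsub>pair_ring A B\<^esub> pair_gen a b"

definition tensor_alg ::
  "('r, 'l) ring_scheme \<Rightarrow> ('r, 'a) calg \<Rightarrow> ('r, 'b) calg \<Rightarrow>
    ('r, (('a \<times> 'b) \<Rightarrow>\<^sub>0 int) set) calg" where
  "tensor_alg R A B =
     with_scalar_map (pair_ring A B Quot tensor_ideal R A B)
       (\<lambda>r. pure_tensor R A B (scalar_map A r) \<one>\<^bsub>B\<^esub>)"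

text \<open>The base change \<open>A \<otimes>\<^sub>\<int> k\<close>, an algebra over \<open>k\<close> through the second factor.\<close>

definition base_change ::
  "('k, 'm) ring_scheme \<Rightarrow> ('a, 'n) ring_scheme \<Rightarrow> ('k, (('a \<times> 'k) \<Rightarrow>\<^sub>0 int) set) calg" where
  "base_change k A =
     with_scalar_map (tensor_alg \<Z> (int_alg A) (int_alg k))
       (\<lambda>c. pure_tensor \<Z> (int_alg A) (int_alg k) \<one>\<^bsub>A\<^esub> c)"


section \<open>Affine schemes over a field\<close>

definition spec_points :: "('a, 'm) ring_scheme \<Rightarrow> 'a set set" where
  "spec_points A = {P. primeideal P A}"

definition basic_open :: "('a, 'm) ring_scheme \<Rightarrow> 'a \<Rightarrow> 'a set set" where
  "basic_open A f = {P \<in> spec_points A. f \<notin> P}"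

definition zariski :: "('a, 'm) ring_scheme \<Rightarrow> 'a set topology" where
  "zariski A = topology_generated_by (basic_open A ` carrier A)"

text \<open>
  The element \<open>a / f\<close> of the localization \<open>A\<^sub>P\<close>, as the set of all fractions equal to it.
\<close>

definition fraction_at :: "('a, 'm) ring_scheme \<Rightarrow> 'a set \<Rightarrow> 'a \<Rightarrow> 'a \<Rightarrow> ('a \<times> 'a) set" where
  "fraction_at A P a f =
     {(b, g). b \<in> carrier A \<and> g \<in> carrier A - P \<and>
        (\<exists>u \<in> carrier A - P. u \<otimes>\<^bsub>A\<^esub> (a \<otimes>\<^bsub>A\<^esub> g) = u \<otimes>\<^bsub>A\<^esub> (b \<otimes>\<^bsub>A\<^esub> f))}"

definition local_ring_at :: "('a, 'm) ring_scheme \<Rightarrow> 'a set \<Rightarrow> ('a \<times> 'a) set ring" where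
  "local_ring_at A P =
     \<lparr> carrier = {fraction_at A P a f | a f. a \<in> carrier A \<and> f \<in> carrier A - P},
       monoid.mult = (\<lambda>x y. \<Union>(a, f)\<in>x. \<Union>(b, g)\<in>y. fraction_at A P (a \<otimes>\<^bsub>A\<^esub> b) (f \<otimes>\<^bsub>A\<^esub> g)),
       one = fraction_at A P \<one>\<^bsub>A\<^esub> \<one>\<^bsub>A\<^esub>,
       ring.zero = fraction_at A P \<zero>\<^bsub>A\<^esub> \<one>\<^bsub>A\<^esub>,
       add = (\<lambda>x y. \<Union>(a, f)\<in>x. \<Union>(b, g)\<in>y.
               fraction_at A P ((a \<otimes>\<^bsub>A\<^esub> g) \<oplus>\<^bsub>A\<^esub> (b \<otimes>\<^bsub>A\<^esub> f)) (f \<otimes>\<^bsub>A\<^esub> g)) \<rparr>"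

text \<open>Sections of the structure sheaf over \<open>U\<close>: families of germs that are locally fractions.\<close>

definition regular_sections ::
  "('a, 'm) ring_scheme \<Rightarrow> 'a set set \<Rightarrow> ('a set \<Rightarrow> ('a \<times> 'a) set) set" where
  "regular_sections A U =
     {t \<in> extensional U. \<forall>P\<in>U. \<exists>W a f. openin (zariski A) W \<and> P \<in> W \<and> W \<subseteq> U \<and>
        a \<in> carrier A \<and> f \<in> carrier A \<and> (\<forall>Q\<in>W. f \<notin> Q \<and> t Q = fraction_at A Q a f)}"

definition section_ring ::
  "('a, 'm) ring_scheme \<Rightarrow> 'a set set \<Rightarrow> ('a set \<Rightarrow> ('a \<times> 'a) set) ring" where
  "section_ring A U =
     \<lparr> carrier = regular_sections A U,
       monoid.mult = (\<lambda>t t'. \<lambda>P\<in>U. t P \<otimes>\<^bsub>local_ring_at A P\<^esub> t' P),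
       one = (\<lambda>P\<in>U. \<one>\<^bsub>local_ring_at A P\<^esub>),
       ring.zero = (\<lambda>P\<in>U. \<zero>\<^bsub>local_ring_at A P\<^esub>),
       add = (\<lambda>t t'. \<lambda>P\<in>U. t P \<oplus>\<^bsub>local_ring_at A P\<^esub> t' P) \<rparr>"

text \<open>
  Spaces with a sheaf of \<open>k\<close>-algebras: \<open>restr W\<close> restricts sections to the open subset \<open>W\<close>, and
  \<open>scalars\<close> maps \<open>k\<close> to the global sections.
\<close>

record ('k, 'p, 's) ringed_space_over =
  pts :: "'p topology"
  sect :: "'p set \<Rightarrow> 's ring"
  restr :: "'p set \<Rightarrow> 's \<Rightarrow> 's"
  scalars :: "'k \<Rightarrow> 's"

definition Spec ::
  "('k, 'a) calg \<Rightarrow> ('k, 'a set, 'a set \<Rightarrow> ('a \<times> 'a) set) ringed_space_over" where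
  "Spec A =
     \<lparr> pts = zariski A,
       sect = section_ring A,
       restr = (\<lambda>W t. restrict t W),
       scalars = (\<lambda>c. \<lambda>P\<in>spec_points A. fraction_at A P (scalar_map A c) \<one>\<^bsub>A\<^esub>) \<rparr>"

text \<open>
  Isomorphism over \<open>k\<close>. An isomorphism of ringed spaces induces isomorphisms of stalks, so
  between schemes the maps on stalks are automatically local.
\<close>

definition isomorphic_over ::
  "('k, 'm) ring_scheme \<Rightarrow> ('k, 'p, 's) ringed_space_over \<Rightarrow> ('k, 'q, 't) ringed_space_over \<Rightarrow> bool"
  where
  "isomorphic_over k M N \<longleftrightarrow>
     (\<exists>h \<phi>. homeomorphic_map (pts M) (pts N) h \<and>
        (\<forall>V. openin (pts N) V \<longrightarrow>
           \<phi> V \<in> ring_iso (sect N V) (sect M {p \<in> topspace (pts M). h p \<in> V})) \<and>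
        (\<forall>V W. openin (pts N) V \<and> openin (pts N) W \<and> W \<subseteq> V \<longrightarrow>
           (\<forall>t \<in> carrier (sect N V).
              \<phi> W (restr N W t) = restr M {p \<in> topspace (pts M). h p \<in> W} (\<phi> V t))) \<and>
        (\<forall>c \<in> carrier k. \<phi> (topspace (pts N)) (scalars N c) = scalars M c))"

text \<open>The closed subscheme \<open>V(f)\<close> of \<open>Spec A\<close>.\<close>

definition vanishing_locus ::
  "('k, 'a) calg \<Rightarrow> 'a \<Rightarrow> ('k, 'a set set, 'a set set \<Rightarrow> ('a set \<times> 'a set) set) ringed_space_over"
  where
  "vanishing_locus A f = Spec (quotient_alg A f)"

text \<open>The fibre product \<open>\<A>\<^sup>1 \<times> Spec A\<close> over \<open>Spec k\<close>.\<close>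

definition affine_line_times where
  "affine_line_times k A = Spec (tensor_alg k (poly_alg k) A)"


section \<open>Seeds and mutation\<close>

text \<open>
  Vertices are natural numbers. Only the entries \<open>exch i j\<close> with \<open>i\<close> a vertex and \<open>j\<close> mutable, and
  the values \<open>symm i\<close> with \<open>i\<close> mutable, are meaningful.
\<close>

record seed =
  mutable :: "nat set"
  frozen :: "nat set"
  symm :: "nat \<Rightarrow> int"
  exch :: "nat \<Rightarrow> nat \<Rightarrow> int"

definition vertices :: "seed \<Rightarrow> nat set" where
  "vertices S = mutable S \<union> frozen S"

definition is_seed :: "seed \<Rightarrow> bool" where
  "is_seed S \<longleftrightarrow>
     finite (mutable S) \<and> finite (frozen S) \<and> mutable S \<inter> frozen S = {} \<and>
     (\<forall>i \<in> mutable S. 0 < symm S i) \<and>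
     (\<forall>i \<in> mutable S. \<forall>j \<in> mutable S. symm S j * exch S i j = - (symm S i * exch S j i))"

definition pos_part :: "int \<Rightarrow> int" where
  "pos_part a = max a 0"

definition mutate :: "nat \<Rightarrow> seed \<Rightarrow> seed" where
  "mutate k S = S\<lparr> exch := (\<lambda>i j.
     if i = k \<or> j = k then - exch S i j
     else exch S i j + pos_part (exch S i k) * pos_part (exch S k j)
                     - pos_part (- exch S i k) * pos_part (- exch S k j)) \<rparr>"

definition mutation_equivalent :: "seed \<Rightarrow> seed \<Rightarrow> bool" where
  "mutation_equivalent = (\<lambda>S T. \<exists>k \<in> mutable S. T = mutate k S)\<^sup>*\<^sup>*"

definition freeze :: "nat set \<Rightarrow> seed \<Rightarrow> seed" where
  "freeze I S = S\<lparr> mutable := mutable S - I, frozen := frozen S \<union> I \<rparr>"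

definition really_full_rank :: "seed \<Rightarrow> bool" where
  "really_full_rank S \<longleftrightarrow>
     (\<forall>w :: nat \<Rightarrow> int. \<exists>c :: nat \<Rightarrow> int.
        \<forall>j \<in> mutable S. w j = (\<Sum>i \<in> vertices S. c i * exch S i j))"

definition arrow :: "seed \<Rightarrow> nat \<Rightarrow> nat \<Rightarrow> bool" where
  "arrow S i j \<longleftrightarrow> i \<in> mutable S \<and> j \<in> mutable S \<and> 0 < exch S i j"

definition is_sink :: "seed \<Rightarrow> nat \<Rightarrow> bool" where
  "is_sink S s \<longleftrightarrow> s \<in> mutable S \<and> (\<forall>v \<in> mutable S. 0 \<le> exch S v s)"

definition N_in :: "seed \<Rightarrow> nat \<Rightarrow> nat set" where
  "N_in S s = {v \<in> mutable S. arrow S v s}"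

inductive sink_recurrent :: "seed \<Rightarrow> bool" where
  discrete: "is_seed S \<Longrightarrow> (\<And>i j. \<not> arrow S i j) \<Longrightarrow> sink_recurrent S"
| mutation: "sink_recurrent S \<Longrightarrow> mutation_equivalent S T \<Longrightarrow> sink_recurrent T"
| sink: "is_seed S \<Longrightarrow> is_sink S s \<Longrightarrow> sink_recurrent (freeze {s} S) \<Longrightarrow>
    sink_recurrent (freeze (N_in S s \<union> {s}) S) \<Longrightarrow> sink_recurrent S"

definition sink_recurrent_at :: "seed \<Rightarrow> nat \<Rightarrow> bool" where
  "sink_recurrent_at S s \<longleftrightarrow>
     is_sink S s \<and> sink_recurrent (freeze {s} S) \<and> sink_recurrent (freeze (N_in S s \<union> {s}) S)"


section \<open>Cluster algebras and cluster varieties\<close>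

text \<open>
  The field of rational functions over \<open>\<rat>\<close> in indeterminates indexed by the natural numbers. A
  seed uses only those indexed by its vertices, which generate the field the cluster algebra
  lives in.
\<close>

type_synonym ratfun = "((nat \<Rightarrow>\<^sub>0 nat) \<Rightarrow>\<^sub>0 rat) fract"

definition indet :: "nat \<Rightarrow> ratfun" where
  "indet i = Fract (Poly_Mapping.single (Poly_Mapping.single i 1) 1) 1"

definition mutate_cluster :: "nat \<Rightarrow> seed \<Rightarrow> (nat \<Rightarrow> ratfun) \<Rightarrow> nat \<Rightarrow> ratfun" where
  "mutate_cluster k S x = x(k :=
     ((\<Prod>i \<in> vertices S. x i ^ nat (pos_part (exch S i k))) +
      (\<Prod>i \<in> vertices S. x i ^ nat (pos_part (- exch S i k)))) / x k)"

inductive reachable :: "seed \<Rightarrow> seed \<Rightarrow> (nat \<Rightarrow> ratfun) \<Rightarrow> bool" for S where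
  initial: "reachable S S indet"
| step: "reachable S T x \<Longrightarrow> k \<in> mutable T \<Longrightarrow> reachable S (mutate k T) (mutate_cluster k T x)"

definition cluster_variables :: "seed \<Rightarrow> ratfun set" where
  "cluster_variables S = {x i | T x i. reachable S T x \<and> i \<in> mutable T}"

definition cluster_algebra :: "seed \<Rightarrow> ratfun ring" where
  "cluster_algebra S =
     (ring_of_type_algebra :: ratfun ring)\<lparr> carrier :=
        generate_ring ring_of_type_algebra
          (cluster_variables S \<union> indet ` frozen S \<union> (\<lambda>f. inverse (indet f)) ` frozen S) \<rparr>"

text \<open>
  The coordinate ring of the cluster variety over \<open>k\<close>, which is \<open>Spec (cluster_algebra_over k S)\<close>.
\<close>

definition cluster_algebra_over where
  "cluster_algebra_over k S = base_change k (cluster_algebra S)"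

text \<open>The initial cluster variable \<open>x\<^sub>s\<close> as a regular function on the cluster variety over \<open>k\<close>.\<close>

definition cluster_function where
  "cluster_function k S s =
     pure_tensor \<Z> (int_alg (cluster_algebra S)) (int_alg k) (indet s) \<one>\<^bsub>k\<^esub>"


section \<open>Deletion at a sink\<close>

text \<open>
  The integer matrix \<open>\<pi>\<close>, with rows indexed by \<open>G\<close> and columns by \<open>F\<close>, induces an isomorphism of
  \<open>\<int>\<^sup>F / \<int>\<chi>\<close> with \<open>\<int>\<^sup>G\<close>, that is, it is the quotient map written in a basis of the quotient.
\<close>

definition quotient_basis :: "nat set \<Rightarrow> (nat \<Rightarrow> int) \<Rightarrow> nat set \<Rightarrow> (nat \<Rightarrow> nat \<Rightarrow> int) \<Rightarrow> bool" where
  "quotient_basis F \<chi> G \<pi> \<longleftrightarrow>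
     (\<forall>w :: nat \<Rightarrow> int. \<exists>v :: nat \<Rightarrow> int. \<forall>g\<in>G. (\<Sum>f\<in>F. \<pi> g f * v f) = w g) \<and>
     (\<forall>v :: nat \<Rightarrow> int. (\<forall>g\<in>G. (\<Sum>f\<in>F. \<pi> g f * v f) = 0) \<longleftrightarrow> (\<exists>c :: int. \<forall>f\<in>F. v f = c * \<chi> f))"

text \<open>
  \<open>D\<close> is a seed \<open>\<Sigma>\<^sup>/\<^sup>s\<close> for \<open>S\<close>; it depends on a choice of basis of the frozen quotient lattice
  (and of labels for the elements of the basis). With \<open>F\<close> the frozen vertices of
  the seed \<open>freeze (N_in S s) S\<close>, the column \<open>\<chi>\<^sub>s\<close> vanishes outside \<open>F\<close>, so that only the rows
  in \<open>F\<close> are changed by the passage to the quotient.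
\<close>

definition is_deletion :: "seed \<Rightarrow> nat \<Rightarrow> seed \<Rightarrow> bool" where
  "is_deletion S s D \<longleftrightarrow>
     (let T = freeze (N_in S s) S in
        mutable D = mutable T - {s} \<and>
        finite (frozen D) \<and> mutable D \<inter> frozen D = {} \<and>
        (\<forall>i \<in> mutable D. symm D i = symm S i) \<and>
        (\<forall>i \<in> mutable D. \<forall>j \<in> mutable D. exch D i j = exch T i j) \<and>
        (\<exists>\<pi>. quotient_basis (frozen T) (\<lambda>f. exch T f s) (frozen D) \<pi> \<and>
           (\<forall>g \<in> frozen D. \<forall>j \<in> mutable D. exch D g j = (\<Sum>f \<in> frozen T. \<pi> g f * exch T f j))))"

text \<open>For really full rank seeds \<open>\<chi>\<^sub>s\<close> is primitive, so a deletion exists.\<close>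

lemma quotient_basis_exists:
  assumes "finite F" and "(\<Sum>f\<in>F. c f * \<chi> f) = (1::int)"
  shows "\<exists>G \<pi>. G \<subseteq> F \<and> quotient_basis F \<chi> G \<pi>"
  using assms(2)
proof (induction "nat (\<Sum>f\<in>F. \<bar>\<chi> f\<bar>)" arbitrary: \<chi> c rule: less_induct)
  case less
  note fin = \<open>finite F\<close>
  have "\<exists>a\<in>F. \<chi> a \<noteq> 0"
  proof (rule ccontr)
    assume "\<not> ?thesis"
    then have "(\<Sum>f\<in>F. c f * \<chi> f) = 0" by (intro sum.neutral) auto
    with less.prems show False by simp
  qed
  then obtain f0 where f0: "f0 \<in> F" "\<chi> f0 \<noteq> 0" by blast
  show ?case
  proof (cases "\<forall>f \<in> F - {f0}. \<chi> f = 0")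
    case True
    have "(\<Sum>f\<in>F. c f * \<chi> f) = c f0 * \<chi> f0 + (\<Sum>f\<in>F - {f0}. c f * \<chi> f)"
      using fin f0 by (simp add: sum.remove)
    also have "(\<Sum>f\<in>F - {f0}. c f * \<chi> f) = 0"
      using True by (intro sum.neutral) auto
    finally have unit: "c f0 * \<chi> f0 = 1" using less.prems by simp
    let ?\<pi> = "\<lambda>g f. if f = g then 1 else (0::int)"
    have proj: "(\<Sum>f\<in>F. ?\<pi> g f * v f) = v g" if "g \<in> F" for g and v :: "nat \<Rightarrow> int"
    proof -
      have "(\<Sum>f\<in>F. ?\<pi> g f * v f) = (\<Sum>f\<in>F. if f = g then v f else 0)"
        by (intro sum.cong) auto
      then show ?thesis using fin that by simp
    qed
    have "quotient_basis F \<chi> (F - {f0}) ?\<pi>"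
      unfolding quotient_basis_def
    proof (intro conjI allI iffI)
      fix w :: "nat \<Rightarrow> int"
      show "\<exists>v. \<forall>g\<in>F - {f0}. (\<Sum>f\<in>F. ?\<pi> g f * v f) = w g"
        using proj by (intro exI[of _ w]) blast
    next
      fix v :: "nat \<Rightarrow> int"
      assume "\<forall>g\<in>F - {f0}. (\<Sum>f\<in>F. ?\<pi> g f * v f) = 0"
      then have "\<forall>g\<in>F - {f0}. v g = 0" using proj by simp
      moreover have "v f0 = (v f0 * c f0) * \<chi> f0" using unit by simp
      ultimately show "\<exists>d. \<forall>f\<in>F. v f = d * \<chi> f"
        using True by (intro exI[of _ "v f0 * c f0"]) (metis DiffI mult_zero_right singletonD)
    next
      fix v :: "nat \<Rightarrow> int"
      assume "\<exists>d. \<forall>f\<in>F. v f = d * \<chi> f"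
      then show "\<forall>g\<in>F - {f0}. (\<Sum>f\<in>F. ?\<pi> g f * v f) = 0"
        using proj True by auto
    qed
    then show ?thesis by blast
  next
    case False
    then obtain f1 where f1: "f1 \<in> F" "f1 \<noteq> f0" "\<chi> f1 \<noteq> 0" by blast
    obtain a b where ab: "a \<in> F" "b \<in> F" "a \<noteq> b" "\<chi> b \<noteq> 0" "\<bar>\<chi> b\<bar> \<le> \<bar>\<chi> a\<bar>"
      using f0 f1 by (metis linear)
    define e where "e = sgn (\<chi> a) * sgn (\<chi> b)"
    have smaller: "\<bar>\<chi> a - e * \<chi> b\<bar> < \<bar>\<chi> a\<bar>"
      using ab(4,5) by (auto simp: e_def sgn_if abs_if split: if_splits)
    define \<chi>' where "\<chi>' = \<chi>(a := \<chi> a - e * \<chi> b)"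
    define c' where "c' = c(b := c b + e * c a)"
    have F: "F = insert a (insert b (F - {a, b}))" using ab by blast
    have split: "(\<Sum>f\<in>F. h f) = h a + (h b + (\<Sum>f\<in>F - {a, b}. h f))" for h :: "nat \<Rightarrow> int"
      by (subst F) (use fin ab in simp)
    have rest: "(\<Sum>f\<in>F - {a, b}. \<bar>\<chi>' f\<bar>) = (\<Sum>f\<in>F - {a, b}. \<bar>\<chi> f\<bar>)"
      "(\<Sum>f\<in>F - {a, b}. c' f * \<chi>' f) = (\<Sum>f\<in>F - {a, b}. c f * \<chi> f)"
      by (intro sum.cong; simp add: \<chi>'_def c'_def)+
    have "(\<Sum>f\<in>F. \<bar>\<chi>' f\<bar>) < (\<Sum>f\<in>F. \<bar>\<chi> f\<bar>)"
      unfolding split rest using smaller ab(3) by (simp add: \<chi>'_def)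
    moreover have "0 \<le> (\<Sum>f\<in>F. \<bar>\<chi>' f\<bar>)" by (intro sum_nonneg) simp
    ultimately have dec: "nat (\<Sum>f\<in>F. \<bar>\<chi>' f\<bar>) < nat (\<Sum>f\<in>F. \<bar>\<chi> f\<bar>)" by linarith
    have "(\<Sum>f\<in>F. c' f * \<chi>' f) = (\<Sum>f\<in>F. c f * \<chi> f)"
      unfolding split rest using ab(3) by (simp add: \<chi>'_def c'_def algebra_simps)
    with less.prems have one: "(\<Sum>f\<in>F. c' f * \<chi>' f) = 1" by simp
    from less.hyps[OF dec one] obtain G \<pi>' where G: "G \<subseteq> F" "quotient_basis F \<chi>' G \<pi>'"
      by blast
    define \<pi> where "\<pi> = (\<lambda>g. (\<pi>' g)(b := \<pi>' g b - e * \<pi>' g a))"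
    define T where "T = (\<lambda>v :: nat \<Rightarrow> int. v(a := v a - e * v b))"
    have \<pi>T: "(\<Sum>f\<in>F. \<pi> g f * v f) = (\<Sum>f\<in>F. \<pi>' g f * T v f)" for g v
    proof -
      have "(\<Sum>f\<in>F - {a, b}. \<pi> g f * v f) = (\<Sum>f\<in>F - {a, b}. \<pi>' g f * T v f)"
        by (intro sum.cong) (auto simp: \<pi>_def T_def)
      then show ?thesis
        unfolding split using ab(3) by (simp add: \<pi>_def T_def algebra_simps)
    qed
    have T_surj: "\<exists>v. T v = w" for w
      using ab(3) by (intro exI[of _ "w(a := w a + e * w b)"]) (auto simp: T_def fun_eq_iff)
    have T_\<chi>: "(\<forall>f\<in>F. T v f = d * \<chi>' f) \<longleftrightarrow> (\<forall>f\<in>F. v f = d * \<chi> f)" for v d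
    proof -
      have "T v a = d * \<chi>' a \<and> T v b = d * \<chi>' b \<longleftrightarrow> v a = d * \<chi> a \<and> v b = d * \<chi> b"
        using ab(3) by (auto simp: T_def \<chi>'_def algebra_simps)
      moreover have "T v f = d * \<chi>' f \<longleftrightarrow> v f = d * \<chi> f" if "f \<noteq> a" "f \<noteq> b" for f
        using that by (simp add: T_def \<chi>'_def)
      ultimately show ?thesis using ab(1,2) by metis
    qed
    have "quotient_basis F \<chi> G \<pi>"
      unfolding quotient_basis_def
    proof (intro conjI allI)
      fix w :: "nat \<Rightarrow> int"
      obtain v' where "\<forall>g\<in>G. (\<Sum>f\<in>F. \<pi>' g f * v' f) = w g"
        using G(2) unfolding quotient_basis_def by blast
      moreover obtain v where "T v = v'" using T_surj by blast
      ultimately show "\<exists>v. \<forall>g\<in>G. (\<Sum>f\<in>F. \<pi> g f * v f) = w g"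
        by (intro exI[of _ v]) (simp add: \<pi>T)
    next
      fix v :: "nat \<Rightarrow> int"
      have "(\<forall>g\<in>G. (\<Sum>f\<in>F. \<pi> g f * v f) = 0) \<longleftrightarrow> (\<exists>d. \<forall>f\<in>F. T v f = d * \<chi>' f)"
        using G(2) unfolding quotient_basis_def \<pi>T by blast
      then show "(\<forall>g\<in>G. (\<Sum>f\<in>F. \<pi> g f * v f) = 0) \<longleftrightarrow> (\<exists>d. \<forall>f\<in>F. v f = d * \<chi> f)"
        unfolding T_\<chi> .
    qed
    with G(1) show ?thesis by blast
  qed
qed

lemma deletion_exists:
  assumes "is_seed S" and "really_full_rank S" and "is_sink S s"
  shows "\<exists>D. is_deletion S s D"
proof -
  define T where "T = freeze (N_in S s) S"
  have fin: "finite (vertices S)" "finite (frozen T)" and s: "s \<in> mutable S"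
    using assms by (auto simp: is_seed_def is_sink_def vertices_def T_def freeze_def N_in_def)
  have disj: "(mutable T - {s}) \<inter> frozen T = {}"
    using assms by (auto simp: is_seed_def T_def freeze_def)
  have exch_T: "exch T = exch S" by (simp add: T_def freeze_def)
  obtain c where c: "\<forall>j \<in> mutable S. 1 = (\<Sum>i \<in> vertices S. c i * exch S i j)"
    using assms(2)[unfolded really_full_rank_def, rule_format, of "\<lambda>_. 1"] by auto
  have "(\<Sum>i \<in> vertices S. c i * exch S i s) = (\<Sum>i \<in> frozen T. c i * exch S i s)"
  proof (rule sum.mono_neutral_right[OF fin(1)])
    show "frozen T \<subseteq> vertices S"
      by (auto simp: T_def freeze_def vertices_def N_in_def)
    show "\<forall>i \<in> vertices S - frozen T. c i * exch S i s = 0"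
      using assms(3) s
      by (force simp: T_def freeze_def vertices_def N_in_def arrow_def is_sink_def)
  qed
  then have "(\<Sum>i \<in> frozen T. c i * exch S i s) = 1" using c s by simp
  from quotient_basis_exists[OF fin(2) this] obtain G \<pi>
    where G: "G \<subseteq> frozen T" "quotient_basis (frozen T) (\<lambda>f. exch T f s) G \<pi>"
    by (auto simp: exch_T)
  define D where "D = \<lparr> mutable = mutable T - {s}, frozen = G, symm = symm S,
    exch = (\<lambda>i j. if i \<in> G then \<Sum>f \<in> frozen T. \<pi> i f * exch T f j else exch T i j) \<rparr>"
  have "is_deletion S s D"
    unfolding is_deletion_def Let_def T_def[symmetric]
    using G disj fin(2) by (auto simp: D_def intro: finite_subset)
  then show ?thesis by blast
qed

end

theory Submission
  imports Defs
begin

text \<open>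
  Since \<open>s\<close> is a sink, \<open>x\<^sub>s x\<^sub>s' = u (1 + z)\<close> with \<open>u\<close> a frozen monomial and \<open>z\<close> divisible by the
  \<open>x\<^sub>v\<close>, \<open>v \<in> N_in S s\<close>. On \<open>x\<^sub>s = 0\<close> these \<open>x\<^sub>v\<close> are therefore invertible, and nothing changes
  there when they are frozen: sink-recurrence and really full rank give
  \<open>cluster algebra = upper bound\<close> for the seed frozen at \<open>N_in S s \<union> {s}\<close>, so that by the Laurent
  phenomenon the cluster algebra \<open>A\<close> of \<open>S\<close> lies in the cluster algebra \<open>A'\<close> of
  \<open>freeze (N_in S s) S\<close>, and \<open>A / x\<^sub>s A = A' / x\<^sub>s A'\<close>. In \<open>A'\<close> the vertex \<open>s\<close> is isolated.

  By really full rank there is a grading by weights \<open>c\<close>, invariant under mutation away from \<open>s\<close>, in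
  which \<open>z\<close> has degree one. Multiplying the cluster variables by powers of the unit \<open>z\<close> to make them
  of degree zero identifies the part \<open>C\<close> of degree zero with the cluster algebra of the deletion,
  and with \<open>y = x\<^sub>s' / u\<close> we obtain \<open>A' = C[x\<^sub>s, y, 1 / (x\<^sub>s y - 1)]\<close>, whose quotient by \<open>x\<^sub>s\<close>
  is \<open>C[y]\<close>.
\<close>

section \<open>Isomorphic algebras have isomorphic spectra\<close>

text \<open>Equality of cluster algebra and upper bound usually rests on factorial Laurent rings and
  coprime exchange binomials. Here gradings replace factorization. In a weight where one
  \<open>yhat\<close> has degree one and another degree zero, the first binomial is monic of degree
  one over the second, and division from the top degree shows that it is no zero divisor modulo the
  second. For a connected pair the degree in one variable does the same after a rank-two
  computation. The same division lets 1 + z be divided out inside the subring attached to an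
  isolated vertex. A grading is cheap to set up: it is the family of eigenspaces of an automorphism
  multiplying variables by powers of 2.

  The geometry reduces to one statement over the integers: the cluster algebra maps onto the
  polynomials over that of the deletion, with kernel generated by x_s. A presentation of this kind
  survives tensoring with k, by right exactness.\<close>

locale cring_isomorphism =
  A: cring A + B: cring B for A :: "('a, 'm) ring_scheme" and B :: "('b, 'n) ring_scheme" +
  fixes f :: "'b \<Rightarrow> 'a"
  assumes iso: "f \<in> ring_iso B A"
begin

lemma hom: "f \<in> ring_hom B A" and bij: "bij_betw f (carrier B) (carrier A)"
  using iso by (auto simp: ring_iso_def)

lemma closed: "b \<in> carrier B \<Longrightarrow> f b \<in> carrier A"
  and mult: "b \<in> carrier B \<Longrightarrow> c \<in> carrier B \<Longrightarrow> f (b \<otimes>\<^bsub>B\<^esub> c) = f b \<otimes>\<^bsub>A\<^esub> f c"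
  and add: "b \<in> carrier B \<Longrightarrow> c \<in> carrier B \<Longrightarrow> f (b \<oplus>\<^bsub>B\<^esub> c) = f b \<oplus>\<^bsub>A\<^esub> f c"
  and one: "f \<one>\<^bsub>B\<^esub> = \<one>\<^bsub>A\<^esub>"
  and inj: "b \<in> carrier B \<Longrightarrow> c \<in> carrier B \<Longrightarrow> f b = f c \<longleftrightarrow> b = c"
  using ring_iso_memE[OF iso] bij by (auto simp: bij_betw_def inj_on_def)

lemma surj: "a \<in> carrier A \<Longrightarrow> \<exists>b\<in>carrier B. f b = a"
  using bij unfolding bij_betw_def by (metis imageE)

definition pull :: "'a set \<Rightarrow> 'b set" where
  "pull P = {b \<in> carrier B. f b \<in> P}"

lemma pull_spec: "P \<in> spec_points A \<Longrightarrow> pull P \<in> spec_points B"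
proof -
  assume "P \<in> spec_points A"
  then have P: "primeideal P A" by (simp add: spec_points_def)
  interpret ring_hom_ring B A f by (rule ring_hom_ringI2[OF B.ring_axioms A.ring_axioms hom])
  show ?thesis using primeideal_vimage[OF B.is_cring P] by (simp add: spec_points_def pull_def)
qed

lemma topspace_zariski: "topspace (zariski B) = spec_points B"
proof -
  have "basic_open B \<one>\<^bsub>B\<^esub> = spec_points B"
    by (auto simp: basic_open_def spec_points_def dest: primeideal.I_notcarr
        ideal.one_imp_carrier[OF primeideal.axioms(1)])
  moreover have "basic_open B b \<subseteq> spec_points B" for b by (auto simp: basic_open_def)
  ultimately show ?thesis
    unfolding zariski_def topology_generated_by_topspace by blast
qed

lemma pull_continuous:
  assumes top: "topspace (zariski A) = spec_points A"
  shows "continuous_map (zariski A) (zariski B) pull"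
proof -
  have "openin (zariski A) (pull -` U \<inter> topspace (zariski A))" if "U \<in> basic_open B ` carrier B" for U
  proof -
    from that obtain b where b: "b \<in> carrier B" "U = basic_open B b" by blast
    have "pull -` U \<inter> topspace (zariski A) = basic_open A (f b)"
      using b pull_spec by (auto simp: top basic_open_def pull_def)
    then show ?thesis
      unfolding zariski_def using b closed by (auto intro: topology_generated_by_Basis)
  qed
  moreover have "pull ` topspace (zariski A) \<subseteq> \<Union> (basic_open B ` carrier B)"
    using topspace_zariski pull_spec unfolding zariski_def topology_generated_by_topspace
    using top topspace_zariski by (auto simp: zariski_def)
  ultimately show ?thesis
    unfolding zariski_def[of B] by (intro continuous_on_generated_topo)
qed

text \<open>A germ is the set of all fractions equal to it, so f acts on germs by taking images. The
  inclusion from left to right uses both halves of bijectivity: surjectivity lifts a fraction and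
  its witness u, injectivity reflects the equation between them.\<close>

lemma fraction_at_pull:
  assumes P: "P \<in> spec_points A" and "b \<in> carrier B" "c \<in> carrier B"
  shows "fraction_at A P (f b) (f c) = map_prod f f ` fraction_at B (pull P) b c"
proof (intro equalityI subsetI)
  fix z assume "z \<in> fraction_at A P (f b) (f c)"
  then obtain x y u where z: "z = (x, y)" "x \<in> carrier A" "y \<in> carrier A - P" "u \<in> carrier A - P"
    "u \<otimes>\<^bsub>A\<^esub> (f b \<otimes>\<^bsub>A\<^esub> y) = u \<otimes>\<^bsub>A\<^esub> (x \<otimes>\<^bsub>A\<^esub> f c)" by (auto simp: fraction_at_def)
  obtain x' y' u' where *: "x' \<in> carrier B" "f x' = x" "y' \<in> carrier B" "f y' = y" "u' \<in> carrier B" "f u' = u"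
    using surj z by (metis DiffD1)
  have "f (u' \<otimes>\<^bsub>B\<^esub> (b \<otimes>\<^bsub>B\<^esub> y')) = f (u' \<otimes>\<^bsub>B\<^esub> (x' \<otimes>\<^bsub>B\<^esub> c))"
    using * z assms by (simp add: mult)
  then have "u' \<otimes>\<^bsub>B\<^esub> (b \<otimes>\<^bsub>B\<^esub> y') = u' \<otimes>\<^bsub>B\<^esub> (x' \<otimes>\<^bsub>B\<^esub> c)"
    using * assms by (simp add: inj)
  then have "(x', y') \<in> fraction_at B (pull P) b c"
    using * z by (auto simp: fraction_at_def pull_def)
  then show "z \<in> map_prod f f ` fraction_at B (pull P) b c"
    using * z by (auto intro!: image_eqI[of _ _ "(x', y')"])
next
  fix z assume "z \<in> map_prod f f ` fraction_at B (pull P) b c"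
  then obtain x y u where z: "z = (f x, f y)" "x \<in> carrier B" "y \<in> carrier B - pull P" "u \<in> carrier B - pull P"
    "u \<otimes>\<^bsub>B\<^esub> (b \<otimes>\<^bsub>B\<^esub> y) = u \<otimes>\<^bsub>B\<^esub> (x \<otimes>\<^bsub>B\<^esub> c)" by (auto simp: fraction_at_def)
  then have "f (u \<otimes>\<^bsub>B\<^esub> (b \<otimes>\<^bsub>B\<^esub> y)) = f (u \<otimes>\<^bsub>B\<^esub> (x \<otimes>\<^bsub>B\<^esub> c))" by simp
  then have "f u \<otimes>\<^bsub>A\<^esub> (f b \<otimes>\<^bsub>A\<^esub> f y) = f u \<otimes>\<^bsub>A\<^esub> (f x \<otimes>\<^bsub>A\<^esub> f c)"
    using z(2-4) assms by (simp add: mult)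
  then show "z \<in> fraction_at A P (f b) (f c)"
    using z closed by (auto simp: fraction_at_def pull_def)
qed

definition pull_section :: "'b set set \<Rightarrow> ('b set \<Rightarrow> ('b \<times> 'b) set) \<Rightarrow> 'a set \<Rightarrow> ('a \<times> 'a) set" where
  "pull_section V t = (\<lambda>P\<in>{P \<in> spec_points A. pull P \<in> V}. map_prod f f ` t (pull P))"

text \<open>Operations on germs are unions over all pairs of representatives, and images commute
  with unions, so everything reduces to \<open>fraction_at_pull\<close>.\<close>

lemma local_ring_mult_pull:
  assumes P: "P \<in> spec_points A" and x: "x \<subseteq> carrier B \<times> carrier B" and y: "y \<subseteq> carrier B \<times> carrier B"
  shows "map_prod f f ` (x \<otimes>\<^bsub>local_ring_at B (pull P)\<^esub> y)
      = (map_prod f f ` x) \<otimes>\<^bsub>local_ring_at A P\<^esub> (map_prod f f ` y)"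
proof -
  have "map_prod f f ` fraction_at B (pull P) (a \<otimes>\<^bsub>B\<^esub> b) (c \<otimes>\<^bsub>B\<^esub> d)
      = fraction_at A P (f a \<otimes>\<^bsub>A\<^esub> f b) (f c \<otimes>\<^bsub>A\<^esub> f d)"
    if "(a, c) \<in> x" "(b, d) \<in> y" for a b c d
    using subsetD[OF x that(1)] subsetD[OF y that(2)]
    by (simp add: fraction_at_pull[OF P, symmetric] mult)
  then show ?thesis
    by (simp add: local_ring_at_def image_UN split_beta)
qed

lemma local_ring_add_pull:
  assumes P: "P \<in> spec_points A" and x: "x \<subseteq> carrier B \<times> carrier B" and y: "y \<subseteq> carrier B \<times> carrier B"
  shows "map_prod f f ` (x \<oplus>\<^bsub>local_ring_at B (pull P)\<^esub> y)
      = (map_prod f f ` x) \<oplus>\<^bsub>local_ring_at A P\<^esub> (map_prod f f ` y)"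
proof -
  have "map_prod f f ` fraction_at B (pull P) ((a \<otimes>\<^bsub>B\<^esub> d) \<oplus>\<^bsub>B\<^esub> (b \<otimes>\<^bsub>B\<^esub> c)) (c \<otimes>\<^bsub>B\<^esub> d)
      = fraction_at A P ((f a \<otimes>\<^bsub>A\<^esub> f d) \<oplus>\<^bsub>A\<^esub> (f b \<otimes>\<^bsub>A\<^esub> f c)) (f c \<otimes>\<^bsub>A\<^esub> f d)"
    if "(a, c) \<in> x" "(b, d) \<in> y" for a b c d
    using subsetD[OF x that(1)] subsetD[OF y that(2)]
    by (simp add: fraction_at_pull[OF P, symmetric] mult add)
  then show ?thesis
    by (simp add: local_ring_at_def image_UN split_beta)
qed

lemma section_value_subset:
  assumes "t \<in> regular_sections B V" "Q \<in> V" shows "t Q \<subseteq> carrier B \<times> carrier B"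
proof -
  from assms obtain b c where "t Q = fraction_at B Q b c" unfolding regular_sections_def by blast
  then show ?thesis by (auto simp: fraction_at_def)
qed

lemma pull_section_regular:
  assumes top: "topspace (zariski A) = spec_points A" and t: "t \<in> regular_sections B V"
  shows "pull_section V t \<in> regular_sections A {P \<in> spec_points A. pull P \<in> V}"
  unfolding regular_sections_def
proof (intro CollectI conjI ballI)
  show "pull_section V t \<in> extensional {P \<in> spec_points A. pull P \<in> V}"
    by (simp add: pull_section_def)
next
  fix P assume P: "P \<in> {P \<in> spec_points A. pull P \<in> V}"
  then obtain W b c where W: "openin (zariski B) W" "pull P \<in> W" "W \<subseteq> V" "b \<in> carrier B" "c \<in> carrier B"
    "\<forall>Q\<in>W. c \<notin> Q \<and> t Q = fraction_at B Q b c"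
    using t unfolding regular_sections_def by blast
  show "\<exists>W a c. openin (zariski A) W \<and> P \<in> W \<and> W \<subseteq> {P \<in> spec_points A. pull P \<in> V} \<and>
      a \<in> carrier A \<and> c \<in> carrier A \<and> (\<forall>Q\<in>W. c \<notin> Q \<and> pull_section V t Q = fraction_at A Q a c)"
  proof (intro exI conjI ballI)
    show "openin (zariski A) {P \<in> spec_points A. pull P \<in> W}"
      using openin_continuous_map_preimage[OF pull_continuous[OF top] W(1)] by (simp add: top)
    show "f b \<in> carrier A" "f c \<in> carrier A" using W closed by auto
    fix Q assume Q: "Q \<in> {P \<in> spec_points A. pull P \<in> W}"
    then show "f c \<notin> Q" using W by (auto simp: pull_def)
    show "pull_section V t Q = fraction_at A Q (f b) (f c)"
      using Q W fraction_at_pull[of Q b c] by (auto simp: pull_section_def)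
  qed (use P W in auto)
qed

lemma pull_section_hom:
  assumes top: "topspace (zariski A) = spec_points A" and V: "V \<subseteq> spec_points B"
  shows "pull_section V \<in> ring_hom (section_ring B V) (section_ring A {P \<in> spec_points A. pull P \<in> V})"
proof (rule ring_hom_memI)
  fix t assume "t \<in> carrier (section_ring B V)"
  then show "pull_section V t \<in> carrier (section_ring A {P \<in> spec_points A. pull P \<in> V})"
    using pull_section_regular[OF top] by (simp add: section_ring_def)
next
  fix t u assume "t \<in> carrier (section_ring B V)" "u \<in> carrier (section_ring B V)"
  then have *: "t Q \<subseteq> carrier B \<times> carrier B" "u Q \<subseteq> carrier B \<times> carrier B" if "Q \<in> V" for Q
    using section_value_subset that by (auto simp: section_ring_def)
  show "pull_section V (t \<otimes>\<^bsub>section_ring B V\<^esub> u) = pull_section V t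
      \<otimes>\<^bsub>section_ring A {P \<in> spec_points A. pull P \<in> V}\<^esub> pull_section V u"
    unfolding section_ring_def pull_section_def
    by (simp, intro restrict_ext) (simp add: local_ring_mult_pull *)
  show "pull_section V (t \<oplus>\<^bsub>section_ring B V\<^esub> u) = pull_section V t
      \<oplus>\<^bsub>section_ring A {P \<in> spec_points A. pull P \<in> V}\<^esub> pull_section V u"
    unfolding section_ring_def pull_section_def
    by (simp, intro restrict_ext) (simp add: local_ring_add_pull *)
next
  show "pull_section V \<one>\<^bsub>section_ring B V\<^esub> = \<one>\<^bsub>section_ring A {P \<in> spec_points A. pull P \<in> V}\<^esub>"
    unfolding section_ring_def pull_section_def local_ring_at_def
    by (simp, intro restrict_ext) (simp add: fraction_at_pull[symmetric] flip: one)
qed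

end

text \<open>The locale is interpreted for f and for its inverse g. The two maps on points, and the
  two maps on sections, are inverse to each other, so each interpretation supplies the continuity
  and regularity of the inverse that the other one needs.\<close>

lemma Spec_isomorphic:
  fixes A :: "('k, 'a) calg" and B :: "('k, 'b) calg"
  assumes "cring A" "cring B" "f \<in> ring_iso B A"
    and scalars: "\<And>c. c \<in> carrier k \<Longrightarrow> scalar_map B c \<in> carrier B \<and> f (scalar_map B c) = scalar_map A c"
  shows "isomorphic_over k (Spec A) (Spec B)"
proof -
  define g where "g = inv_into (carrier B) f"
  interpret F: cring_isomorphism A B f
    using assms by (simp add: cring_isomorphism_def cring_isomorphism_axioms_def)
  interpret F': cring_isomorphism B A g
    using assms ring_iso_set_sym[OF cring.axioms(1)[OF assms(2)] assms(3)]
    by (simp add: cring_isomorphism_def cring_isomorphism_axioms_def g_def)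
  have gf: "g (f b) = b" if "b \<in> carrier B" for b
    using that F.bij by (simp add: g_def bij_betw_def)
  have fg: "f (g a) = a" if "a \<in> carrier A" for a
    using that F.bij by (simp add: g_def bij_betw_inv_into_right)
  have spec_carrier: "P \<subseteq> carrier A" if "P \<in> spec_points A" for P
    using that additive_subgroup.a_subset[OF ideal.axioms(1)[OF primeideal.axioms(1)]]
    by (auto simp: spec_points_def)
  have spec_carrier': "P \<subseteq> carrier B" if "P \<in> spec_points B" for P
    using that additive_subgroup.a_subset[OF ideal.axioms(1)[OF primeideal.axioms(1)]]
    by (auto simp: spec_points_def)
  have pull_pull: "F'.pull (F.pull P) = P" if "P \<in> spec_points A" for P
    using spec_carrier[OF that] fg F'.closed by (auto simp: F.pull_def F'.pull_def)
  have pull_pull': "F.pull (F'.pull P) = P" if "P \<in> spec_points B" for P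
    using spec_carrier'[OF that] gf F.closed by (auto simp: F.pull_def F'.pull_def)
  note top = F'.topspace_zariski and top' = F.topspace_zariski
  have homeo: "homeomorphic_map (zariski A) (zariski B) F.pull"
    unfolding homeomorphic_map_maps homeomorphic_maps_def
    using F.pull_continuous[OF top] F'.pull_continuous[OF top'] pull_pull pull_pull' top top'
    by (intro exI[of _ F'.pull]) auto
  have images: "map_prod g g ` map_prod f f ` x = x" if "x \<subseteq> carrier B \<times> carrier B" for x
  proof -
    have "map_prod g g (map_prod f f z) = z" if "z \<in> x" for z
      using that \<open>x \<subseteq> _\<close> gf by (cases z) auto
    then show ?thesis by (simp add: image_image)
  qed
  have images': "map_prod f f ` map_prod g g ` x = x" if "x \<subseteq> carrier A \<times> carrier A" for x
  proof -
    have "map_prod f f (map_prod g g z) = z" if "z \<in> x" for z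
      using that \<open>x \<subseteq> _\<close> fg by (cases z) auto
    then show ?thesis by (simp add: image_image)
  qed
  let ?pre = "\<lambda>V. {P \<in> spec_points A. F.pull P \<in> V}"
  have iso: "F.pull_section V \<in> ring_iso (section_ring B V) (section_ring A (?pre V))"
    if V: "V \<subseteq> spec_points B" for V
  proof -
    have pre_pre: "{Q \<in> spec_points B. F'.pull Q \<in> ?pre V} = V"
      using V F'.pull_spec pull_pull' by auto
    have "F'.pull_section (?pre V) u \<in> carrier (section_ring B V)"
      if "u \<in> carrier (section_ring A (?pre V))" for u
      using F'.pull_section_regular[OF top', of u "?pre V"] that unfolding pre_pre by (simp add: section_ring_def)
    moreover have "F'.pull_section (?pre V) (F.pull_section V t) = t" if "t \<in> carrier (section_ring B V)" for t
    proof (rule extensionalityI[of _ V])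
      have t: "t \<in> regular_sections B V" using that by (simp add: section_ring_def)
      then show "t \<in> extensional V" by (simp add: regular_sections_def)
      show "F'.pull_section (?pre V) (F.pull_section V t) \<in> extensional V"
        unfolding F'.pull_section_def pre_pre by simp
      fix Q assume Q: "Q \<in> V"
      then have "Q \<in> spec_points B" using V by auto
      then show "F'.pull_section (?pre V) (F.pull_section V t) Q = t Q"
        using Q images[OF F.section_value_subset[OF t Q]]
        by (simp add: F'.pull_section_def F.pull_section_def pull_pull' F'.pull_spec)
    qed
    moreover have "F.pull_section V (F'.pull_section (?pre V) u) = u"
      if "u \<in> carrier (section_ring A (?pre V))" for u
    proof (rule extensionalityI[of _ "?pre V"])
      have u: "u \<in> regular_sections A (?pre V)" using that by (simp add: section_ring_def)
      then show "u \<in> extensional (?pre V)" by (simp add: regular_sections_def)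
      show "F.pull_section V (F'.pull_section (?pre V) u) \<in> extensional (?pre V)"
        by (simp add: F.pull_section_def)
      fix Q assume Q: "Q \<in> ?pre V"
      then show "F.pull_section V (F'.pull_section (?pre V) u) Q = u Q"
        using images'[OF F'.section_value_subset[OF u Q]]
        by (simp add: F'.pull_section_def F.pull_section_def pull_pull F.pull_spec)
    qed
    moreover have "F.pull_section V t \<in> carrier (section_ring A (?pre V))" if "t \<in> carrier (section_ring B V)" for t
      using that F.pull_section_regular[OF top] by (simp add: section_ring_def)
    ultimately have "bij_betw (F.pull_section V) (carrier (section_ring B V)) (carrier (section_ring A (?pre V)))"
      by (intro bij_betwI[of _ _ _ "F'.pull_section (?pre V)"]) auto
    then show ?thesis using F.pull_section_hom[OF top V] by (simp add: ring_iso_def)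
  qed
  have subset: "V \<subseteq> spec_points B" if "openin (zariski B) V" for V
    using openin_subset[OF that] by (simp add: top')
  show ?thesis
    unfolding isomorphic_over_def Spec_def
  proof (intro exI[of _ F.pull] exI[of _ F.pull_section] conjI allI impI ballI)
    show "homeomorphic_map (pts \<lparr>pts = zariski A, sect = section_ring A, restr = \<lambda>W t. restrict t W,
          scalars = \<lambda>c. \<lambda>P\<in>spec_points A. fraction_at A P (scalar_map A c) \<one>\<^bsub>A\<^esub>\<rparr>)
       (pts \<lparr>pts = zariski B, sect = section_ring B, restr = \<lambda>W t. restrict t W,
          scalars = \<lambda>c. \<lambda>P\<in>spec_points B. fraction_at B P (scalar_map B c) \<one>\<^bsub>B\<^esub>\<rparr>) F.pull"
      using homeo by simp
  next
    fix V assume "openin (pts \<lparr>pts = zariski B, sect = section_ring B, restr = \<lambda>W t. restrict t W,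
          scalars = \<lambda>c. \<lambda>P\<in>spec_points B. fraction_at B P (scalar_map B c) \<one>\<^bsub>B\<^esub>\<rparr>) V"
    then show "F.pull_section V \<in> ring_iso (sect \<lparr>pts = zariski B, sect = section_ring B, restr = \<lambda>W t. restrict t W,
          scalars = \<lambda>c. \<lambda>P\<in>spec_points B. fraction_at B P (scalar_map B c) \<one>\<^bsub>B\<^esub>\<rparr> V)
        (sect \<lparr>pts = zariski A, sect = section_ring A, restr = \<lambda>W t. restrict t W,
          scalars = \<lambda>c. \<lambda>P\<in>spec_points A. fraction_at A P (scalar_map A c) \<one>\<^bsub>A\<^esub>\<rparr>
        {p \<in> topspace (pts \<lparr>pts = zariski A, sect = section_ring A, restr = \<lambda>W t. restrict t W,
          scalars = \<lambda>c. \<lambda>P\<in>spec_points A. fraction_at A P (scalar_map A c) \<one>\<^bsub>A\<^esub>\<rparr>). F.pull p \<in> V})"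
      using iso[OF subset[of V]] by (simp add: top)
  qed (auto simp: F.pull_section_def top top' F.pull_spec F.fraction_at_pull[symmetric] scalars
      fun_eq_iff restrict_def simp flip: F.one)
qed

section \<open>Tensor products of commutative algebras\<close>

lemma with_scalar_map_simps [simp]:
  "carrier (with_scalar_map A \<phi>) = carrier A"
  "monoid.mult (with_scalar_map A \<phi>) = monoid.mult A"
  "one (with_scalar_map A \<phi>) = one A"
  "ring.zero (with_scalar_map A \<phi>) = ring.zero A"
  "add (with_scalar_map A \<phi>) = add A"
  "scalar_map (with_scalar_map A \<phi>) = \<phi>"
  by (simp_all add: with_scalar_map_def)

lemma cring_with_scalar_map:
  assumes "cring A" shows "cring (with_scalar_map A \<phi>)"
proof -
  interpret cring A by fact
  show ?thesis
    by (intro cringI abelian_groupI comm_monoidI)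
      (auto simp: a_ac m_ac l_distr r_distr intro: l_neg bexI[of _ "\<ominus>\<^bsub>A\<^esub> _"])
qed

lemma ring_hom_with_scalar_map [simp]:
  "ring_hom (with_scalar_map A \<phi>) S = ring_hom A S"
  "ring_hom R (with_scalar_map A \<phi>) = ring_hom R A"
  by (simp_all add: ring_hom_def)

lemma coset_with_scalar_map [simp]:
  "I +>\<^bsub>with_scalar_map A \<phi>\<^esub> x = I +>\<^bsub>A\<^esub> x"
  by (simp add: a_r_coset_def r_coset_def)

lemma quotient_lift:
  assumes "ideal I R" "ring S" "h0 \<in> ring_hom R S" "\<And>i. i \<in> I \<Longrightarrow> h0 i = \<zero>\<^bsub>S\<^esub>"
  obtains h where "h \<in> ring_hom (R Quot I) S" "\<And>x. x \<in> carrier R \<Longrightarrow> h (I +>\<^bsub>R\<^esub> x) = h0 x"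
proof -
  interpret I: ideal I R by fact
  interpret S: ring S by fact
  interpret H: ring_hom_ring R S h0
    by (rule ring_hom_ringI2[OF I.ring_axioms assms(2,3)])
  \<comment> \<open>Evaluation at an arbitrary representative: two representatives differ by an
    element of I, which h0 kills.\<close>
  define h where "h = (\<lambda>Y. h0 (SOME p. p \<in> Y))"
  have h: "h (I +>\<^bsub>R\<^esub> x) = h0 x" if x: "x \<in> carrier R" for x
  proof -
    have "x \<in> I +>\<^bsub>R\<^esub> x" using x by (rule I.a_rcos_self)
    then have "(SOME p. p \<in> I +>\<^bsub>R\<^esub> x) \<in> I +>\<^bsub>R\<^esub> x" by (rule someI)
    then obtain i where i: "i \<in> I" "(SOME p. p \<in> I +>\<^bsub>R\<^esub> x) = i \<oplus>\<^bsub>R\<^esub> x"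
      by (auto simp: a_r_coset_def')
    then show ?thesis using x assms(4)[OF i(1)] by (simp add: h_def I.Icarr)
  qed
  have "h \<in> ring_hom (R Quot I) S"
  proof (rule ring_hom_memI)
    fix x assume "x \<in> carrier (R Quot I)"
    then obtain p where "p \<in> carrier R" "x = I +>\<^bsub>R\<^esub> p" by (auto simp: FactRing_simps)
    then show "h x \<in> carrier S" by (simp add: h)
  next
    fix x y assume "x \<in> carrier (R Quot I)" "y \<in> carrier (R Quot I)"
    then obtain p q where pq: "p \<in> carrier R" "x = I +>\<^bsub>R\<^esub> p" "q \<in> carrier R" "y = I +>\<^bsub>R\<^esub> q"
      by (auto simp: FactRing_simps)
    show "h (x \<otimes>\<^bsub>R Quot I\<^esub> y) = h x \<otimes>\<^bsub>S\<^esub> h y"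
      using pq by (simp add: FactRing_def I.rcoset_mult_add h)
    show "h (x \<oplus>\<^bsub>R Quot I\<^esub> y) = h x \<oplus>\<^bsub>S\<^esub> h y"
      using pq by (simp add: FactRing_def I.a_rcos_sum h)
  next
    show "h \<one>\<^bsub>R Quot I\<^esub> = \<one>\<^bsub>S\<^esub>" by (simp add: FactRing_def h)
  qed
  then show ?thesis using h that by blast
qed

lemma carrier_quotientE:
  assumes "x \<in> carrier (R Quot I)"
  obtains p where "p \<in> carrier R" "x = I +>\<^bsub>R\<^esub> p"
  using assms by (auto simp: FactRing_simps)

lemma frag_extend_diff_fun:
  fixes f g :: "'b \<Rightarrow> 'c \<Rightarrow>\<^sub>0 int"
  shows "frag_extend (\<lambda>u. f u - g u) p = frag_extend f p - frag_extend g p"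
proof -
  have "frag_cmul c (a - b) = frag_cmul c a - frag_cmul c b" for c and a b :: "'c \<Rightarrow>\<^sub>0 int"
    by (rule poly_mapping_eqI) (simp add: lookup_minus right_diff_distrib)
  then show ?thesis by (simp add: frag_extend_def sum_subtractf)
qed

section \<open>The ring of integer combinations of pairs\<close>

locale cring_pair = A: cring A + B: cring B
  for A :: "('a, 'm) ring_scheme" and B :: "('b, 'n) ring_scheme"
begin

abbreviation M where "M \<equiv> pair_ring A B"

definition pair_mult :: "'a \<times> 'b \<Rightarrow> 'a \<times> 'b \<Rightarrow> 'a \<times> 'b" where
  "pair_mult u v = (fst u \<otimes>\<^bsub>A\<^esub> fst v, snd u \<otimes>\<^bsub>B\<^esub> snd v)"

lemma pair_ring_simps:
  "carrier M = {p. Poly_Mapping.keys p \<subseteq> carrier A \<times> carrier B}"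
  "one M = frag_of (\<one>\<^bsub>A\<^esub>, \<one>\<^bsub>B\<^esub>)" "ring.zero M = 0" "add M = (+)"
  by (simp_all add: pair_ring_def)

text \<open>As an iterated \<open>frag_extend\<close> the multiplication is additive in each
  argument, so the ring laws have to be checked on generators only.\<close>

lemma pair_ring_mult:
  "p \<otimes>\<^bsub>M\<^esub> q = frag_extend (\<lambda>u. frag_extend (\<lambda>v. frag_of (pair_mult u v)) q) p"
proof -
  have "frag_cmul c (Poly_Mapping.single x d) = Poly_Mapping.single x (c * d)" for c d and x :: "'a \<times> 'b"
    by (rule poly_mapping_eqI) (simp add: lookup_single when_def)
  then show ?thesis
    by (simp add: pair_ring_def frag_extend_def pair_mult_def frag_cmul_sum)
qed

lemma mult_frag_of: "frag_of u \<otimes>\<^bsub>M\<^esub> frag_of v = frag_of (pair_mult u v)"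
  by (simp add: pair_ring_mult)

lemma mult_diff_left: "(p - p') \<otimes>\<^bsub>M\<^esub> q = p \<otimes>\<^bsub>M\<^esub> q - p' \<otimes>\<^bsub>M\<^esub> q"
  by (simp add: pair_ring_mult frag_extend_diff)

lemma mult_diff_right: "p \<otimes>\<^bsub>M\<^esub> (q - q') = p \<otimes>\<^bsub>M\<^esub> q - p \<otimes>\<^bsub>M\<^esub> q'"
  by (simp add: pair_ring_mult frag_extend_diff frag_extend_diff_fun)

lemma mult_0_left: "0 \<otimes>\<^bsub>M\<^esub> q = 0" and mult_0_right: "p \<otimes>\<^bsub>M\<^esub> 0 = 0"
  using mult_diff_left[of 0 0 q] mult_diff_right[of p 0 0] by simp_all

lemma mult_minus_left: "(- p) \<otimes>\<^bsub>M\<^esub> q = - (p \<otimes>\<^bsub>M\<^esub> q)"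
  using mult_diff_left[of 0 p q] by (simp add: mult_0_left)

lemma mult_add_left: "(p + p') \<otimes>\<^bsub>M\<^esub> q = p \<otimes>\<^bsub>M\<^esub> q + p' \<otimes>\<^bsub>M\<^esub> q"
  using mult_diff_left[of p "- p'" q] by (simp add: mult_minus_left)

lemma mult_closed: "p \<in> carrier M \<Longrightarrow> q \<in> carrier M \<Longrightarrow> p \<otimes>\<^bsub>M\<^esub> q \<in> carrier M"
  unfolding pair_ring_simps pair_ring_mult mem_Collect_eq
  by (rule order_trans[OF keys_frag_extend], rule UN_least, rule order_trans[OF keys_frag_extend], rule UN_least)
    (auto simp: keys_frag_of pair_mult_def dest!: subsetD)

lemma carrier_induct [consumes 1, case_names zero gen diff]:
  assumes "p \<in> carrier M" "P 0" "\<And>u. u \<in> carrier A \<times> carrier B \<Longrightarrow> P (frag_of u)"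
    "\<And>p q. P p \<Longrightarrow> P q \<Longrightarrow> P (p - q)"
  shows "P p"
  using assms(1) unfolding pair_ring_simps mem_Collect_eq
  by (rule frag_induction) (use assms in auto)

lemma mult_comm: "p \<in> carrier M \<Longrightarrow> q \<in> carrier M \<Longrightarrow> p \<otimes>\<^bsub>M\<^esub> q = q \<otimes>\<^bsub>M\<^esub> p"
proof (induction p rule: carrier_induct)
  case (gen u)
  from gen(2,1) show ?case
    by (induction q rule: carrier_induct)
      (auto simp: mult_frag_of mult_diff_left mult_diff_right mult_0_left mult_0_right pair_mult_def
        A.m_comm B.m_comm)
qed (auto simp: mult_diff_left mult_diff_right mult_0_left mult_0_right)

lemma mult_assoc:
  "p \<in> carrier M \<Longrightarrow> q \<in> carrier M \<Longrightarrow> r \<in> carrier M \<Longrightarrow> p \<otimes>\<^bsub>M\<^esub> q \<otimes>\<^bsub>M\<^esub> r = p \<otimes>\<^bsub>M\<^esub> (q \<otimes>\<^bsub>M\<^esub> r)"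
proof (induction p rule: carrier_induct)
  case (gen u)
  from gen(2,1,3) show ?case
  proof (induction q rule: carrier_induct)
    case (gen v)
    from gen(3,1,2) show ?case
      by (induction r rule: carrier_induct)
        (auto simp: mult_frag_of mult_diff_left mult_diff_right mult_0_left mult_0_right pair_mult_def
          A.m_assoc B.m_assoc)
  qed (auto simp: mult_diff_left mult_diff_right mult_0_left mult_0_right)
qed (auto simp: mult_diff_left mult_diff_right mult_0_left mult_0_right)

lemma mult_one: "p \<in> carrier M \<Longrightarrow> frag_of (\<one>\<^bsub>A\<^esub>, \<one>\<^bsub>B\<^esub>) \<otimes>\<^bsub>M\<^esub> p = p"
  by (induction p rule: carrier_induct)
    (auto simp: mult_frag_of mult_diff_right mult_0_right pair_mult_def)

lemma cring_pair_ring: "cring M"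
proof (rule cringI)
  show "abelian_group M"
  proof (rule abelian_groupI)
    fix p assume "p \<in> carrier M"
    then show "\<exists>q\<in>carrier M. q \<oplus>\<^bsub>M\<^esub> p = \<zero>\<^bsub>M\<^esub>"
      by (intro bexI[of _ "- p"]) (auto simp: pair_ring_simps)
  qed (auto simp: pair_ring_simps algebra_simps dest!: subsetD[OF keys_add])
  show "comm_monoid M"
    by (rule comm_monoidI)
      (use mult_closed mult_comm mult_assoc mult_one in \<open>auto simp: pair_ring_simps(2)\<close>,
       auto simp: pair_ring_simps keys_frag_of)
  show "(p \<oplus>\<^bsub>M\<^esub> q) \<otimes>\<^bsub>M\<^esub> r = p \<otimes>\<^bsub>M\<^esub> r \<oplus>\<^bsub>M\<^esub> q \<otimes>\<^bsub>M\<^esub> r" for p q r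
    by (simp add: pair_ring_simps mult_add_left)
qed

sublocale M: cring M by (rule cring_pair_ring)

lemma a_inv_pair_ring: "p \<in> carrier M \<Longrightarrow> \<ominus>\<^bsub>M\<^esub> p = - p"
  using M.minus_equality[of "- p" p] by (simp add: pair_ring_simps)

lemma minus_pair_ring: "p \<in> carrier M \<Longrightarrow> q \<in> carrier M \<Longrightarrow> p \<ominus>\<^bsub>M\<^esub> q = p - q"
  by (simp add: M.minus_eq a_inv_pair_ring) (simp add: pair_ring_simps)

text \<open>Additively this is the universal property of the free abelian group. Both sides of
  multiplicativity are biadditive, so it is checked on pairs of generators, where commutativity of C
  rearranges the four factors.\<close>

lemma pair_ring_hom:
  assumes "cring C" "\<alpha> \<in> ring_hom A C" "\<beta> \<in> ring_hom B C"
  obtains h where "h \<in> ring_hom M C" "\<And>a b. a \<in> carrier A \<Longrightarrow> b \<in> carrier B \<Longrightarrow>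
      h (frag_of (a, b)) = \<alpha> a \<otimes>\<^bsub>C\<^esub> \<beta> b"
proof -
  interpret C: cring C by fact
  note \<alpha> = ring_hom_memE[OF assms(2)] and \<beta> = ring_hom_memE[OF assms(3)]
  have "comm_group (add_monoid C)" by (rule C.a_comm_group)
  moreover have "(\<lambda>(a, b). \<alpha> a \<otimes>\<^bsub>C\<^esub> \<beta> b) ` (carrier A \<times> carrier B) \<subseteq> carrier (add_monoid C)"
    using \<alpha> \<beta> by auto
  ultimately obtain h where h: "h \<in> hom (free_Abelian_group (carrier A \<times> carrier B)) (add_monoid C)"
    "\<And>u. u \<in> carrier A \<times> carrier B \<Longrightarrow> h (frag_of u) = (case u of (a, b) \<Rightarrow> \<alpha> a \<otimes>\<^bsub>C\<^esub> \<beta> b)"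
    using comm_group.free_Abelian_group_universal[of "add_monoid C" "\<lambda>(a, b). \<alpha> a \<otimes>\<^bsub>C\<^esub> \<beta> b" "carrier A \<times> carrier B"]
    by metis
  have closed: "h p \<in> carrier C" if "p \<in> carrier M" for p
    using that h(1) by (auto simp: hom_def pair_ring_simps Pi_iff)
  have add: "h (p + q) = h p \<oplus>\<^bsub>C\<^esub> h q" if "p \<in> carrier M" "q \<in> carrier M" for p q
    using that h(1) by (simp add: hom_def pair_ring_simps)
  have h0: "h 0 = \<zero>\<^bsub>C\<^esub>"
    using add[of 0 0] closed[of 0] C.add.r_cancel_one' by (force simp: pair_ring_simps)
  have diff: "h (p - q) = h p \<ominus>\<^bsub>C\<^esub> h q" if pq: "p \<in> carrier M" "q \<in> carrier M" for p q
  proof -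
    have "p - q \<in> carrier M" using M.minus_closed[OF pq] minus_pair_ring pq by simp
    then have "h p = h (p - q) \<oplus>\<^bsub>C\<^esub> h q" using add[of "p - q" q] pq by simp
    then show ?thesis using closed pq \<open>p - q \<in> carrier M\<close> by (simp add: C.minus_eq C.a_assoc C.r_neg)
  qed
  have diff_closed: "p - q \<in> carrier M" if "p \<in> carrier M" "q \<in> carrier M" for p q
    using M.minus_closed minus_pair_ring that by metis
  have gen_closed: "frag_of u \<in> carrier M" if "u \<in> carrier A \<times> carrier B" for u
    using that by (simp add: pair_ring_simps keys_frag_of)
  have mult: "h (p \<otimes>\<^bsub>M\<^esub> q) = h p \<otimes>\<^bsub>C\<^esub> h q" if "p \<in> carrier M" "q \<in> carrier M" for p q
  proof -
    \<comment> \<open>Membership is carried along because the difference case of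
      \<open>carrier_induct\<close> supplies nothing but the two induction hypotheses.\<close>
    have "p \<in> carrier M \<and> h (p \<otimes>\<^bsub>M\<^esub> q) = h p \<otimes>\<^bsub>C\<^esub> h q" using that(1)
    proof (induction p rule: carrier_induct)
      case zero
      show ?case using closed[OF that(2)] by (simp add: h0 mult_0_left) (simp add: pair_ring_simps)
    next
      case (diff p p')
      then show ?case using that(2) closed
        by (simp add: mult_diff_left \<open>\<And>p q. _ \<Longrightarrow> _ \<Longrightarrow> h (p - q) = _\<close> diff_closed mult_closed)
          (simp add: C.minus_eq C.l_distr C.l_minus)
    next
      case (gen u)
      have "q \<in> carrier M \<and> h (frag_of u \<otimes>\<^bsub>M\<^esub> q) = h (frag_of u) \<otimes>\<^bsub>C\<^esub> h q" using that(2)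
      proof (induction q rule: carrier_induct)
        case zero
        show ?case using closed[OF gen_closed[OF gen]] by (simp add: h0 mult_0_right) (simp add: pair_ring_simps)
      next
        case (diff p p')
        then show ?case using gen_closed[OF gen] closed
          by (simp add: mult_diff_right \<open>\<And>p q. _ \<Longrightarrow> _ \<Longrightarrow> h (p - q) = _\<close> diff_closed mult_closed)
            (simp add: C.minus_eq C.r_distr C.r_minus)
      next
        case (gen v)
        obtain a b a' b' where uv: "u = (a, b)" "v = (a', b')" by (metis surj_pair)
        show ?case using \<open>u \<in> _\<close> gen uv \<alpha> \<beta> gen_closed
          by (simp add: mult_frag_of pair_mult_def h(2) C.m_ac)
      qed
      then show ?case using gen gen_closed by auto
    qed
    then show ?thesis by blast
  qed
  have "h \<in> ring_hom M C"
    using closed add mult h(2)[of "(\<one>\<^bsub>A\<^esub>, \<one>\<^bsub>B\<^esub>)"] \<alpha>(4) \<beta>(4)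
    by (intro ring_hom_memI) (auto simp: pair_ring_simps(2,4))
  then show ?thesis using h(2) by (intro that) auto
qed

end

lemma ring_hom_add_pow_int:
  assumes "ring A" "ring C" "\<alpha> \<in> ring_hom A C" "a \<in> carrier A"
  shows "\<alpha> (add_pow A (n::int) a) = add_pow C n (\<alpha> a)"
proof -
  interpret H: ring_hom_ring A C \<alpha> by (rule ring_hom_ringI2[OF assms(1-3)])
  have nat: "\<alpha> (add_pow A (m::nat) a) = add_pow C m (\<alpha> a)" for m
    by (induction m) (simp_all add: assms(4))
  show ?thesis
  proof (cases "n \<ge> 0")
    case True then show ?thesis by (simp add: add_pow_int_ge nat)
  next
    case False then show ?thesis by (simp add: add_pow_int_lt nat assms(4))
  qed
qed

section \<open>The universal property of the tensor product\<close>

locale tensor_product = cring_pair A B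
  for A :: "('r, 'a) calg" and B :: "('r, 'b) calg" +
  fixes R :: "('r, 'l) ring_scheme"
  assumes scalar_A: "r \<in> carrier R \<Longrightarrow> scalar_map A r \<in> carrier A"
    and scalar_B: "r \<in> carrier R \<Longrightarrow> scalar_map B r \<in> carrier B"
begin

abbreviation T where "T \<equiv> tensor_alg R A B"
abbreviation J where "J \<equiv> tensor_ideal R A B"
abbreviation pure where "pure \<equiv> pure_tensor R A B"

lemma gen_closed: "a \<in> carrier A \<Longrightarrow> b \<in> carrier B \<Longrightarrow> frag_of (a, b) \<in> carrier M"
  by (simp add: pair_ring_simps keys_frag_of)

lemma diff_closed: "p \<in> carrier M \<Longrightarrow> q \<in> carrier M \<Longrightarrow> p - q \<in> carrier M"
  using M.minus_closed minus_pair_ring by metis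

lemma relations_closed: "bilinear_relations R A B \<subseteq> carrier M"
  unfolding bilinear_relations_def
  by (auto intro!: diff_closed gen_closed simp: scalar_A scalar_B)

lemma ideal_J: "ideal J M"
  unfolding tensor_ideal_def by (rule M.genideal_ideal[OF relations_closed])

sublocale J: ideal J M by (rule ideal_J)

lemma relations_J: "bilinear_relations R A B \<subseteq> J"
  unfolding tensor_ideal_def by (rule M.genideal_self[OF relations_closed])

lemma cring_T: "cring T"
  unfolding tensor_alg_def by (intro cring_with_scalar_map J.quotient_is_cring cring_pair_ring)

sublocale T: cring T by (rule cring_T)

lemma T_simps:
  "carrier T = carrier (M Quot J)" "monoid.mult T = monoid.mult (M Quot J)" "add T = add (M Quot J)"
  "one T = one (M Quot J)" "ring.zero T = J"
  by (simp_all add: tensor_alg_def FactRing_def)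

lemma scalar_map_T: "scalar_map T r = pure (scalar_map A r) \<one>\<^bsub>B\<^esub>"
  by (simp add: tensor_alg_def)

lemma pure_closed: "a \<in> carrier A \<Longrightarrow> b \<in> carrier B \<Longrightarrow> pure a b \<in> carrier T"
  unfolding pure_tensor_def T_simps by (simp add: FactRing_def M.a_rcosetsI J.a_subset gen_closed)

lemma pure_mult: "a \<in> carrier A \<Longrightarrow> b \<in> carrier B \<Longrightarrow> a' \<in> carrier A \<Longrightarrow> b' \<in> carrier B \<Longrightarrow>
    pure a b \<otimes>\<^bsub>T\<^esub> pure a' b' = pure (a \<otimes>\<^bsub>A\<^esub> a') (b \<otimes>\<^bsub>B\<^esub> b')"
  by (simp add: pure_tensor_def T_simps FactRing_def J.rcoset_mult_add gen_closed mult_frag_of pair_mult_def)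

lemma pure_one: "pure \<one>\<^bsub>A\<^esub> \<one>\<^bsub>B\<^esub> = \<one>\<^bsub>T\<^esub>"
  by (simp add: pure_tensor_def T_simps FactRing_def pair_ring_simps)

lemma coset_eqI:
  assumes "p - q \<in> J" "p \<in> carrier M" "q \<in> carrier M" shows "J +>\<^bsub>M\<^esub> p = J +>\<^bsub>M\<^esub> q"
  using M.quotient_eq_iff_same_a_r_cos[OF ideal_J assms(2,3)] assms by (simp add: minus_pair_ring)

lemma sum_coset: "p \<in> carrier M \<Longrightarrow> q \<in> carrier M \<Longrightarrow>
    (J +>\<^bsub>M\<^esub> p) \<oplus>\<^bsub>T\<^esub> (J +>\<^bsub>M\<^esub> q) = J +>\<^bsub>M\<^esub> (p + q)"
  by (simp add: T_simps FactRing_def J.a_rcos_sum) (simp add: pair_ring_simps)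

lemma pure_add_left:
  assumes "a \<in> carrier A" "a' \<in> carrier A" "b \<in> carrier B"
  shows "pure (a \<oplus>\<^bsub>A\<^esub> a') b = pure a b \<oplus>\<^bsub>T\<^esub> pure a' b"
proof -
  have "frag_of (a \<oplus>\<^bsub>A\<^esub> a', b) - (frag_of (a, b) + frag_of (a', b)) \<in> J"
    using assms by (intro subsetD[OF relations_J]) (auto simp: bilinear_relations_def diff_diff_eq)
  moreover have "frag_of (a, b) + frag_of (a', b) \<in> carrier M"
    using M.a_closed[OF gen_closed gen_closed, of a b a' b] assms by (simp add: pair_ring_simps(4))
  ultimately show ?thesis
    unfolding pure_tensor_def using assms by (simp add: sum_coset gen_closed coset_eqI)
qed

lemma pure_add_right:
  assumes "a \<in> carrier A" "b \<in> carrier B" "b' \<in> carrier B"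
  shows "pure a (b \<oplus>\<^bsub>B\<^esub> b') = pure a b \<oplus>\<^bsub>T\<^esub> pure a b'"
proof -
  have "frag_of (a, b \<oplus>\<^bsub>B\<^esub> b') - (frag_of (a, b) + frag_of (a, b')) \<in> J"
    using assms by (intro subsetD[OF relations_J]) (auto simp: bilinear_relations_def diff_diff_eq)
  moreover have "frag_of (a, b) + frag_of (a, b') \<in> carrier M"
    using M.a_closed[OF gen_closed gen_closed, of a b a b'] assms by (simp add: pair_ring_simps(4))
  ultimately show ?thesis
    unfolding pure_tensor_def using assms by (simp add: sum_coset gen_closed coset_eqI)
qed

lemma pure_scalar:
  assumes "r \<in> carrier R"
  shows "pure (scalar_map A r) \<one>\<^bsub>B\<^esub> = pure \<one>\<^bsub>A\<^esub> (scalar_map B r)"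
proof -
  have "frag_of (scalar_map A r \<otimes>\<^bsub>A\<^esub> \<one>\<^bsub>A\<^esub>, \<one>\<^bsub>B\<^esub>) - frag_of (\<one>\<^bsub>A\<^esub>, scalar_map B r \<otimes>\<^bsub>B\<^esub> \<one>\<^bsub>B\<^esub>) \<in> J"
    using assms by (intro subsetD[OF relations_J]) (auto simp: bilinear_relations_def)
  then show ?thesis
    unfolding pure_tensor_def using assms scalar_A scalar_B by (intro coset_eqI gen_closed) auto
qed

lemma pure_hom_left: "(\<lambda>a. pure a \<one>\<^bsub>B\<^esub>) \<in> ring_hom A T"
  by (rule ring_hom_memI) (simp_all add: pure_closed pure_mult pure_add_left pure_one)

lemma pure_hom_right: "(\<lambda>b. pure \<one>\<^bsub>A\<^esub> b) \<in> ring_hom B T"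
  by (rule ring_hom_memI) (simp_all add: pure_closed pure_mult pure_add_right pure_one)

lemma pure_eq: "a \<in> carrier A \<Longrightarrow> b \<in> carrier B \<Longrightarrow>
    pure a b = pure a \<one>\<^bsub>B\<^esub> \<otimes>\<^bsub>T\<^esub> pure \<one>\<^bsub>A\<^esub> b"
  by (simp add: pure_mult)

text \<open>The homomorphism on pairs kills the three kinds of relations; its kernel is an ideal, so
  it contains the ideal they generate.\<close>

lemma lift:
  assumes C: "cring C" and "\<alpha> \<in> ring_hom A C" "\<beta> \<in> ring_hom B C"
    and sc: "\<And>r. r \<in> carrier R \<Longrightarrow> \<alpha> (scalar_map A r) = \<beta> (scalar_map B r)"
  obtains h where "h \<in> ring_hom T C"
    "\<And>a b. a \<in> carrier A \<Longrightarrow> b \<in> carrier B \<Longrightarrow> h (pure a b) = \<alpha> a \<otimes>\<^bsub>C\<^esub> \<beta> b"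
proof -
  interpret C: cring C by fact
  note \<alpha> = ring_hom_memE[OF assms(2)] and \<beta> = ring_hom_memE[OF assms(3)]
  obtain h0 where h0: "h0 \<in> ring_hom M C" "\<And>a b. a \<in> carrier A \<Longrightarrow> b \<in> carrier B \<Longrightarrow>
      h0 (frag_of (a, b)) = \<alpha> a \<otimes>\<^bsub>C\<^esub> \<beta> b" by (rule pair_ring_hom[OF assms(1-3)]) blast
  interpret H: ring_hom_ring M C h0 by (rule ring_hom_ringI2[OF M.ring_axioms C.ring_axioms h0(1)])
  have diff: "h0 (p - q) = h0 p \<ominus>\<^bsub>C\<^esub> h0 q" if "p \<in> carrier M" "q \<in> carrier M" for p q
    unfolding minus_pair_ring[OF that, symmetric] M.minus_eq C.minus_eq using that by simp
  have cancel: "(x \<oplus>\<^bsub>C\<^esub> y) \<ominus>\<^bsub>C\<^esub> x \<ominus>\<^bsub>C\<^esub> y = \<zero>\<^bsub>C\<^esub>" if "x \<in> carrier C" "y \<in> carrier C" for x y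
    using that by algebra
  have "h0 p = \<zero>\<^bsub>C\<^esub>" if "p \<in> bilinear_relations R A B" for p
    using that unfolding bilinear_relations_def
  proof (elim UnE)
    assume "p \<in> {frag_of (a \<oplus>\<^bsub>A\<^esub> a', b) - frag_of (a, b) - frag_of (a', b) | a a' b.
        a \<in> carrier A \<and> a' \<in> carrier A \<and> b \<in> carrier B}"
    then show ?thesis
      by (auto simp: diff diff_closed gen_closed h0(2) \<alpha> \<beta> C.l_distr cancel)
  next
    assume "p \<in> {frag_of (a, b \<oplus>\<^bsub>B\<^esub> b') - frag_of (a, b) - frag_of (a, b') | a b b'.
        a \<in> carrier A \<and> b \<in> carrier B \<and> b' \<in> carrier B}"
    then show ?thesis
      by (auto simp: diff diff_closed gen_closed h0(2) \<alpha> \<beta> C.r_distr cancel)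
  next
    assume "p \<in> {frag_of (scalar_map A r \<otimes>\<^bsub>A\<^esub> a, b) - frag_of (a, scalar_map B r \<otimes>\<^bsub>B\<^esub> b) | r a b.
        r \<in> carrier R \<and> a \<in> carrier A \<and> b \<in> carrier B}"
    then show ?thesis
      by (auto simp: diff gen_closed h0(2) \<alpha> \<beta> scalar_A scalar_B sc C.minus_eq C.m_ac C.r_neg)
  qed
  then have "bilinear_relations R A B \<subseteq> a_kernel M C h0"
    using relations_closed unfolding a_kernel_def' by blast
  then have "J \<subseteq> a_kernel M C h0"
    unfolding tensor_ideal_def by (rule M.genideal_minimal[OF H.kernel_is_ideal])
  then have ker: "h0 p = \<zero>\<^bsub>C\<^esub>" if "p \<in> J" for p
    using that unfolding a_kernel_def' by blast
  obtain h where "h \<in> ring_hom (M Quot J) C" "\<And>p. p \<in> carrier M \<Longrightarrow> h (J +>\<^bsub>M\<^esub> p) = h0 p"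
    using quotient_lift[OF ideal_J C.ring_axioms h0(1) ker] by blast
  then show ?thesis
    by (intro that[of h]) (simp_all add: tensor_alg_def pure_tensor_def gen_closed h0(2))
qed

text \<open>Pure tensors generate additively, and a pure tensor is the product of its two one-sided
  ones, so agreement on the two factors is enough.\<close>

lemma hom_eqI:
  assumes C: "ring C" and g: "g \<in> ring_hom T C" and h: "h \<in> ring_hom T C"
    and left: "\<And>a. a \<in> carrier A \<Longrightarrow> g (pure a \<one>\<^bsub>B\<^esub>) = h (pure a \<one>\<^bsub>B\<^esub>)"
    and right: "\<And>b. b \<in> carrier B \<Longrightarrow> g (pure \<one>\<^bsub>A\<^esub> b) = h (pure \<one>\<^bsub>A\<^esub> b)"
    and x: "x \<in> carrier T"
  shows "g x = h x"
proof -
  interpret G: ring_hom_ring T C g by (rule ring_hom_ringI2[OF T.ring_axioms C g])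
  interpret H: ring_hom_ring T C h by (rule ring_hom_ringI2[OF T.ring_axioms C h])
  have coset: "J +>\<^bsub>M\<^esub> p \<in> carrier T" if "p \<in> carrier M" for p
    using that by (simp add: T_simps FactRing_def M.a_rcosetsI J.a_subset)
  have "p \<in> carrier M \<and> g (J +>\<^bsub>M\<^esub> p) = h (J +>\<^bsub>M\<^esub> p)" if "p \<in> carrier M" for p
    using that
  proof (induction p rule: carrier_induct)
    case zero
    have "J +>\<^bsub>M\<^esub> 0 = \<zero>\<^bsub>T\<^esub>"
      using M.a_rcos_zero[OF ideal_J J.zero_closed] by (simp add: T_simps pair_ring_simps(3))
    then show ?case by (simp add: G.hom_zero H.hom_zero pair_ring_simps(1))
  next
    case (gen u)
    obtain a b where u: "u = (a, b)" by (metis surj_pair)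
    then have ab: "a \<in> carrier A" "b \<in> carrier B" using gen by auto
    have "g (pure a b) = h (pure a b)"
      using ab by (simp only: pure_eq) (simp add: left right pure_closed)
    then show ?case using ab u by (simp add: pure_tensor_def gen_closed)
  next
    case (diff p q)
    then have pq: "p - q \<in> carrier M" by (simp add: diff_closed)
    moreover have "g (J +>\<^bsub>M\<^esub> p) = g (J +>\<^bsub>M\<^esub> (p - q)) \<oplus>\<^bsub>C\<^esub> g (J +>\<^bsub>M\<^esub> q)"
      using sum_coset[of "p - q" q] diff pq coset G.hom_add[of "J +>\<^bsub>M\<^esub> (p - q)" "J +>\<^bsub>M\<^esub> q"]
      by (metis diff_add_cancel)
    moreover have "h (J +>\<^bsub>M\<^esub> p) = h (J +>\<^bsub>M\<^esub> (p - q)) \<oplus>\<^bsub>C\<^esub> h (J +>\<^bsub>M\<^esub> q)"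
      using sum_coset[of "p - q" q] diff pq coset H.hom_add[of "J +>\<^bsub>M\<^esub> (p - q)" "J +>\<^bsub>M\<^esub> q"]
      by (metis diff_add_cancel)
    ultimately show ?case
      using diff coset G.hom_closed H.hom_closed by (metis G.S.add.right_cancel)
  qed
  moreover obtain p where "p \<in> carrier M" "x = J +>\<^bsub>M\<^esub> p"
    using x unfolding T_simps by (rule carrier_quotientE)
  ultimately show ?thesis by blast
qed

end

lemma cring_int_alg: "cring A \<Longrightarrow> cring (int_alg A)"
  by (simp add: int_alg_def cring_with_scalar_map)

lemma tensor_product_int:
  assumes "cring A" "cring B" shows "tensor_product (int_alg A) (int_alg B) \<Z>"
proof -
  interpret A: cring A by fact
  interpret B: cring B by fact
  show ?thesis
    using assms by (intro tensor_product.intro cring_pair.intro cring_int_alg tensor_product_axioms.intro)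
      (simp_all add: int_alg_def)
qed

lemma int_alg_simps:
  "carrier (int_alg A) = carrier A" "one (int_alg A) = one A" "ring_hom (int_alg A) S = ring_hom A S"
  "monoid.mult (int_alg A) = monoid.mult A" "add (int_alg A) = add A"
  by (simp_all add: int_alg_def)

text \<open>Over the integers \<alpha> and \<beta> are automatically compatible: both send n times
  the unit to n times the unit.\<close>

lemma base_change_lift:
  assumes "cring A" "cring k" "cring C" "\<alpha> \<in> ring_hom A C" "\<beta> \<in> ring_hom k C"
  obtains h where "h \<in> ring_hom (base_change k A) C"
    "\<And>a c. a \<in> carrier A \<Longrightarrow> c \<in> carrier k \<Longrightarrow>
      h (pure_tensor \<Z> (int_alg A) (int_alg k) a c) = \<alpha> a \<otimes>\<^bsub>C\<^esub> \<beta> c"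
proof -
  interpret T: tensor_product "int_alg A" "int_alg k" \<Z> by (rule tensor_product_int[OF assms(1,2)])
  interpret A: cring A by fact
  interpret k: cring k by fact
  interpret C: cring C by fact
  have "\<alpha> (scalar_map (int_alg A) n) = \<beta> (scalar_map (int_alg k) n)" for n
    using ring_hom_add_pow_int[OF A.ring_axioms C.ring_axioms assms(4) A.one_closed]
      ring_hom_add_pow_int[OF k.ring_axioms C.ring_axioms assms(5) k.one_closed]
      ring_hom_memE(4)[OF assms(4)] ring_hom_memE(4)[OF assms(5)]
    by (simp add: int_alg_def)
  then obtain h where "h \<in> ring_hom T.T C"
    "\<And>a b. a \<in> carrier (int_alg A) \<Longrightarrow> b \<in> carrier (int_alg k) \<Longrightarrow> h (T.pure a b) = \<alpha> a \<otimes>\<^bsub>C\<^esub> \<beta> b"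
    using T.lift[OF assms(3), of \<alpha> \<beta>] assms(4,5) by (metis int_alg_simps(3))
  then show ?thesis by (intro that[of h]) (simp_all add: base_change_def int_alg_simps)
qed

lemma quotient_alg_cring:
  assumes "cring A" "x \<in> carrier A" shows "cring (quotient_alg A x)"
proof -
  interpret cring A by fact
  show ?thesis unfolding quotient_alg_def
    by (intro cring_with_scalar_map ideal.quotient_is_cring cgenideal_ideal assms)
qed

lemma ring_hom_comp': "g \<in> ring_hom A B \<Longrightarrow> h \<in> ring_hom B C \<Longrightarrow> (\<lambda>x. h (g x)) \<in> ring_hom A C"
  using ring_hom_trans[of g A B h C] by (simp add: comp_def)

lemma UP_hom_eqI:
  assumes "cring R" "cring S" "g \<in> ring_hom (UP R) S" "h \<in> ring_hom (UP R) S"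
    and "g (up_ring.monom (UP R) \<one>\<^bsub>R\<^esub> 1) = h (up_ring.monom (UP R) \<one>\<^bsub>R\<^esub> 1)"
    and "\<And>r. r \<in> carrier R \<Longrightarrow> g (up_ring.monom (UP R) r 0) = h (up_ring.monom (UP R) r 0)"
    and "p \<in> carrier (UP R)"
  shows "g p = h p"
proof -
  interpret UP: UP_cring R "UP R" by (rule UP_cring.intro[OF assms(1)]) simp
  have const: "(\<lambda>r. up_ring.monom (UP R) r 0) \<in> ring_hom R (UP R)"
    by (rule UP.const_ring_hom)
  interpret U: UP_pre_univ_prop R S "\<lambda>r. g (up_ring.monom (UP R) r 0)" "UP R"
    by (intro UP_pre_univ_propI assms ring_hom_comp'[OF const assms(3)]) simp
  show ?thesis
    by (rule U.UP_hom_unique[of g "g (up_ring.monom (UP R) \<one>\<^bsub>R\<^esub> 1)" h])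
      (use assms U.ring_homD ring_hom_memE(1)[OF assms(3)] ring_hom_memE(1)[OF assms(4)] in auto)
qed

lemma UP_lift:
  assumes "cring R" "cring S" "h \<in> ring_hom R S" "s \<in> carrier S"
  obtains g where "g \<in> ring_hom (UP R) S" "g (up_ring.monom (UP R) \<one>\<^bsub>R\<^esub> 1) = s"
    "\<And>r. r \<in> carrier R \<Longrightarrow> g (up_ring.monom (UP R) r 0) = h r"
proof -
  interpret U: UP_pre_univ_prop R S h "UP R"
    by (intro UP_pre_univ_propI assms) simp
  show ?thesis
    using U.eval_ring_hom[OF assms(4)] U.eval_monom1[OF assms(4)] U.eval_const[OF assms(4)]
    by (intro that[of "eval R S h s"]) simp_all
qed

text \<open>E identifies A / (x) with D[y] over the integers, and tensoring with k identifies the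
  fibre with k[y] \<otimes> (D \<otimes> k). In place of an appeal to right exactness, maps F and G
  in the two directions are built from universal properties and compared on generators.\<close>

lemma fiber_iso:
  fixes k :: "'k ring" and A :: "'a ring" and D :: "'d ring"
  assumes k: "cring k" and A: "cring A" and D: "cring D" and x: "x \<in> carrier A"
    and E: "E \<in> ring_hom A (UP D)" and E_surj: "E ` carrier A = carrier (UP D)"
    and E_ker: "\<And>a. a \<in> carrier A \<Longrightarrow> E a = \<zero>\<^bsub>UP D\<^esub> \<Longrightarrow> a \<in> PIdl\<^bsub>A\<^esub> x"
    and E_x: "E x = \<zero>\<^bsub>UP D\<^esub>"
  defines "X1 \<equiv> quotient_alg (base_change k A) (pure_tensor \<Z> (int_alg A) (int_alg k) x \<one>\<^bsub>k\<^esub>)"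
    and "Y1 \<equiv> tensor_alg k (poly_alg k) (base_change k D)"
  shows "cring X1" "cring Y1"
    "\<exists>G\<in>ring_iso Y1 X1. \<forall>c\<in>carrier k. scalar_map Y1 c \<in> carrier Y1 \<and> G (scalar_map Y1 c) = scalar_map X1 c"
proof -
  interpret k: cring k by fact
  interpret A: cring A by fact
  interpret D: cring D by fact
  interpret TA: tensor_product "int_alg A" "int_alg k" \<Z> by (rule tensor_product_int[OF A k])
  interpret TD: tensor_product "int_alg D" "int_alg k" \<Z> by (rule tensor_product_int[OF D k])
  interpret Uk: UP_cring k "UP k" by (rule UP_cring.intro[OF k]) simp
  interpret UD: UP_cring D "UP D" by (rule UP_cring.intro[OF D]) simp
  let ?pA = "pure_tensor \<Z> (int_alg A) (int_alg k)" and ?pD = "pure_tensor \<Z> (int_alg D) (int_alg k)"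
  let ?kA = "base_change k A" and ?kD = "base_change k D" and ?kT = "poly_alg k"
  have hom_simps: "ring_hom ?kA S = ring_hom TA.T S" "ring_hom ?kD S = ring_hom TD.T S"
    "ring_hom ?kT S = ring_hom (UP k) S" "ring_hom S ?kA = ring_hom S TA.T" "ring_hom S ?kD = ring_hom S TD.T"
    "ring_hom S ?kT = ring_hom S (UP k)"  for S
    by (simp_all add: base_change_def poly_alg_def)
  note simps = int_alg_simps
  have kA: "cring ?kA" and kD: "cring ?kD" and kT: "cring ?kT"
    using TA.cring_T TD.cring_T Uk.is_cring
    by (simp_all add: base_change_def poly_alg_def cring_with_scalar_map)
  have carr: "carrier ?kA = carrier TA.T" "carrier ?kD = carrier TD.T" "carrier ?kT = carrier (UP k)"
    "\<one>\<^bsub>?kA\<^esub> = \<one>\<^bsub>TA.T\<^esub>" "\<one>\<^bsub>?kD\<^esub> = \<one>\<^bsub>TD.T\<^esub>" "\<one>\<^bsub>?kT\<^esub> = \<one>\<^bsub>UP k\<^esub>"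
    by (simp_all add: base_change_def poly_alg_def)
  have sc: "scalar_map ?kD c = ?pD \<one>\<^bsub>D\<^esub> c" "scalar_map ?kT c = up_ring.monom (UP k) c 0" for c
    by (simp_all add: base_change_def poly_alg_def)
  interpret TY: tensor_product ?kT ?kD k
    using TD.pure_closed[of "\<one>\<^bsub>D\<^esub>"]
    by (intro tensor_product.intro cring_pair.intro kT kD tensor_product_axioms.intro)
      (simp_all add: sc carr simps)
  let ?pY = "pure_tensor k ?kT ?kD"
  show cringY: "cring Y1" unfolding Y1_def by (rule TY.cring_T)
  let ?x = "?pA x \<one>\<^bsub>k\<^esub>"
  have x_in: "?x \<in> carrier ?kA" using TA.pure_closed[of x "\<one>\<^bsub>k\<^esub>"] x by (simp add: carr simps)
  show cringX: "cring X1" unfolding X1_def by (rule quotient_alg_cring[OF kA x_in])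
  interpret X1: cring X1 by fact
  interpret Y1: cring Y1 by fact
  interpret kA: cring ?kA by fact
  let ?I = "PIdl\<^bsub>?kA\<^esub> ?x"
  have I: "ideal ?I ?kA" by (rule kA.cgenideal_ideal[OF x_in])
  interpret I: ideal ?I ?kA by fact
  define cl where "cl = (\<lambda>z. ?I +>\<^bsub>?kA\<^esub> z)"
  have cl_hom: "cl \<in> ring_hom ?kA X1"
    unfolding X1_def quotient_alg_def cl_def using I.rcos_ring_hom by simp
  define q where "q = (\<lambda>a. cl (?pA a \<one>\<^bsub>k\<^esub>))"
  define \<kappa> where "\<kappa> = (\<lambda>c. cl (?pA \<one>\<^bsub>A\<^esub> c))"
  have q: "q \<in> ring_hom A X1"
    unfolding q_def using ring_hom_comp'[OF TA.pure_hom_left[unfolded simps] cl_hom[unfolded hom_simps]] .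
  have \<kappa>: "\<kappa> \<in> ring_hom k X1"
    unfolding \<kappa>_def using ring_hom_comp'[OF TA.pure_hom_right[unfolded simps] cl_hom[unfolded hom_simps]] .
  have q_x: "q x = \<zero>\<^bsub>X1\<^esub>"
    using kA.a_rcos_zero[OF I kA.cgenideal_self[OF x_in]]
    by (simp add: q_def cl_def X1_def quotient_alg_def FactRing_def)
  interpret q: ring_hom_ring A X1 q by (rule ring_hom_ringI2[OF A.ring_axioms X1.ring_axioms q])
  interpret E: ring_hom_ring A "UP D" E by (rule ring_hom_ringI2[OF A.ring_axioms UD.ring_axioms E])
  \<comment> \<open>Elements with the same image under E differ by a multiple of x, so q factors
    through E; the factor is the map \<epsilon> from D[y] to the fibre.\<close>
  have q_eq: "q a = q b" if ab: "a \<in> carrier A" "b \<in> carrier A" "E a = E b" for a b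
  proof -
    have "E (a \<ominus>\<^bsub>A\<^esub> b) = \<zero>\<^bsub>UP D\<^esub>"
      using ab by (simp add: A.minus_eq UD.r_neg)
    then obtain c where c: "c \<in> carrier A" "a \<ominus>\<^bsub>A\<^esub> b = c \<otimes>\<^bsub>A\<^esub> x"
      using E_ker[of "a \<ominus>\<^bsub>A\<^esub> b"] ab unfolding cgenideal_def by auto
    have "q (a \<ominus>\<^bsub>A\<^esub> b) = \<zero>\<^bsub>X1\<^esub>" unfolding c(2) using c(1) x by (simp add: q_x)
    then have "q a \<ominus>\<^bsub>X1\<^esub> q b = \<zero>\<^bsub>X1\<^esub>" using ab by (simp add: A.minus_eq X1.minus_eq)
    then show ?thesis using ab by (simp add: X1.r_right_minus_eq)
  qed
  define lft where "lft = (\<lambda>p. SOME a. a \<in> carrier A \<and> E a = p)"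
  have lft: "lft p \<in> carrier A" "E (lft p) = p" if "p \<in> carrier (UP D)" for p
  proof -
    have "p \<in> E ` carrier A" unfolding E_surj by (rule that)
    then obtain a where "a \<in> carrier A" "p = E a" by (rule imageE)
    then have "a \<in> carrier A \<and> E a = p" by simp
    then have "lft p \<in> carrier A \<and> E (lft p) = p" unfolding lft_def by (rule someI)
    then show "lft p \<in> carrier A" "E (lft p) = p" by auto
  qed
  define \<epsilon> where "\<epsilon> = (\<lambda>p. q (lft p))"
  have \<epsilon>_E: "\<epsilon> (E a) = q a" if "a \<in> carrier A" for a
    unfolding \<epsilon>_def using lft[of "E a"] that by (intro q_eq) auto
  have \<epsilon>: "\<epsilon> \<in> ring_hom (UP D) X1"
  proof (rule ring_hom_memI)
    fix p r assume "p \<in> carrier (UP D)" "r \<in> carrier (UP D)"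
    then obtain a b where "a \<in> carrier A" "b \<in> carrier A" "p = E a" "r = E b"
      unfolding E_surj[symmetric] by (elim imageE)
    then show "\<epsilon> (p \<otimes>\<^bsub>UP D\<^esub> r) = \<epsilon> p \<otimes>\<^bsub>X1\<^esub> \<epsilon> r" "\<epsilon> (p \<oplus>\<^bsub>UP D\<^esub> r) = \<epsilon> p \<oplus>\<^bsub>X1\<^esub> \<epsilon> r"
      by (simp_all add: \<epsilon>_E flip: E.hom_mult E.hom_add)
  next
    show "\<epsilon> \<one>\<^bsub>UP D\<^esub> = \<one>\<^bsub>X1\<^esub>" using \<epsilon>_E[OF A.one_closed] by simp
  qed (simp add: \<epsilon>_def lft)
  \<comment> \<open>t is the coordinate of the affine line and \<eta>0 the structure map from D;
    \<eta> evaluates polynomials over D at t.\<close>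
  define t where "t = ?pY (up_ring.monom (UP k) \<one>\<^bsub>k\<^esub> 1) \<one>\<^bsub>?kD\<^esub>"
  define \<eta>0 where "\<eta>0 = (\<lambda>d. ?pY \<one>\<^bsub>?kT\<^esub> (?pD d \<one>\<^bsub>k\<^esub>))"
  have t: "t \<in> carrier Y1"
    unfolding t_def Y1_def using TY.pure_closed[of "up_ring.monom (UP k) \<one>\<^bsub>k\<^esub> 1" "\<one>\<^bsub>?kD\<^esub>"] by (simp add: carr)
  have \<eta>0: "\<eta>0 \<in> ring_hom D Y1"
    unfolding \<eta>0_def Y1_def
    using ring_hom_comp'[OF TD.pure_hom_left[unfolded simps] TY.pure_hom_right[unfolded hom_simps]] .
  obtain \<eta> where \<eta>: "\<eta> \<in> ring_hom (UP D) Y1" and \<eta>_mon: "\<eta> (up_ring.monom (UP D) \<one>\<^bsub>D\<^esub> 1) = t"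
    "\<And>d. d \<in> carrier D \<Longrightarrow> \<eta> (up_ring.monom (UP D) d 0) = \<eta>0 d"
    by (rule UP_lift[OF D cringY \<eta>0 t], rule that)
  define \<kappa>Y where "\<kappa>Y = (\<lambda>c. ?pY \<one>\<^bsub>?kT\<^esub> (?pD \<one>\<^bsub>D\<^esub> c))"
  have \<kappa>Y: "\<kappa>Y \<in> ring_hom k Y1"
    unfolding \<kappa>Y_def Y1_def
    using ring_hom_comp'[OF TD.pure_hom_right[unfolded simps] TY.pure_hom_right[unfolded hom_simps]] .
  \<comment> \<open>F0 is \<eta> after E on A and the structure map on k. As E sends x to zero, it
    vanishes on the ideal and descends to F.\<close>
  obtain F0 where F0: "F0 \<in> ring_hom ?kA Y1" "\<And>a c. a \<in> carrier A \<Longrightarrow> c \<in> carrier k \<Longrightarrow>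
      F0 (?pA a c) = \<eta> (E a) \<otimes>\<^bsub>Y1\<^esub> \<kappa>Y c"
    by (rule base_change_lift[OF A k cringY ring_hom_comp'[OF E \<eta>] \<kappa>Y], rule that)
  have \<eta>_zero: "\<eta> \<zero>\<^bsub>UP D\<^esub> = \<zero>\<^bsub>Y1\<^esub>"
    by (rule ring_hom_zero[OF \<eta> UD.ring_axioms Y1.ring_axioms])
  note \<kappa>Y_closed = ring_hom_memE(1)[OF \<kappa>Y] and \<kappa>_closed = ring_hom_memE(1)[OF \<kappa>]
  have F0_ker: "F0 z = \<zero>\<^bsub>Y1\<^esub>" if z: "z \<in> ?I" for z
  proof -
    obtain w where w: "w \<in> carrier ?kA" "z = w \<otimes>\<^bsub>?kA\<^esub> ?x" using z unfolding cgenideal_def by blast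
    have "F0 ?x = \<zero>\<^bsub>Y1\<^esub>" using F0(2)[OF x k.one_closed] \<kappa>Y_closed by (simp add: E_x \<eta>_zero)
    then show ?thesis unfolding w(2)
      using w(1) x_in ring_hom_memE(1,2)[OF F0(1)] by simp
  qed
  obtain F where F': "F \<in> ring_hom (?kA Quot ?I) Y1" "\<And>z. z \<in> carrier ?kA \<Longrightarrow> F (?I +>\<^bsub>?kA\<^esub> z) = F0 z"
    by (rule quotient_lift[OF I Y1.ring_axioms F0(1) F0_ker], assumption, rule that)
  have F: "F \<in> ring_hom X1 Y1" "\<And>z. z \<in> carrier ?kA \<Longrightarrow> F (cl z) = F0 z"
    using F' by (simp_all add: X1_def quotient_alg_def cl_def)
  let ?TD = "up_ring.monom (UP D) \<one>\<^bsub>D\<^esub> 1"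
  have \<epsilon>T: "\<epsilon> ?TD \<in> carrier X1" using ring_hom_memE(1)[OF \<epsilon>] by simp
  \<comment> \<open>In the other direction the coordinate goes to the class of a lift of y. G1 and
    G2 agree on k, where both are \<kappa>, and so combine to G.\<close>
  obtain G1 where G1: "G1 \<in> ring_hom (UP k) X1" and G1_mon: "G1 (up_ring.monom (UP k) \<one>\<^bsub>k\<^esub> 1) = \<epsilon> ?TD"
    "\<And>c. c \<in> carrier k \<Longrightarrow> G1 (up_ring.monom (UP k) c 0) = \<kappa> c"
    by (rule UP_lift[OF k cringX \<kappa> \<epsilon>T], rule that)
  obtain G2 where G2: "G2 \<in> ring_hom ?kD X1" "\<And>d c. d \<in> carrier D \<Longrightarrow> c \<in> carrier k \<Longrightarrow>
      G2 (?pD d c) = \<epsilon> (up_ring.monom (UP D) d 0) \<otimes>\<^bsub>X1\<^esub> \<kappa> c"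
    by (rule base_change_lift[OF D k cringX ring_hom_comp'[OF UD.const_ring_hom \<epsilon>] \<kappa>], rule that)
  have \<kappa>1: "\<kappa> \<one>\<^bsub>k\<^esub> = \<one>\<^bsub>X1\<^esub>" using ring_hom_memE(4)[OF \<kappa>] .
  have \<epsilon>1: "\<epsilon> (up_ring.monom (UP D) \<one>\<^bsub>D\<^esub> 0) = \<one>\<^bsub>X1\<^esub>"
    using ring_hom_memE(4)[OF ring_hom_comp'[OF UD.const_ring_hom \<epsilon>]] .
  have \<epsilon>_closed: "p \<in> carrier (UP D) \<Longrightarrow> \<epsilon> p \<in> carrier X1" for p using ring_hom_memE(1)[OF \<epsilon>] .
  have \<epsilon>1': "\<epsilon> \<one>\<^bsub>UP D\<^esub> = \<one>\<^bsub>X1\<^esub>" using ring_hom_memE(4)[OF \<epsilon>] .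
  have G2_d: "G2 (?pD d \<one>\<^bsub>k\<^esub>) = \<epsilon> (up_ring.monom (UP D) d 0)" if "d \<in> carrier D" for d
    using that by (simp add: G2(2) \<kappa>1 \<epsilon>_closed)
  have G2_c: "G2 (?pD \<one>\<^bsub>D\<^esub> c) = \<kappa> c" if "c \<in> carrier k" for c
    using that by (simp add: G2(2) \<epsilon>1 \<epsilon>1' \<kappa>_closed)
  obtain G where G': "G \<in> ring_hom TY.T X1" "\<And>p z. p \<in> carrier ?kT \<Longrightarrow> z \<in> carrier ?kD \<Longrightarrow>
      G (?pY p z) = G1 p \<otimes>\<^bsub>X1\<^esub> G2 z"
  proof (rule TY.lift[OF cringX, of G1 G2])
    show "G1 \<in> ring_hom ?kT X1" "G2 \<in> ring_hom ?kD X1" using G1 G2(1) by (simp_all add: hom_simps)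
    show "G1 (scalar_map ?kT c) = G2 (scalar_map ?kD c)" if "c \<in> carrier k" for c
      using that by (simp add: sc G1_mon G2_c)
  qed (rule that)
  have G: "G \<in> ring_hom Y1 X1" "\<And>p z. p \<in> carrier ?kT \<Longrightarrow> z \<in> carrier ?kD \<Longrightarrow>
      G (?pY p z) = G1 p \<otimes>\<^bsub>X1\<^esub> G2 z"
    using G' by (simp_all add: Y1_def)
  note G1_one = ring_hom_memE(4)[OF G1] and G2_one = ring_hom_memE(4)[OF G2(1)]
  note G1_closed = ring_hom_memE(1)[OF G1] and G2_closed = ring_hom_memE(1)[OF G2(1)]
  have G_left: "G (?pY p \<one>\<^bsub>?kD\<^esub>) = G1 p" if "p \<in> carrier (UP k)" for p
    using that by (subst G(2)) (simp_all add: carr(3) G2_one G1_closed)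
  have G_right: "G (?pY \<one>\<^bsub>?kT\<^esub> z) = G2 z" if "z \<in> carrier ?kD" for z
    using that TY.A.one_closed by (subst G(2)) (simp_all add: G1_one[folded carr(6)] G2_closed)
  have pD_closed: "?pD d c \<in> carrier ?kD" if "d \<in> carrier D" "c \<in> carrier k" for d c
    using that TD.pure_closed[of d c] by (simp add: carr simps)
  have pA_closed: "?pA d c \<in> carrier ?kA" if "d \<in> carrier A" "c \<in> carrier k" for d c
    using that TA.pure_closed[of d c] by (simp add: carr simps)
  have F_q: "F (q a) = \<eta> (E a)" if "a \<in> carrier A" for a
    using that ring_hom_memE(4)[OF \<kappa>Y] ring_hom_memE(1)[OF ring_hom_comp'[OF E \<eta>]]
    by (simp add: q_def F(2) pA_closed F0(2))
  have F_\<kappa>: "F (\<kappa> c) = \<kappa>Y c" if "c \<in> carrier k" for c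
    using that ring_hom_memE(4)[OF ring_hom_comp'[OF E \<eta>]] \<kappa>Y_closed
    by (simp add: \<kappa>_def F(2) pA_closed F0(2))
  have G_\<kappa>: "G (\<kappa>Y c) = \<kappa> c" if "c \<in> carrier k" for c
    using that by (simp add: \<kappa>Y_def G_right pD_closed G2_c)
  have G_\<eta>: "G (\<eta> p) = \<epsilon> p" if "p \<in> carrier (UP D)" for p
  proof (rule UP_hom_eqI[OF D cringX ring_hom_comp'[OF \<eta> G(1)] \<epsilon> _ _ that])
    show "G (\<eta> ?TD) = \<epsilon> ?TD"
      unfolding \<eta>_mon t_def by (subst G_left) (simp_all add: G1_mon[simplified])
    show "G (\<eta> (up_ring.monom (UP D) d 0)) = \<epsilon> (up_ring.monom (UP D) d 0)" if "d \<in> carrier D" for d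
      using that by (simp add: \<eta>_mon \<eta>0_def G_right pD_closed G2_d)
  qed
  have F_\<epsilon>: "F (\<epsilon> p) = \<eta> p" if "p \<in> carrier (UP D)" for p
    using F_q[OF lft(1)[OF that]] lft(2)[OF that] by (simp add: \<epsilon>_def)
  have GF0: "G (F0 z) = cl z" if z: "z \<in> carrier ?kA" for z
  proof (rule TA.hom_eqI[OF X1.ring_axioms ring_hom_comp'[OF F0(1) G(1), unfolded hom_simps] cl_hom[unfolded hom_simps]])
    fix a assume "a \<in> carrier (int_alg A)"
    then have a: "a \<in> carrier A" by (simp add: simps)
    then have "G (F0 (?pA a \<one>\<^bsub>k\<^esub>)) = \<epsilon> (E a)"
      using F_q[OF a] F(2)[OF pA_closed[OF a k.one_closed]] G_\<eta>[of "E a"] by (simp add: q_def)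
    then show "G (F0 (?pA a \<one>\<^bsub>int_alg k\<^esub>)) = cl (?pA a \<one>\<^bsub>int_alg k\<^esub>)"
      using \<epsilon>_E[OF a] by (simp add: simps q_def)
  next
    fix c assume "c \<in> carrier (int_alg k)"
    then have c: "c \<in> carrier k" by (simp add: simps)
    then have "G (F0 (?pA \<one>\<^bsub>A\<^esub> c)) = \<kappa> c"
      using F_\<kappa>[OF c] F(2)[OF pA_closed[OF A.one_closed c]] G_\<kappa>[OF c] by (simp add: \<kappa>_def)
    then show "G (F0 (?pA \<one>\<^bsub>int_alg A\<^esub> c)) = cl (?pA \<one>\<^bsub>int_alg A\<^esub> c)"
      by (simp add: simps \<kappa>_def)
  qed (use z in \<open>simp add: carr\<close>)
  have GF: "G (F z) = z" if z: "z \<in> carrier X1" for z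
  proof -
    from z obtain w where "w \<in> carrier ?kA" "z = cl w"
      unfolding X1_def quotient_alg_def with_scalar_map_simps cl_def by (rule carrier_quotientE)
    then show ?thesis by (simp add: F(2) GF0)
  qed
  have FG: "F (G z) = z" if z: "z \<in> carrier Y1" for z
  proof (rule TY.hom_eqI[OF Y1.ring_axioms, of "\<lambda>z. F (G z)" "\<lambda>z. z"])
    show "(\<lambda>z. F (G z)) \<in> ring_hom TY.T Y1" "(\<lambda>z. z) \<in> ring_hom TY.T Y1"
      using ring_hom_comp'[OF G(1) F(1)] unfolding Y1_def by (simp_all add: ring_hom_def)
    show "z \<in> carrier TY.T" using z by (simp add: Y1_def)
  next
    fix p assume p: "p \<in> carrier ?kT"
    have "F (G1 p) = ?pY p \<one>\<^bsub>?kD\<^esub>"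
    proof (rule UP_hom_eqI[OF k cringY ring_hom_comp'[OF G1 F(1)]])
      show "(\<lambda>p. ?pY p \<one>\<^bsub>?kD\<^esub>) \<in> ring_hom (UP k) Y1"
        using TY.pure_hom_left unfolding hom_simps Y1_def .
      show "F (G1 (up_ring.monom (UP k) \<one>\<^bsub>k\<^esub> 1)) = ?pY (up_ring.monom (UP k) \<one>\<^bsub>k\<^esub> 1) \<one>\<^bsub>?kD\<^esub>"
        unfolding G1_mon by (subst F_\<epsilon>) (simp_all add: \<eta>_mon[simplified] t_def)
      show "F (G1 (up_ring.monom (UP k) c 0)) = ?pY (up_ring.monom (UP k) c 0) \<one>\<^bsub>?kD\<^esub>" if "c \<in> carrier k" for c
        using TY.pure_scalar[OF that] that by (simp add: G1_mon F_\<kappa> \<kappa>Y_def sc)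
      show "p \<in> carrier (UP k)" using p by (simp add: carr)
    qed
    then show "F (G (?pY p \<one>\<^bsub>?kD\<^esub>)) = ?pY p \<one>\<^bsub>?kD\<^esub>"
      using p by (simp add: G_left carr(3))
  next
    fix w assume w: "w \<in> carrier ?kD"
    have "F (G2 w) = ?pY \<one>\<^bsub>?kT\<^esub> w"
    proof (rule TD.hom_eqI[OF Y1.ring_axioms])
      show "(\<lambda>w. F (G2 w)) \<in> ring_hom TD.T Y1"
        using ring_hom_comp'[OF G2(1) F(1)] unfolding hom_simps .
      show "(\<lambda>w. ?pY \<one>\<^bsub>?kT\<^esub> w) \<in> ring_hom TD.T Y1"
        using TY.pure_hom_right unfolding hom_simps Y1_def .
      show "w \<in> carrier TD.T" using w by (simp add: carr)
    next
      fix d assume "d \<in> carrier (int_alg D)"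
      then show "F (G2 (?pD d \<one>\<^bsub>int_alg k\<^esub>)) = ?pY \<one>\<^bsub>?kT\<^esub> (?pD d \<one>\<^bsub>int_alg k\<^esub>)"
        by (simp add: simps G2_d F_\<epsilon> \<eta>_mon \<eta>0_def)
    next
      fix c assume "c \<in> carrier (int_alg k)"
      then show "F (G2 (?pD \<one>\<^bsub>int_alg D\<^esub> c)) = ?pY \<one>\<^bsub>?kT\<^esub> (?pD \<one>\<^bsub>int_alg D\<^esub> c)"
        by (simp add: simps G2_c F_\<kappa> \<kappa>Y_def)
    qed
    then show "F (G (?pY \<one>\<^bsub>?kT\<^esub> w)) = ?pY \<one>\<^bsub>?kT\<^esub> w" using w by (simp add: G_right)
  qed
  have "bij_betw G (carrier Y1) (carrier X1)"
    by (rule bij_betwI[of _ _ _ F]) (use FG GF ring_hom_memE(1)[OF F(1)] ring_hom_memE(1)[OF G(1)] in auto)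
  then have "G \<in> ring_iso Y1 X1" using G(1) by (simp add: ring_iso_def)
  moreover have "scalar_map Y1 c = ?pY (up_ring.monom (UP k) c 0) \<one>\<^bsub>?kD\<^esub>" for c
    using TY.scalar_map_T by (simp add: Y1_def sc)
  moreover have "scalar_map X1 c = \<kappa> c" for c
    by (simp add: X1_def quotient_alg_def base_change_def \<kappa>_def cl_def)
  moreover have "?pY (up_ring.monom (UP k) c 0) \<one>\<^bsub>?kD\<^esub> \<in> carrier Y1" if "c \<in> carrier k" for c
    unfolding Y1_def using that TY.pure_closed[of "up_ring.monom (UP k) c 0" "\<one>\<^bsub>?kD\<^esub>"] by (simp add: carr)
  ultimately show "\<exists>G\<in>ring_iso Y1 X1. \<forall>c\<in>carrier k. scalar_map Y1 c \<in> carrier Y1 \<and> G (scalar_map Y1 c) = scalar_map X1 c"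
    by (intro bexI[of _ G]) (auto simp: G_left G1_mon)
qed

section \<open>The field of rational functions\<close>

definition field_hom :: "('a::field \<Rightarrow> 'b::field) \<Rightarrow> bool" where
  "field_hom h \<longleftrightarrow> h 1 = 1 \<and> (\<forall>x y. h (x + y) = h x + h y) \<and> (\<forall>x y. h (x * y) = h x * h y)"

lemma field_homI:
  "h 1 = 1 \<Longrightarrow> (\<And>x y. h (x + y) = h x + h y) \<Longrightarrow> (\<And>x y. h (x * y) = h x * h y) \<Longrightarrow> field_hom h"
  by (simp add: field_hom_def)

context
  fixes h :: "'a::field \<Rightarrow> 'b::field"
  assumes h: "field_hom h"
begin

lemma field_hom_one: "h 1 = 1"
  and field_hom_add: "h (x + y) = h x + h y"
  and field_hom_mult: "h (x * y) = h x * h y"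
  using h by (auto simp: field_hom_def)

lemma field_hom_zero: "h 0 = 0"
  using field_hom_add[of 0 0] by (metis add_0 add_cancel_right_left)

lemma field_hom_minus: "h (- x) = - h x"
  using field_hom_add[of x "- x"] by (simp add: field_hom_zero eq_neg_iff_add_eq_0 add.commute)

lemma field_hom_diff: "h (x - y) = h x - h y"
  using field_hom_add[of x "- y"] by (simp add: field_hom_minus)

lemma field_hom_eq_0_iff: "h x = 0 \<longleftrightarrow> x = 0"
proof
  assume "h x = 0"
  show "x = 0"
  proof (rule ccontr)
    assume "x \<noteq> 0"
    then have "h x * h (inverse x) = 1" by (simp flip: field_hom_mult add: field_hom_one)
    with \<open>h x = 0\<close> show False by simp
  qed
qed (simp add: field_hom_zero)

lemma field_hom_inj: "h x = h y \<longleftrightarrow> x = y"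
  using field_hom_eq_0_iff[of "x - y"] by (simp add: field_hom_diff)

lemma field_hom_inverse: "h (inverse x) = inverse (h x)"
proof (cases "x = 0")
  case False
  then have "h x * h (inverse x) = 1" by (simp flip: field_hom_mult add: field_hom_one)
  then show ?thesis by (metis inverse_unique)
qed (simp add: field_hom_zero)

lemma field_hom_divide: "h (x / y) = h x / h y"
  by (simp add: divide_inverse field_hom_mult field_hom_inverse)

lemma field_hom_power: "h (x ^ n) = h x ^ n"
  by (induction n) (simp_all add: field_hom_one field_hom_mult)

lemma field_hom_power_int: "h (x powi n) = h x powi n"
  by (simp add: power_int_def field_hom_power field_hom_inverse)

lemma field_hom_sum: "h (sum f A) = (\<Sum>a\<in>A. h (f a))"
  by (induction A rule: infinite_finite_induct) (simp_all add: field_hom_zero field_hom_add)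

lemma field_hom_prod: "h (prod f A) = (\<Prod>a\<in>A. h (f a))"
  by (induction A rule: infinite_finite_induct) (simp_all add: field_hom_one field_hom_mult)

lemma field_hom_of_nat: "h (of_nat n) = of_nat n"
  by (induction n) (simp_all add: field_hom_zero field_hom_one field_hom_add)

lemma field_hom_of_int: "h (of_int n) = of_int n"
  by (cases n) (simp_all add: field_hom_of_nat field_hom_minus del: of_nat_Suc)

lemma field_hom_numeral: "h (numeral n) = numeral n"
  using field_hom_of_nat[of "numeral n"] by simp

lemmas field_hom_simps = field_hom_one field_hom_zero field_hom_add field_hom_mult field_hom_minus
  field_hom_diff field_hom_inverse field_hom_divide field_hom_power field_hom_power_int
  field_hom_sum field_hom_prod field_hom_numeral field_hom_eq_0_iff field_hom_inj

end

lemma field_hom_id: "field_hom (\<lambda>x. x)"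
  by (simp add: field_hom_def)

lemma field_hom_comp: "field_hom g \<Longrightarrow> field_hom h \<Longrightarrow> field_hom (\<lambda>x. g (h x))"
  by (simp add: field_hom_def)

section \<open>Generated subrings\<close>

definition ring_span :: "'a::comm_ring_1 set \<Rightarrow> 'a set" where
  "ring_span G = generate_ring ring_of_type_algebra G"

lemma ring_of_type_algebra_simps [simp]:
  "carrier (ring_of_type_algebra :: 'a::comm_ring_1 ring) = UNIV"
  "monoid.mult (ring_of_type_algebra :: 'a::comm_ring_1 ring) = (*)"
  "add (ring_of_type_algebra :: 'a::comm_ring_1 ring) = (+)"
  "one (ring_of_type_algebra :: 'a::comm_ring_1 ring) = 1"
  "ring.zero (ring_of_type_algebra :: 'a::comm_ring_1 ring) = 0"
  by (simp_all add: ring_of_type_algebra_def)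

lemma a_inv_ring_of_type_algebra [simp]: "\<ominus>\<^bsub>ring_of_type_algebra\<^esub> x = - (x :: 'a::comm_ring_1)"
proof -
  interpret R: cring "ring_of_type_algebra :: 'a ring" by (rule cring_from_type_algebra)
  have "x + (\<ominus>\<^bsub>ring_of_type_algebra\<^esub> x) = 0" using R.r_neg[of x] by simp
  then show ?thesis by (simp add: eq_neg_iff_add_eq_0 add.commute)
qed

lemma ring_span_incl: "x \<in> G \<Longrightarrow> x \<in> ring_span G"
  unfolding ring_span_def by (rule generate_ring.incl)

lemma ring_span_1: "1 \<in> ring_span G"
  using generate_ring.one[of ring_of_type_algebra G] by (simp add: ring_span_def)

lemma ring_span_add: "x \<in> ring_span G \<Longrightarrow> y \<in> ring_span G \<Longrightarrow> x + y \<in> ring_span G"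
  using generate_ring.eng_add[of x ring_of_type_algebra G y] by (simp add: ring_span_def)

lemma ring_span_mult: "x \<in> ring_span G \<Longrightarrow> y \<in> ring_span G \<Longrightarrow> x * y \<in> ring_span G"
  using generate_ring.eng_mult[of x ring_of_type_algebra G y] by (simp add: ring_span_def)

lemma ring_span_minus: "x \<in> ring_span G \<Longrightarrow> - x \<in> ring_span G"
  using generate_ring.a_inv[of x ring_of_type_algebra G] by (simp add: ring_span_def)

lemma ring_span_0: "0 \<in> ring_span G"
  using ring_span_add[OF ring_span_1 ring_span_minus[OF ring_span_1]] by simp

lemma ring_span_diff: "x \<in> ring_span G \<Longrightarrow> y \<in> ring_span G \<Longrightarrow> x - y \<in> ring_span G"
  using ring_span_add[OF _ ring_span_minus, of x G y] by simp

lemma ring_span_power: "x \<in> ring_span G \<Longrightarrow> x ^ n \<in> ring_span G"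
  by (induction n) (simp_all add: ring_span_1 ring_span_mult)

lemma ring_span_sum: "(\<And>a. a \<in> A \<Longrightarrow> f a \<in> ring_span G) \<Longrightarrow> sum f A \<in> ring_span G"
  by (induction A rule: infinite_finite_induct) (simp_all add: ring_span_0 ring_span_add)

lemma ring_span_prod: "(\<And>a. a \<in> A \<Longrightarrow> f a \<in> ring_span G) \<Longrightarrow> prod f A \<in> ring_span G"
  by (induction A rule: infinite_finite_induct) (simp_all add: ring_span_1 ring_span_mult)

lemma ring_span_power_int:
  "x \<in> ring_span G \<Longrightarrow> inverse x \<in> ring_span G \<Longrightarrow> (x::'a::field) powi n \<in> ring_span G"
  by (simp add: power_int_def ring_span_power)

lemmas ring_span_intros = ring_span_1 ring_span_0 ring_span_add ring_span_mult ring_span_minus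
  ring_span_diff ring_span_power ring_span_sum ring_span_prod ring_span_power_int

lemma ring_span_induct [consumes 1, case_names incl one minus add mult]:
  assumes "x \<in> ring_span G"
    and "\<And>x. x \<in> G \<Longrightarrow> P x" and "P 1" and "\<And>x. P x \<Longrightarrow> P (- x)"
    and "\<And>x y. P x \<Longrightarrow> P y \<Longrightarrow> P (x + y)" and "\<And>x y. P x \<Longrightarrow> P y \<Longrightarrow> P (x * y)"
  shows "P x"
  using assms(1) unfolding ring_span_def
  by (induction rule: generate_ring.induct) (simp_all add: assms(2-))

lemma ring_span_mono:
  assumes "G \<subseteq> ring_span Y" shows "ring_span G \<subseteq> ring_span Y"
proof
  fix x assume "x \<in> ring_span G"
  then show "x \<in> ring_span Y"
    by (induction rule: ring_span_induct) (use assms in \<open>auto intro: ring_span_intros\<close>)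
qed

lemma field_hom_ring_span:
  assumes "field_hom h" and "x \<in> ring_span G" and "\<And>x. x \<in> G \<Longrightarrow> h x \<in> ring_span Y"
  shows "h x \<in> ring_span Y"
  using assms(2) by (induction rule: ring_span_induct)
    (simp_all add: assms field_hom_simps[OF assms(1)] ring_span_intros)

text \<open>The elements that some power of p moves into \<open>ring_span Y\<close> form a subring,
  in effect the localization at p. So only the denominators of the generators have to be
  cleared.\<close>

lemma ring_span_localize:
  assumes "x \<in> ring_span G" and p: "p \<in> ring_span Y"
    and gen: "\<And>x. x \<in> G \<Longrightarrow> \<exists>n. p ^ n * x \<in> ring_span Y"
  shows "\<exists>n. p ^ n * x \<in> ring_span Y"
  using assms(1)
proof (induction rule: ring_span_induct)
  case (incl x)
  then show ?case by (rule gen)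
next
  case one
  show ?case by (rule exI[of _ 0]) (simp add: ring_span_1)
next
  case (minus x)
  then obtain n where "p ^ n * x \<in> ring_span Y" ..
  then show ?case using ring_span_minus[of "p ^ n * x" Y] by (intro exI[of _ n]) simp
next
  case (add x y)
  then obtain n m where "p ^ n * x \<in> ring_span Y" "p ^ m * y \<in> ring_span Y" by blast
  then have "p ^ m * (p ^ n * x) + p ^ n * (p ^ m * y) \<in> ring_span Y"
    by (metis ring_span_add ring_span_mult ring_span_power p)
  then show ?case by (intro exI[of _ "n + m"]) (simp add: algebra_simps power_add)
next
  case (mult x y)
  then obtain n m where "p ^ n * x \<in> ring_span Y" "p ^ m * y \<in> ring_span Y" by blast
  then have "(p ^ n * x) * (p ^ m * y) \<in> ring_span Y" by (rule ring_span_mult)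
  then show ?case by (intro exI[of _ "n + m"]) (simp add: algebra_simps power_add)
qed

section \<open>Evaluation of polynomials and substitution into rational functions\<close>

type_synonym mpoly_rat = "(nat \<Rightarrow>\<^sub>0 nat) \<Rightarrow>\<^sub>0 rat"

definition rat_const :: "rat \<Rightarrow> ratfun" where
  "rat_const r = Fract (Poly_Mapping.single 0 r) 1"

lemma rat_const_simps:
  "rat_const 0 = 0" "rat_const 1 = 1" "rat_const (a + b) = rat_const a + rat_const b"
  "rat_const (a * b) = rat_const a * rat_const b"
  by (simp_all add: rat_const_def single_add mult_single Zero_fract_def One_fract_def)

lemma rat_const_eq_iff: "rat_const a = rat_const b \<longleftrightarrow> a = b"
  by (auto simp: rat_const_def eq_fract dest: injD[OF inj_single])

lemma rat_const_of_nat: "rat_const (of_nat n) = of_nat n"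
  by (induction n) (simp_all add: rat_const_simps)

lemma rat_const_of_int: "rat_const (of_int n) = of_int n"
proof (cases n)
  case (neg m)
  have "rat_const (of_int n) + rat_const (of_nat (Suc m)) = 0"
    unfolding rat_const_simps(3)[symmetric] by (simp add: neg rat_const_simps)
  then show ?thesis by (simp add: neg rat_const_of_nat eq_neg_iff_add_eq_0 del: of_nat_Suc)
qed (simp add: rat_const_of_nat)

lemma of_int_ratfun_eq_0_iff: "(of_int n :: ratfun) = 0 \<longleftrightarrow> n = 0"
  using rat_const_eq_iff[of "of_int n" 0] by (simp add: rat_const_of_int rat_const_simps)

lemma field_hom_rat_const:
  assumes "field_hom (h :: ratfun \<Rightarrow> ratfun)" shows "h (rat_const r) = rat_const r"
proof (cases r)
  case (Fract a b)
  have "rat_const r * of_int b = of_int a"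
    using Fract by (simp add: Fract_of_int_quotient of_rat_divide
        flip: rat_const_of_int rat_const_simps)
  then have eq: "rat_const r = of_int a / of_int b"
    using Fract(2) by (simp add: field_simps of_int_ratfun_eq_0_iff)
  show ?thesis unfolding eq
    by (simp add: field_hom_divide[OF assms] field_hom_of_int[OF assms])
qed

definition mono_eval :: "(nat \<Rightarrow> ratfun) \<Rightarrow> (nat \<Rightarrow>\<^sub>0 nat) \<Rightarrow> ratfun" where
  "mono_eval y m = (\<Prod>i\<in>Poly_Mapping.keys m. y i ^ Poly_Mapping.lookup m i)"

definition poly_eval :: "(nat \<Rightarrow> ratfun) \<Rightarrow> mpoly_rat \<Rightarrow> ratfun" where
  "poly_eval y p = (\<Sum>m\<in>Poly_Mapping.keys p. rat_const (Poly_Mapping.lookup p m) * mono_eval y m)"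

lemma mono_eval_superset:
  "finite I \<Longrightarrow> Poly_Mapping.keys m \<subseteq> I \<Longrightarrow> mono_eval y m = (\<Prod>i\<in>I. y i ^ Poly_Mapping.lookup m i)"
  unfolding mono_eval_def by (rule prod.mono_neutral_left) (auto simp: in_keys_iff)

lemma poly_eval_superset:
  "finite M \<Longrightarrow> Poly_Mapping.keys p \<subseteq> M \<Longrightarrow>
     poly_eval y p = (\<Sum>m\<in>M. rat_const (Poly_Mapping.lookup p m) * mono_eval y m)"
  unfolding poly_eval_def by (rule sum.mono_neutral_left) (auto simp: in_keys_iff rat_const_simps)

lemma mono_eval_add: "mono_eval y (m + n) = mono_eval y m * mono_eval y n"
proof -
  let ?I = "Poly_Mapping.keys m \<union> Poly_Mapping.keys n"
  have "mono_eval y (m + n) = (\<Prod>i\<in>?I. y i ^ Poly_Mapping.lookup (m + n) i)"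
    by (rule mono_eval_superset) (use Poly_Mapping.keys_add[of m n] in auto)
  also have "\<dots> = (\<Prod>i\<in>?I. y i ^ Poly_Mapping.lookup m i) * (\<Prod>i\<in>?I. y i ^ Poly_Mapping.lookup n i)"
    by (simp add: lookup_add power_add prod.distrib)
  also have "\<dots> = mono_eval y m * mono_eval y n"
    by (simp add: mono_eval_superset[of ?I, symmetric])
  finally show ?thesis .
qed

lemma mono_eval_0: "mono_eval y 0 = 1"
  by (simp add: mono_eval_def)

lemma poly_eval_add: "poly_eval y (p + q) = poly_eval y p + poly_eval y q"
proof -
  let ?M = "Poly_Mapping.keys p \<union> Poly_Mapping.keys q"
  have "poly_eval y (p + q) = (\<Sum>m\<in>?M. rat_const (Poly_Mapping.lookup (p + q) m) * mono_eval y m)"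
    by (rule poly_eval_superset) (use Poly_Mapping.keys_add[of p q] in auto)
  also have "\<dots> = (\<Sum>m\<in>?M. rat_const (Poly_Mapping.lookup p m) * mono_eval y m)
      + (\<Sum>m\<in>?M. rat_const (Poly_Mapping.lookup q m) * mono_eval y m)"
    by (simp add: lookup_add rat_const_simps algebra_simps sum.distrib)
  also have "\<dots> = poly_eval y p + poly_eval y q"
    by (simp add: poly_eval_superset[of ?M, symmetric])
  finally show ?thesis .
qed

lemma poly_eval_0: "poly_eval y 0 = 0"
  by (simp add: poly_eval_def)

lemma poly_eval_sum: "poly_eval y (sum f A) = (\<Sum>a\<in>A. poly_eval y (f a))"
  by (induction A rule: infinite_finite_induct) (simp_all add: poly_eval_0 poly_eval_add)

lemma poly_eval_single: "poly_eval y (Poly_Mapping.single m r) = rat_const r * mono_eval y m"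
  by (cases "r = 0") (simp_all add: poly_eval_def rat_const_simps)

lemma sum_singles: "p = (\<Sum>m\<in>Poly_Mapping.keys p. Poly_Mapping.single m (Poly_Mapping.lookup p m))"
proof (rule poly_mapping_eqI)
  fix k
  have "(\<Sum>m\<in>Poly_Mapping.keys p. Poly_Mapping.lookup (Poly_Mapping.single m (Poly_Mapping.lookup p m)) k)
      = (\<Sum>m\<in>Poly_Mapping.keys p. if m = k then Poly_Mapping.lookup p m else 0)"
    by (intro sum.cong) (auto simp: lookup_single)
  then show "Poly_Mapping.lookup p k =
      Poly_Mapping.lookup (\<Sum>m\<in>Poly_Mapping.keys p. Poly_Mapping.single m (Poly_Mapping.lookup p m)) k"
    by (simp add: lookup_sum in_keys_iff)
qed

lemma poly_eval_mult: "poly_eval y (p * q) = poly_eval y p * poly_eval y q"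
proof -
  let ?s = "\<lambda>p m. Poly_Mapping.single m (Poly_Mapping.lookup p m) :: mpoly_rat"
  have "p * q = (\<Sum>m\<in>Poly_Mapping.keys p. ?s p m) * (\<Sum>n\<in>Poly_Mapping.keys q. ?s q n)"
    by (simp flip: sum_singles)
  also have "\<dots> = (\<Sum>m\<in>Poly_Mapping.keys p. \<Sum>n\<in>Poly_Mapping.keys q.
      Poly_Mapping.single (m + n) (Poly_Mapping.lookup p m * Poly_Mapping.lookup q n))"
    by (simp add: sum_product mult_single)
  finally have "poly_eval y (p * q) = (\<Sum>m\<in>Poly_Mapping.keys p. \<Sum>n\<in>Poly_Mapping.keys q.
      (rat_const (Poly_Mapping.lookup p m) * mono_eval y m) * (rat_const (Poly_Mapping.lookup q n) * mono_eval y n))"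
    by (simp add: poly_eval_sum poly_eval_single rat_const_simps mono_eval_add algebra_simps)
  then show ?thesis by (simp add: poly_eval_def sum_product)
qed

lemma poly_eval_1: "poly_eval y 1 = 1"
  using poly_eval_single[of y 0 1] by (simp add: mono_eval_0 rat_const_simps)

lemma poly_eval_const: "poly_eval y (Poly_Mapping.single 0 r) = rat_const r"
  by (simp add: poly_eval_single mono_eval_0)

lemma poly_eval_var: "poly_eval y (Poly_Mapping.single (Poly_Mapping.single i 1) 1) = y i"
  by (simp add: poly_eval_single rat_const_simps mono_eval_def)

lemma field_hom_poly_eval:
  assumes "field_hom h" shows "h (poly_eval y p) = poly_eval (\<lambda>i. h (y i)) p"
  by (simp add: poly_eval_def mono_eval_def field_hom_simps[OF assms] field_hom_rat_const[OF assms])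

lemma Fract_1_mult: "Fract (a * b) 1 = (Fract a 1 * Fract b 1 :: 'a::idom fract)"
  and Fract_1_add: "Fract (a + b) 1 = (Fract a 1 + Fract b 1 :: 'a::idom fract)"
  by simp_all

lemma Fract_power: "Fract (a ^ n) 1 = (Fract a 1 :: 'a::idom fract) ^ n"
  by (induction n) (simp_all only: power.simps Fract_1_mult One_fract_def)

lemma Fract_prod: "Fract (prod f A) 1 = (\<Prod>a\<in>A. Fract (f a) 1 :: 'a::idom fract)"
  by (induction A rule: infinite_finite_induct) (simp_all add: Fract_1_mult One_fract_def del: mult_fract)

lemma Fract_sum: "Fract (sum f A) 1 = (\<Sum>a\<in>A. Fract (f a) 1 :: 'a::idom fract)"
  by (induction A rule: infinite_finite_induct) (simp_all add: Fract_1_add Zero_fract_def del: add_fract)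

lemma single_pow:
  "Poly_Mapping.single (Poly_Mapping.single i k) (1::rat) = Poly_Mapping.single (Poly_Mapping.single i (1::nat)) 1 ^ k"
proof (induction k)
  case (Suc k)
  have "Poly_Mapping.single (Poly_Mapping.single i (Suc k)) (1::rat)
      = Poly_Mapping.single (Poly_Mapping.single i 1 + Poly_Mapping.single i k) (1 * 1)"
    by (simp flip: single_add)
  also have "\<dots> = Poly_Mapping.single (Poly_Mapping.single i 1) 1 * Poly_Mapping.single (Poly_Mapping.single i k) 1"
    by (rule mult_single[symmetric])
  finally show ?case by (simp add: Suc)
qed simp

lemma single_sum_prod:
  "Poly_Mapping.single (\<Sum>i\<in>I. f i) (1::rat) = (\<Prod>i\<in>I. Poly_Mapping.single (f i) 1)"
  for f :: "'b \<Rightarrow> nat \<Rightarrow>\<^sub>0 nat"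
proof (induction I rule: infinite_finite_induct)
  case (insert i I)
  then show ?case using mult_single[of "f i" "1::rat" "sum f I" 1] by simp
qed simp_all

lemma Fract_mono: "Fract (Poly_Mapping.single m 1) 1 = mono_eval indet m"
proof -
  have "Poly_Mapping.single m (1::rat)
      = (\<Prod>i\<in>Poly_Mapping.keys m. Poly_Mapping.single (Poly_Mapping.single i 1) 1 ^ Poly_Mapping.lookup m i)"
    by (subst sum_singles[of m], subst single_sum_prod, rule prod.cong[OF refl], rule single_pow)
  then show ?thesis by (simp add: Fract_prod Fract_power mono_eval_def indet_def)
qed

lemma Fract_poly: "Fract p 1 = poly_eval indet p"
proof -
  have "Fract (Poly_Mapping.single m r) 1 = rat_const r * mono_eval indet m" for m and r :: rat
    using mult_single[of "0 :: nat \<Rightarrow>\<^sub>0 nat" r m 1] by (simp add: rat_const_def flip: Fract_mono)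
  then have "Fract (\<Sum>m\<in>Poly_Mapping.keys p. Poly_Mapping.single m (Poly_Mapping.lookup p m)) 1 = poly_eval indet p"
    by (simp add: Fract_sum poly_eval_def)
  then show ?thesis by (simp flip: sum_singles)
qed

lemma poly_eval_indet_eq_0_iff: "poly_eval indet p = 0 \<longleftrightarrow> p = 0"
  by (simp add: Zero_fract_def eq_fract flip: Fract_poly)

lemma ratfun_cases:
  obtains a b where "b \<noteq> 0" and "f = poly_eval indet a / poly_eval indet b"
proof (cases f)
  case (Fract a b)
  then have "f = Fract a 1 / Fract b 1" by simp
  with Fract(2) show ?thesis by (intro that[of b a]) (simp_all add: Fract_poly)
qed

lemma indet_nz: "indet i \<noteq> 0"
  using poly_eval_indet_eq_0_iff[of "Poly_Mapping.single (Poly_Mapping.single i 1) 1"]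
  unfolding poly_eval_var by (metis single_zero inj_single injD zero_neq_one)

lemma field_hom_eqI:
  fixes g h :: "ratfun \<Rightarrow> ratfun"
  assumes "field_hom g" "field_hom h" "\<And>i. g (indet i) = h (indet i)"
  shows "g f = h f"
proof -
  obtain a b where "f = poly_eval indet a / poly_eval indet b" by (rule ratfun_cases)
  then show ?thesis
    by (simp add: field_hom_divide[OF assms(1)] field_hom_divide[OF assms(2)]
        field_hom_poly_eval[OF assms(1)] field_hom_poly_eval[OF assms(2)] assms(3))
qed

text \<open>The graph of the substitution \<open>indet i \<mapsto> w i\<close>, a partial map: defined where some
  denominator does not vanish.\<close>

definition subst_rel :: "(nat \<Rightarrow> ratfun) \<Rightarrow> ratfun \<Rightarrow> ratfun \<Rightarrow> bool" where
  "subst_rel w f g \<longleftrightarrow> (\<exists>a b. poly_eval w b \<noteq> 0 \<and> f * poly_eval indet b = poly_eval indet a \<and>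
      g * poly_eval w b = poly_eval w a)"

text \<open>Cross-multiplying two presentations of f gives an identity of polynomials, since the
  variables are independent. The identity may be evaluated at w, where both denominators are
  nonzero.\<close>

lemma subst_rel_unique:
  assumes "subst_rel w f g" "subst_rel w f g'" shows "g = g'"
proof -
  from assms obtain a b a' b' where *: "poly_eval w b \<noteq> 0" "f * poly_eval indet b = poly_eval indet a"
    "g * poly_eval w b = poly_eval w a" "poly_eval w b' \<noteq> 0" "f * poly_eval indet b' = poly_eval indet a'"
    "g' * poly_eval w b' = poly_eval w a'" unfolding subst_rel_def by blast
  have "poly_eval indet (a * b' - a' * b) + poly_eval indet (a' * b) = poly_eval indet (a * b')"
    by (simp flip: poly_eval_add)
  then have "poly_eval indet (a * b' - a' * b) = 0"
    by (simp add: poly_eval_mult algebra_simps flip: *)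
  then have "a * b' = a' * b" by (simp add: poly_eval_indet_eq_0_iff)
  then have "poly_eval w a * poly_eval w b' = poly_eval w a' * poly_eval w b"
    by (metis poly_eval_mult)
  then have "(g - g') * (poly_eval w b * poly_eval w b') = 0"
    by (simp add: algebra_simps flip: *)
  with * show ?thesis by simp
qed

lemma subst_rel_const: "subst_rel w (rat_const r) (rat_const r)"
  unfolding subst_rel_def
  by (rule exI[of _ "Poly_Mapping.single 0 r"], rule exI[of _ 1]) (simp add: poly_eval_1 poly_eval_const)

lemma subst_rel_0: "subst_rel w 0 0" and subst_rel_1: "subst_rel w 1 1"
  using subst_rel_const[of w 0] subst_rel_const[of w 1] by (simp_all add: rat_const_simps)

lemma subst_rel_indet: "subst_rel w (indet i) (w i)"
  unfolding subst_rel_def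
  by (rule exI[of _ "Poly_Mapping.single (Poly_Mapping.single i 1) 1"], rule exI[of _ 1])
    (simp only: poly_eval_1 poly_eval_var, simp)

lemma subst_rel_add: "subst_rel w f g \<Longrightarrow> subst_rel w f' g' \<Longrightarrow> subst_rel w (f + f') (g + g')"
proof -
  assume "subst_rel w f g" "subst_rel w f' g'"
  then obtain a b a' b' where *: "poly_eval w b \<noteq> 0" "f * poly_eval indet b = poly_eval indet a"
    "g * poly_eval w b = poly_eval w a" "poly_eval w b' \<noteq> 0" "f' * poly_eval indet b' = poly_eval indet a'"
    "g' * poly_eval w b' = poly_eval w a'" unfolding subst_rel_def by blast
  show ?thesis unfolding subst_rel_def
  proof (rule exI[of _ "a * b' + a' * b"], rule exI[of _ "b * b'"], intro conjI)
    show "poly_eval w (b * b') \<noteq> 0" using *(1,4) by (simp add: poly_eval_mult)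
    show "(f + f') * poly_eval indet (b * b') = poly_eval indet (a * b' + a' * b)"
      unfolding poly_eval_mult poly_eval_add *(2,5)[symmetric] by (simp only: algebra_simps)
    show "(g + g') * poly_eval w (b * b') = poly_eval w (a * b' + a' * b)"
      unfolding poly_eval_mult poly_eval_add *(3,6)[symmetric] by (simp only: algebra_simps)
  qed
qed

lemma subst_rel_mult: "subst_rel w f g \<Longrightarrow> subst_rel w f' g' \<Longrightarrow> subst_rel w (f * f') (g * g')"
proof -
  assume "subst_rel w f g" "subst_rel w f' g'"
  then obtain a b a' b' where *: "poly_eval w b \<noteq> 0" "f * poly_eval indet b = poly_eval indet a"
    "g * poly_eval w b = poly_eval w a" "poly_eval w b' \<noteq> 0" "f' * poly_eval indet b' = poly_eval indet a'"
    "g' * poly_eval w b' = poly_eval w a'" unfolding subst_rel_def by blast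
  show ?thesis unfolding subst_rel_def
  proof (rule exI[of _ "a * a'"], rule exI[of _ "b * b'"], intro conjI)
    show "poly_eval w (b * b') \<noteq> 0" using *(1,4) by (simp add: poly_eval_mult)
    show "(f * f') * poly_eval indet (b * b') = poly_eval indet (a * a')"
      unfolding poly_eval_mult poly_eval_add *(2,5)[symmetric] by (simp only: algebra_simps)
    show "(g * g') * poly_eval w (b * b') = poly_eval w (a * a')"
      unfolding poly_eval_mult poly_eval_add *(3,6)[symmetric] by (simp only: algebra_simps)
  qed
qed

lemma subst_rel_inverse: "subst_rel w f g \<Longrightarrow> g \<noteq> 0 \<Longrightarrow> subst_rel w (inverse f) (inverse g)"
proof -
  assume rel: "subst_rel w f g" and nz: "g \<noteq> 0"
  then obtain a b where *: "poly_eval w b \<noteq> 0" "f * poly_eval indet b = poly_eval indet a"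
    "g * poly_eval w b = poly_eval w a" unfolding subst_rel_def by (elim exE conjE) blast
  \<comment> \<open>If f were zero it would be related to 0 as well as to g, against
    uniqueness.\<close>
  have f: "f \<noteq> 0"
  proof
    assume "f = 0"
    with rel have "subst_rel w 0 g" by simp
    from subst_rel_unique[OF this subst_rel_0] nz show False by simp
  qed
  have "poly_eval w a \<noteq> 0" using *(1) nz *(3) by (metis mult_eq_0_iff)
  moreover have "inverse f * poly_eval indet a = inverse f * f * poly_eval indet b"
    by (simp only: *(2)[symmetric] mult.assoc)
  moreover have "inverse g * poly_eval w a = inverse g * g * poly_eval w b"
    by (simp only: *(3)[symmetric] mult.assoc)
  ultimately show ?thesis
    unfolding subst_rel_def
    by (rule_tac exI[of _ b], rule_tac exI[of _ a]) (simp add: left_inverse[OF f] left_inverse[OF nz])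
qed

lemma subst_rel_divide:
  "subst_rel w f g \<Longrightarrow> subst_rel w f' g' \<Longrightarrow> g' \<noteq> 0 \<Longrightarrow> subst_rel w (f / f') (g / g')"
  unfolding divide_inverse by (intro subst_rel_mult subst_rel_inverse)

lemma subst_rel_power: "subst_rel w f g \<Longrightarrow> subst_rel w (f ^ n) (g ^ n)"
  by (induction n) (simp_all add: subst_rel_1 subst_rel_mult)

lemma subst_rel_power_int: "subst_rel w f g \<Longrightarrow> g \<noteq> 0 \<Longrightarrow> subst_rel w (f powi n) (g powi n)"
  unfolding power_int_def by (simp add: subst_rel_power subst_rel_inverse del: power_inverse)

lemma subst_rel_sum:
  "(\<And>a. a \<in> A \<Longrightarrow> subst_rel w (f a) (g a)) \<Longrightarrow> subst_rel w (sum f A) (sum g A)"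
  by (induction A rule: infinite_finite_induct) (simp_all add: subst_rel_0 subst_rel_add)

lemma subst_rel_prod:
  "(\<And>a. a \<in> A \<Longrightarrow> subst_rel w (f a) (g a)) \<Longrightarrow> subst_rel w (prod f A) (prod g A)"
  by (induction A rule: infinite_finite_induct) (simp_all add: subst_rel_1 subst_rel_mult)

text \<open>A substitution with a left inverse is injective on polynomials, so it extends to the
  field of fractions.\<close>

lemma substitution_exists:
  assumes "\<And>i. subst_rel w (y i) (indet i)"
  obtains h where "field_hom h" and "\<And>i. h (indet i) = y i"
proof -
  have "subst_rel w (poly_eval y p) (poly_eval indet p)" for p
    unfolding poly_eval_def mono_eval_def
    by (intro subst_rel_sum subst_rel_mult subst_rel_const subst_rel_prod subst_rel_power assms)
  then have inj: "poly_eval y p \<noteq> 0" if "p \<noteq> 0" for p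
    using that poly_eval_indet_eq_0_iff subst_rel_unique subst_rel_0 by metis
  have "\<exists>g. subst_rel y f g" for f
  proof -
    obtain a b where ab: "b \<noteq> 0" "f = poly_eval indet a / poly_eval indet b" by (rule ratfun_cases)
    then show ?thesis unfolding subst_rel_def
      by (intro exI[of _ "poly_eval y a / poly_eval y b"] exI[of _ a] exI[of _ b])
        (simp add: inj poly_eval_indet_eq_0_iff)
  qed
  then obtain h where h: "subst_rel y f (h f)" for f by metis
  have eq: "h f = g" if "subst_rel y f g" for f g
    using subst_rel_unique[OF h that] .
  show ?thesis
  proof (rule that)
    show "field_hom h"
      by (intro field_homI eq subst_rel_1 subst_rel_add subst_rel_mult h)
    show "h (indet i) = y i" for i by (intro eq subst_rel_indet)
  qed
qed

section \<open>Gradings\<close>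

lemma ratfun_two_nz: "(2::ratfun) \<noteq> 0"
  using of_int_ratfun_eq_0_iff[of 2] by simp

lemma two_powi_inj: "(2::ratfun) powi d = 2 powi e \<longleftrightarrow> d = e"
proof -
  have less: "d = e" if eq: "(2::ratfun) powi d = 2 powi e" and "d \<le> e" for d e
  proof -
    have "(2::ratfun) powi (e - d) = 1"
      using eq ratfun_two_nz by (simp add: power_int_diff)
    then have "(2::ratfun) ^ nat (e - d) = 1" using \<open>d \<le> e\<close> by (simp add: power_int_def)
    then have "of_int (2 ^ nat (e - d) - 1) = (0::ratfun)" by simp
    then have "(2::int) ^ nat (e - d) = 1" by (simp only: of_int_ratfun_eq_0_iff)
    then have "nat (e - d) = 0" by simp
    then show ?thesis using \<open>d \<le> e\<close> by simp
  qed
  show ?thesis using less[of d e] less[of e d] by (metis linear)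
qed

text \<open>A weight c is encoded as the automorphism that multiplies the i-th variable by 2 to the
  power c i. Its eigenspaces \<open>homog c d\<close> are the homogeneous parts, rational functions
  included. Since 2 is not a root of unity, \<open>two_powi_inj\<close>, different degrees have
  different eigenvalues.\<close>

definition scale :: "(nat \<Rightarrow> int) \<Rightarrow> ratfun \<Rightarrow> ratfun" where
  "scale c = (SOME h. field_hom h \<and> (\<forall>i. h (indet i) = 2 powi c i * indet i))"

lemma scale: "field_hom (scale c)" "scale c (indet i) = 2 powi c i * indet i"
proof -
  have two: "subst_rel w (2 powi n) (2 powi n)" for w n
    using subst_rel_power_int[OF subst_rel_const[of w 2]] rat_const_of_int[of 2] ratfun_two_nz by simp
  have "subst_rel (\<lambda>i. 2 powi (- c i) * indet i) (2 powi c i * indet i) (indet i)" for i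
    using subst_rel_mult[OF two[of _ "c i"] subst_rel_indet[of "\<lambda>i. 2 powi (- c i) * indet i" i]]
    by (simp add: mult.assoc[symmetric] ratfun_two_nz flip: power_int_add)
  then obtain h where "field_hom h" "\<And>i. h (indet i) = 2 powi c i * indet i"
    using substitution_exists[of "\<lambda>i. 2 powi (- c i) * indet i" "\<lambda>i. 2 powi c i * indet i"] by blast
  then have "\<exists>h. field_hom h \<and> (\<forall>i. h (indet i) = 2 powi c i * indet i)" by blast
  from someI_ex[OF this] show "field_hom (scale c)" "scale c (indet i) = 2 powi c i * indet i"
    unfolding scale_def by auto
qed

lemmas scale_simps = field_hom_simps[OF scale(1)]

definition homog :: "(nat \<Rightarrow> int) \<Rightarrow> int \<Rightarrow> ratfun set" where
  "homog c d = {f. scale c f = 2 powi d * f}"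

lemma homog_indet: "indet i \<in> homog c (c i)"
  by (simp add: homog_def scale)

lemma homog_0: "0 \<in> homog c d"
  and homog_1: "1 \<in> homog c 0"
  and homog_add: "f \<in> homog c d \<Longrightarrow> g \<in> homog c d \<Longrightarrow> f + g \<in> homog c d"
  and homog_minus: "f \<in> homog c d \<Longrightarrow> - f \<in> homog c d"
  by (simp_all add: homog_def scale_simps algebra_simps)

lemma homog_mult: "f \<in> homog c d \<Longrightarrow> g \<in> homog c e \<Longrightarrow> f * g \<in> homog c (d + e)"
  by (simp add: homog_def scale_simps power_int_add ratfun_two_nz)

lemma homog_inverse: "f \<in> homog c d \<Longrightarrow> inverse f \<in> homog c (- d)"
  by (simp add: homog_def scale_simps power_int_minus)

lemma homog_power: "f \<in> homog c d \<Longrightarrow> f ^ n \<in> homog c (int n * d)"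
  by (induction n) (auto simp: homog_1 algebra_simps dest: homog_mult)

lemma homog_power_int: "f \<in> homog c d \<Longrightarrow> f powi n \<in> homog c (n * d)"
  unfolding homog_def mem_Collect_eq mult.commute[of n d]
  by (simp add: scale_simps power_int_mult_distrib power_int_mult)

lemma homog_prod: "(\<And>i. i \<in> A \<Longrightarrow> f i \<in> homog c (d i)) \<Longrightarrow> prod f A \<in> homog c (sum d A)"
  by (induction A rule: infinite_finite_induct) (auto simp: homog_1 homog_mult)

text \<open>Eigenvectors for distinct eigenvalues are independent: \<open>scale c\<close> minus the
  eigenvalue of e removes the component of degree e and multiplies the others by nonzero
  constants.\<close>

lemma homog_independent:
  assumes "finite I" "\<And>d. d \<in> I \<Longrightarrow> h d \<in> homog c d" "sum h I = 0"
  shows "\<forall>d\<in>I. h d = 0"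
  using assms
proof (induction I arbitrary: h rule: finite_induct)
  case (insert e I)
  have "scale c (h e + sum h I) - 2 powi e * (h e + sum h I) = 0"
    using insert.prems(2) insert.hyps by (simp add: scale_simps)
  moreover have "scale c (h e + sum h I) - 2 powi e * (h e + sum h I) = (\<Sum>d\<in>I. (2 powi d - 2 powi e) * h d)"
    using insert.prems(1) by (simp add: scale_simps homog_def algebra_simps sum_distrib_left sum_distrib_right sum_subtractf)
  moreover have "(2 powi d - 2 powi e) * h d \<in> homog c d" if "d \<in> I" for d
    using insert.prems(1)[of d] that by (simp add: homog_def scale_simps)
  ultimately have "\<forall>d\<in>I. (2 powi d - 2 powi e) * h d = 0"
    by (intro insert.IH) auto
  moreover have "2 powi d - 2 powi e \<noteq> (0::ratfun)" if "d \<in> I" for d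
    using that insert.hyps by (auto simp: two_powi_inj)
  ultimately have "\<forall>d\<in>I. h d = 0" by simp
  then show ?case using insert.prems(2) insert.hyps by simp
qed simp

lemma homog_components_unique:
  assumes "finite I" "finite K" "\<And>d. d \<in> I \<Longrightarrow> h d \<in> homog c d" "\<And>d. d \<in> K \<Longrightarrow> g d \<in> homog c d"
    and "sum h I = sum g K"
  shows "(if d \<in> I then h d else 0) = (if d \<in> K then g d else 0)"
proof -
  let ?d = "\<lambda>d. (if d \<in> I then h d else 0) - (if d \<in> K then g d else 0)"
  have "(\<Sum>d\<in>I \<union> K. if d \<in> I then h d else 0) = sum h I" "(\<Sum>d\<in>I \<union> K. if d \<in> K then g d else 0) = sum g K"
    using assms(1,2) by (simp_all add: sum.If_cases Int_absorb1 Int_commute)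
  then have "sum ?d (I \<union> K) = 0" using assms(5) by (simp add: sum_subtractf)
  moreover have "?d d \<in> homog c d" if "d \<in> I \<union> K" for d
    using homog_add[OF _ homog_minus, of _ c d] homog_0 homog_minus assms(3,4) that by auto
  ultimately have "\<forall>d\<in>I \<union> K. ?d d = 0" by (intro homog_independent[of _ _ c]) (use assms in auto)
  then show ?thesis by (cases "d \<in> I \<union> K") auto
qed

text \<open>P is left arbitrary: it is later \<open>homog c d\<close> cut down to a subring, the
  multiples of the d-th power of one variable by elements of a ring, or \<open>homog c d\<close> in
  nonnegative degrees only.\<close>

definition graded_sum :: "(int \<Rightarrow> ratfun set) \<Rightarrow> ratfun set" where
  "graded_sum P = {sum h I | h I. finite I \<and> (\<forall>d\<in>I. h d \<in> P d)}"

lemma graded_sumE: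
  assumes "f \<in> graded_sum P"
  obtains I h where "finite I" "\<And>d. d \<in> I \<Longrightarrow> h d \<in> P d" "f = sum h I"
  using assms by (auto simp: graded_sum_def)

lemma ring_span_graded_sum:
  assumes P: "\<And>d. 0 \<in> P d" "\<And>d x y. x \<in> P d \<Longrightarrow> y \<in> P d \<Longrightarrow> x + y \<in> P d"
    "\<And>d x. x \<in> P d \<Longrightarrow> - x \<in> P d" "1 \<in> P 0"
    "\<And>d e x y. x \<in> P d \<Longrightarrow> y \<in> P e \<Longrightarrow> x * y \<in> P (d + e)"
    and gens: "\<And>x. x \<in> G \<Longrightarrow> \<exists>d. x \<in> P d" and f: "f \<in> ring_span G"
  shows "f \<in> graded_sum P"
proof -
  have hom: "x \<in> graded_sum P" if "x \<in> P d" for x d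
    unfolding graded_sum_def using that by (intro CollectI exI[of _ "\<lambda>_. x"] exI[of _ "{d}"]) auto
  have add: "x + y \<in> graded_sum P" if xy: "x \<in> graded_sum P" "y \<in> graded_sum P" for x y
  proof -
    obtain I h where I: "finite I" "\<And>d. d \<in> I \<Longrightarrow> h d \<in> P d" "x = sum h I" using graded_sumE[OF xy(1)] by blast
    obtain K g where K: "finite K" "\<And>d. d \<in> K \<Longrightarrow> g d \<in> P d" "y = sum g K" using graded_sumE[OF xy(2)] by blast
    let ?s = "\<lambda>d. (if d \<in> I then h d else 0) + (if d \<in> K then g d else 0)"
    have "x + y = sum ?s (I \<union> K)"
      using I(1) K(1) by (simp add: I(3) K(3) sum.distrib sum.If_cases Int_absorb1 Int_commute)
    moreover have "?s d \<in> P d" if "d \<in> I \<union> K" for d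
      using that I(2) K(2) P(1,2) by (auto intro!: P(2))
    ultimately show ?thesis unfolding graded_sum_def
      using I(1) K(1) by (intro CollectI exI[of _ ?s] exI[of _ "I \<union> K"]) auto
  qed
  have zero: "0 \<in> graded_sum P" using hom P(1) by blast
  have sum: "sum s A \<in> graded_sum P" if "\<And>a. a \<in> A \<Longrightarrow> s a \<in> graded_sum P" for s and A :: "'b set"
    using that by (induction A rule: infinite_finite_induct) (auto simp: zero add)
  show ?thesis using f
  proof (induction rule: ring_span_induct)
    case (incl x) then show ?case using gens hom by blast
  next
    case one show ?case using hom P(4) by blast
  next
    case (minus x)
    then obtain I h where I: "finite I" "\<And>d. d \<in> I \<Longrightarrow> h d \<in> P d" "x = sum h I" using graded_sumE by blast
    have "- x = (\<Sum>d\<in>I. - h d)" by (simp add: I(3) sum_negf)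
    then show ?case using sum[of I "\<lambda>d. - h d"] hom P(3) I(2) by metis
  next
    case (add x y) then show ?case using \<open>\<And>x y. _ \<Longrightarrow> _ \<Longrightarrow> x + y \<in> graded_sum P\<close> by blast
  next
    case (mult x y)
    obtain I h where I: "finite I" "\<And>d. d \<in> I \<Longrightarrow> h d \<in> P d" "x = sum h I" using graded_sumE[OF mult(1)] by blast
    obtain K g where K: "finite K" "\<And>d. d \<in> K \<Longrightarrow> g d \<in> P d" "y = sum g K" using graded_sumE[OF mult(2)] by blast
    have "x * y = (\<Sum>d\<in>I. \<Sum>e\<in>K. h d * g e)" by (simp add: I(3) K(3) sum_product)
    moreover have "h d * g e \<in> graded_sum P" if "d \<in> I" "e \<in> K" for d e
      using hom P(5) I(2) K(2) that by blast
    ultimately show ?case using sum[of I "\<lambda>d. \<Sum>e\<in>K. h d * g e"] sum[of K] by metis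
  qed
qed

lemma ring_span_homog:
  assumes "\<And>x. x \<in> G \<Longrightarrow> \<exists>d. x \<in> homog c d" and "f \<in> ring_span G"
  shows "f \<in> graded_sum (\<lambda>d. homog c d \<inter> ring_span G)"
  by (rule ring_span_graded_sum[OF _ _ _ _ _ _ assms(2)])
    (use assms(1) in \<open>auto simp: homog_0 homog_1 homog_add homog_minus homog_mult
      ring_span_intros intro: ring_span_incl\<close>)

text \<open>Division by the monic polynomial \<open>t + a\<close> in a homogeneous element \<open>t\<close> of degree one,
  starting from the component of highest degree.\<close>

lemma monic_division:
  assumes J: "0 \<in> J" "\<And>x y. x \<in> J \<Longrightarrow> y \<in> J \<Longrightarrow> x + y \<in> J" "\<And>x. x \<in> J \<Longrightarrow> - x \<in> J"
    and J_graded: "J \<subseteq> graded_sum (\<lambda>d. homog c d \<inter> J)"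
    and t: "t \<in> homog c 1" "t \<noteq> 0" "\<And>x. x \<in> J \<Longrightarrow> inverse t * x \<in> J"
    and a: "a \<in> homog c 0" "\<And>x. x \<in> J \<Longrightarrow> a * x \<in> J"
    and f: "f \<in> graded_sum (homog c)" "(t + a) * f \<in> J"
  shows "f \<in> J"
proof -
  obtain I h where I: "finite I" "\<And>d. d \<in> I \<Longrightarrow> h d \<in> homog c d" "f = sum h I"
    using graded_sumE[OF f(1)] by blast
  obtain K g where K: "finite K" "\<And>d. d \<in> K \<Longrightarrow> g d \<in> homog c d \<inter> J" "(t + a) * f = sum g K"
    using graded_sumE[OF subsetD[OF J_graded f(2)]] by blast
  define H where "H d = (if d \<in> I then h d else 0)" for d
  have H: "H d \<in> homog c d" for d using I(2) by (simp add: H_def homog_0)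
  \<comment> \<open>N covers the degrees of both a f and t f, so the two products can be added over
    one index set.\<close>
  let ?N = "I \<union> (\<lambda>d. d + 1) ` I"
  have N: "finite ?N" using I(1) by simp
  have "f = sum H I" by (simp add: I(3) H_def)
  also have "\<dots> = sum H ?N" by (rule sum.mono_neutral_left) (use N in \<open>auto simp: H_def\<close>)
  finally have f_sum: "f = sum H ?N" .
  have "sum (\<lambda>e. H (e - 1)) ((\<lambda>d. d + 1) ` I) = sum H I"
    by (subst sum.reindex) (auto simp: inj_on_def)
  also have "sum (\<lambda>e. H (e - 1)) ((\<lambda>d. d + 1) ` I) = sum (\<lambda>e. H (e - 1)) ?N"
  proof (rule sum.mono_neutral_left[OF N])
    have "H (e - 1) = 0" if "e \<notin> (\<lambda>d. d + 1) ` I" for e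
    proof -
      have "e - 1 \<notin> I" using that by (metis diff_add_cancel imageI)
      then show ?thesis by (simp add: H_def)
    qed
    then show "\<forall>e\<in>?N - (\<lambda>d. d + 1) ` I. H (e - 1) = 0" by blast
  qed blast
  finally have f_sum': "f = sum (\<lambda>e. H (e - 1)) ?N" using \<open>f = sum H I\<close> by simp
  have "t * f = (\<Sum>e\<in>?N. t * H (e - 1))" by (subst f_sum') (simp add: sum_distrib_left)
  moreover have "a * f = (\<Sum>e\<in>?N. a * H e)" by (subst f_sum) (simp add: sum_distrib_left)
  ultimately have "(t + a) * f = (\<Sum>e\<in>?N. t * H (e - 1) + a * H e)"
    by (simp add: distrib_right sum.distrib)
  moreover have "t * H (e - 1) + a * H e \<in> homog c e" for e
    using homog_mult[OF t(1) H[of "e - 1"]] homog_mult[OF a(1) H[of e]] by (simp add: homog_add)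
  ultimately have eq: "(if e \<in> ?N then t * H (e - 1) + a * H e else 0) = (if e \<in> K then g e else 0)" for e
    using K by (intro homog_components_unique[OF N K(1), of _ c]) auto
  have HJ: "H d \<in> J" for d
  proof (rule ccontr)
    assume "H d \<notin> J"
    then have bad: "{d \<in> I. H d \<notin> J} \<noteq> {}" "finite {d \<in> I. H d \<notin> J}"
      using I(1) J(1) by (auto simp: H_def split: if_splits)
    \<comment> \<open>m is the top degree in which the component of f is outside J. In degree m + 1
      the product (t + a) f has component t H m + a H (m + 1); it lies in J, and so does its second
      term.\<close>
    define m where "m = Max {d \<in> I. H d \<notin> J}"
    have m: "m \<in> I" "H m \<notin> J" using Max_in[OF bad(2,1)] by (auto simp: m_def)
    have "H (m + 1) \<in> J"
    proof (rule ccontr)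
      assume "H (m + 1) \<notin> J"
      moreover from this have "m + 1 \<in> I" using J(1) unfolding H_def by metis
      ultimately have "m + 1 \<in> {d \<in> I. H d \<notin> J}" by simp
      then have "m + 1 \<le> m" unfolding m_def using bad by (intro Max_ge)
      then show False by simp
    qed
    have "t * H m + a * H (m + 1) = (if m + 1 \<in> K then g (m + 1) else 0)"
      using eq[of "m + 1"] m(1) by auto
    also have "\<dots> \<in> J" using K(2) J(1) by auto
    finally have "t * H m + a * H (m + 1) + - (a * H (m + 1)) \<in> J"
      using J a(2) \<open>H (m + 1) \<in> J\<close> by blast
    then have "inverse t * (t * H m) \<in> J" using t(3) by simp
    then show False using m(2) t(2) by (simp add: mult.assoc[symmetric])
  qed
  have "sum H A \<in> J" for A
    by (induction A rule: infinite_finite_induct) (simp_all add: J(1,2) HJ)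
  then show "f \<in> J" unfolding f_sum .
qed

section \<open>Mutation and Laurent polynomials\<close>

lemma vertices_mutate [simp]: "vertices (mutate k S) = vertices S"
  and mutable_mutate [simp]: "mutable (mutate k S) = mutable S"
  and frozen_mutate [simp]: "frozen (mutate k S) = frozen S"
  and symm_mutate [simp]: "symm (mutate k S) = symm S"
  by (simp_all add: mutate_def vertices_def)

lemma exch_mutate:
  "exch (mutate k S) i j = (if i = k \<or> j = k then - exch S i j
     else exch S i j + pos_part (exch S i k) * pos_part (exch S k j)
                     - pos_part (- exch S i k) * pos_part (- exch S k j))"
  by (simp add: mutate_def)

lemma mutate_mutate [simp]: "mutate k (mutate k S) = S"
proof -
  have "exch (mutate k (mutate k S)) = exch S"
    by (intro ext) (simp add: exch_mutate)
  then show ?thesis by (simp add: mutate_def)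
qed

lemma seed_finite: "is_seed S \<Longrightarrow> finite (vertices S)"
  and seed_vertex: "k \<in> mutable S \<Longrightarrow> k \<in> vertices S"
  and seed_symm: "is_seed S \<Longrightarrow> i \<in> mutable S \<Longrightarrow> j \<in> mutable S \<Longrightarrow>
    symm S j * exch S i j = - (symm S i * exch S j i)"
  and seed_symm_pos: "is_seed S \<Longrightarrow> i \<in> mutable S \<Longrightarrow> 0 < symm S i"
  unfolding is_seed_def vertices_def by blast+

lemma seed_diag: "is_seed S \<Longrightarrow> k \<in> mutable S \<Longrightarrow> exch S k k = 0"
  using seed_symm[of S k k] seed_symm_pos[of S k] by (metis add_eq_0_iff2 mult_2 mult_eq_0_iff
      neg_equal_zero order_less_irrefl)

lemma seed_sign: "is_seed S \<Longrightarrow> i \<in> mutable S \<Longrightarrow> j \<in> mutable S \<Longrightarrow> 0 < exch S i j \<longleftrightarrow> exch S j i < 0"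
proof -
  assume *: "is_seed S" "i \<in> mutable S" "j \<in> mutable S"
  have "0 < exch S i j \<longleftrightarrow> 0 < symm S j * exch S i j"
    using seed_symm_pos[OF *(1,3)] by (simp add: zero_less_mult_iff)
  also have "\<dots> \<longleftrightarrow> symm S i * exch S j i < 0" using seed_symm[OF *] by linarith
  also have "\<dots> \<longleftrightarrow> exch S j i < 0"
    using seed_symm_pos[OF *(1,2)] by (simp add: mult_less_0_iff)
  finally show ?thesis .
qed

lemma seed_zero: "is_seed S \<Longrightarrow> i \<in> mutable S \<Longrightarrow> j \<in> mutable S \<Longrightarrow> exch S i j = 0 \<longleftrightarrow> exch S j i = 0"
  using seed_sign[of S i j] seed_sign[of S j i] by linarith

lemma pos_part_mult: "0 \<le> d \<Longrightarrow> pos_part (d * a) = d * pos_part a"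
  by (auto simp: pos_part_def max_def mult_le_0_iff zero_le_mult_iff)

lemma is_seed_mutate:
  assumes "is_seed S" "k \<in> mutable S" shows "is_seed (mutate k S)"
proof -
  have "symm S j * exch (mutate k S) i j = - (symm S i * exch (mutate k S) j i)"
    if ij: "i \<in> mutable S" "j \<in> mutable S" for i j
  proof (cases "i = k \<or> j = k")
    case True
    then show ?thesis using seed_symm[OF assms(1) ij] by (auto simp: exch_mutate)
  next
    case False
    define di dj dk where "di = symm S i" and "dj = symm S j" and "dk = symm S k"
    have d: "0 < di" "0 < dj" "0 < dk"
      using assms ij by (auto simp: di_def dj_def dk_def seed_symm_pos)
    have e: "dk * exch S i k = - (di * exch S k i)" "dj * exch S k j = - (dk * exch S j k)"
      "dj * exch S i j = - (di * exch S j i)"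
      using assms ij by (auto simp: di_def dj_def dk_def intro: seed_symm)
    \<comment> \<open>Skew-symmetrizability trades column k for row k up to the factors d and swaps
      positive with negative parts. The products below are multiplied by dk so that these relations
      apply.\<close>
    have p: "dk * pos_part (exch S i k) = di * pos_part (- exch S k i)"
      "dk * pos_part (- exch S i k) = di * pos_part (exch S k i)"
      "dj * pos_part (exch S k j) = dk * pos_part (- exch S j k)"
      "dj * pos_part (- exch S k j) = dk * pos_part (exch S j k)"
      using e d by (simp_all flip: pos_part_mult)
    have "dk * (dj * (pos_part (exch S i k) * pos_part (exch S k j)))
        = (dk * pos_part (exch S i k)) * (dj * pos_part (exch S k j))" by (simp add: algebra_simps)
    also have "\<dots> = dk * (di * (pos_part (- exch S j k) * pos_part (- exch S k i)))"
      unfolding p by (simp add: algebra_simps)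
    finally have 1: "dj * (pos_part (exch S i k) * pos_part (exch S k j)) = di * (pos_part (- exch S j k) * pos_part (- exch S k i))"
      using d by simp
    have "dk * (dj * (pos_part (- exch S i k) * pos_part (- exch S k j)))
        = (dk * pos_part (- exch S i k)) * (dj * pos_part (- exch S k j))" by (simp add: algebra_simps)
    also have "\<dots> = dk * (di * (pos_part (exch S j k) * pos_part (exch S k i)))"
      unfolding p by (simp add: algebra_simps)
    finally have 2: "dj * (pos_part (- exch S i k) * pos_part (- exch S k j)) = di * (pos_part (exch S j k) * pos_part (exch S k i))"
      using d by simp
    show ?thesis using False e(3) 1 2
      unfolding exch_mutate di_def[symmetric] dj_def[symmetric] by (simp add: algebra_simps)
  qed
  then show ?thesis using assms(1) unfolding is_seed_def mutable_mutate frozen_mutate symm_mutate by blast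
qed

lemma freeze_simps [simp]:
  "mutable (freeze I S) = mutable S - I" "frozen (freeze I S) = frozen S \<union> I"
  "exch (freeze I S) = exch S" "symm (freeze I S) = symm S"
  by (simp_all add: freeze_def)

lemma is_seed_freeze:
  assumes S: "is_seed S" and I: "I \<subseteq> mutable S" shows "is_seed (freeze I S)"
proof -
  have "finite I" using S I unfolding is_seed_def by (metis finite_subset)
  then show ?thesis using S I unfolding is_seed_def freeze_simps by blast
qed

lemma vertices_freeze: "I \<subseteq> mutable S \<Longrightarrow> vertices (freeze I S) = vertices S"
  by (auto simp: vertices_def)

lemma really_full_rank_freeze:
  "really_full_rank S \<Longrightarrow> I \<subseteq> mutable S \<Longrightarrow> really_full_rank (freeze I S)"
  unfolding really_full_rank_def by (simp add: vertices_freeze) (meson DiffD1)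

lemma pos_part_diff: "pos_part a - pos_part (- a) = a"
  by (simp add: pos_part_def)

text \<open>In this asymmetric form mutation away from k is a row operation followed by a column
  operation, both unimodular, so weighted sums over the rows pass through it.\<close>

lemma exch_mutate':
  "i \<noteq> k \<Longrightarrow> j \<noteq> k \<Longrightarrow> exch (mutate k S) i j
    = exch S i j + pos_part (- exch S i k) * exch S k j + exch S i k * pos_part (exch S k j)"
proof -
  have "pos_part a * pos_part b - pos_part (- a) * pos_part (- b) = pos_part (- a) * b + a * pos_part b" for a b
    by (auto simp: pos_part_def max_def)
  then show "i \<noteq> k \<Longrightarrow> j \<noteq> k \<Longrightarrow> ?thesis" by (simp add: exch_mutate diff_conv_add_uminus add.assoc del: add_uminus_conv_diff)
qed

text \<open>The k-th entry is the degree of the exchange partner of x_k, computed from the negative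
  monomial. The positive monomial gives the same value when column k has weight zero.\<close>

definition mutate_weight :: "nat \<Rightarrow> seed \<Rightarrow> (nat \<Rightarrow> int) \<Rightarrow> nat \<Rightarrow> int" where
  "mutate_weight k S c = c(k := (\<Sum>i\<in>vertices S. c i * pos_part (- exch S i k)) - c k)"

text \<open>Viewed as a row vector times the matrix, c E undergoes only the column operation of
  mutation. This is invertible over the integers, whence invariance of really full rank, and it
  keeps c E zero if it vanishes on all mutable columns.\<close>

lemma weight_mutate:
  assumes "is_seed S" "k \<in> mutable S"
  shows "(\<Sum>i\<in>vertices S. mutate_weight k S c i * exch (mutate k S) i j)
    = (if j = k then - (\<Sum>i\<in>vertices S. c i * exch S i k)
       else (\<Sum>i\<in>vertices S. c i * exch S i j) + (\<Sum>i\<in>vertices S. c i * exch S i k) * pos_part (exch S k j))"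
proof -
  have fin: "finite (vertices S)" and k: "k \<in> vertices S"
    using assms by (simp_all add: seed_finite seed_vertex)
  define V where "V = vertices S - {k}"
  have split: "(\<Sum>i\<in>vertices S. h i) = h k + (\<Sum>i\<in>V. h i)" for h :: "nat \<Rightarrow> int"
    using fin k by (simp add: V_def sum.remove)
  have diag: "exch S k k = 0" by (rule seed_diag[OF assms])
  define c' where "c' = mutate_weight k S c"
  have c'k: "c' k = (\<Sum>i\<in>V. c i * pos_part (- exch S i k)) - c k"
    using diag by (simp add: c'_def mutate_weight_def split pos_part_def)
  have c'V: "(\<Sum>i\<in>V. c' i * h i) = (\<Sum>i\<in>V. c i * h i)" for h
    by (intro sum.cong) (auto simp: c'_def mutate_weight_def V_def)
  show ?thesis
  proof (cases "j = k")
    case True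
    have "(\<Sum>i\<in>V. c' i * exch (mutate k S) i k) = - (\<Sum>i\<in>V. c i * exch S i k)"
      unfolding c'V by (simp add: exch_mutate sum_negf)
    then show ?thesis using True diag unfolding c'_def[symmetric] by (simp add: split exch_mutate)
  next
    case False
    have "(\<Sum>i\<in>V. c' i * exch (mutate k S) i j) = (\<Sum>i\<in>V. c i * exch S i j
        + (c i * pos_part (- exch S i k)) * exch S k j + (c i * exch S i k) * pos_part (exch S k j))"
      unfolding c'V by (intro sum.cong refl) (use False in \<open>simp add: exch_mutate' V_def algebra_simps\<close>)
    also have "\<dots> = (\<Sum>i\<in>V. c i * exch S i j) + (\<Sum>i\<in>V. c i * pos_part (- exch S i k)) * exch S k j
        + (\<Sum>i\<in>V. c i * exch S i k) * pos_part (exch S k j)"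
      by (simp add: sum.distrib sum_distrib_right)
    finally show ?thesis
      using False diag unfolding c'_def[symmetric] by (simp add: split c'k exch_mutate algebra_simps)
  qed
qed

lemma really_full_rank_mutate:
  assumes "is_seed S" "k \<in> mutable S" "really_full_rank S" shows "really_full_rank (mutate k S)"
  unfolding really_full_rank_def
proof
  fix w :: "nat \<Rightarrow> int"
  \<comment> \<open>w' is the preimage of w under the column operation of
    \<open>weight_mutate\<close>.\<close>
  define w' where "w' j = (if j = k then - w k else w j + w k * pos_part (exch S k j))" for j
  obtain c where c: "\<And>j. j \<in> mutable S \<Longrightarrow> (\<Sum>i \<in> vertices S. c i * exch S i j) = w' j"
    using assms(3) unfolding really_full_rank_def by metis
  have "w j = (\<Sum>i\<in>vertices S. mutate_weight k S c i * exch (mutate k S) i j)" if "j \<in> mutable S" for j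
    unfolding weight_mutate[OF assms(1,2)] c[OF that] c[OF assms(2)] by (simp add: w'_def)
  then show "\<exists>c. \<forall>j\<in>mutable (mutate k S). w j = (\<Sum>i\<in>vertices (mutate k S). c i * exch (mutate k S) i j)"
    by (intro exI[of _ "mutate_weight k S c"]) simp
qed

text \<open>Reversing all signs swaps the two exchange monomials and leaves clusters and mutations
  unchanged. It reduces a pair with \<open>exch S k j < 0\<close> to the case of a positive
  entry.\<close>

definition negate :: "seed \<Rightarrow> seed" where
  "negate S = S\<lparr> exch := \<lambda>i j. - exch S i j \<rparr>"

lemma negate_simps [simp]:
  "mutable (negate S) = mutable S" "frozen (negate S) = frozen S" "symm (negate S) = symm S"
  "vertices (negate S) = vertices S" "exch (negate S) i j = - exch S i j"
  by (simp_all add: negate_def vertices_def)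

lemma is_seed_negate: "is_seed S \<Longrightarrow> is_seed (negate S)"
  unfolding is_seed_def negate_simps mult_minus_right by metis

lemma mutate_negate: "mutate k (negate S) = negate (mutate k S)"
proof -
  have "exch (mutate k (negate S)) = exch (negate (mutate k S))"
    by (intro ext) (simp add: exch_mutate)
  then show ?thesis by (simp add: mutate_def negate_def)
qed

section \<open>Exchange binomials, and mutation as a field automorphism\<close>

definition pos_mon :: "seed \<Rightarrow> (nat \<Rightarrow> ratfun) \<Rightarrow> nat \<Rightarrow> ratfun" where
  "pos_mon S x k = (\<Prod>i \<in> vertices S. x i ^ nat (pos_part (exch S i k)))"

definition neg_mon :: "seed \<Rightarrow> (nat \<Rightarrow> ratfun) \<Rightarrow> nat \<Rightarrow> ratfun" where
  "neg_mon S x k = (\<Prod>i \<in> vertices S. x i ^ nat (pos_part (- exch S i k)))"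

text \<open>The variable y-hat of Fomin and Zelevinsky: the exchange relation reads x_k x_k' =
  \<open>neg_mon\<close> (1 + \<open>yhat\<close>), with a Laurent unit in front of the
  binomial.\<close>

definition yhat :: "seed \<Rightarrow> (nat \<Rightarrow> ratfun) \<Rightarrow> nat \<Rightarrow> ratfun" where
  "yhat S x k = (\<Prod>i \<in> vertices S. x i powi exch S i k)"

lemma mutate_cluster_eq: "mutate_cluster k S x = x(k := (pos_mon S x k + neg_mon S x k) / x k)"
  by (simp add: mutate_cluster_def pos_mon_def neg_mon_def)

lemma mutate_cluster_negate [simp]: "mutate_cluster k (negate S) x = mutate_cluster k S x"
  by (simp add: mutate_cluster_eq pos_mon_def neg_mon_def add.commute)

lemma mutate_cluster_mutate [simp]: "mutate_cluster k (mutate k S) x = mutate_cluster k S x"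
  by (simp add: mutate_cluster_eq pos_mon_def neg_mon_def exch_mutate add.commute)

lemma pos_mon_eq:
  assumes "\<And>i. i \<in> vertices S \<Longrightarrow> x i \<noteq> 0"
  shows "pos_mon S x k = neg_mon S x k * yhat S x k"
proof -
  have "x i ^ nat (pos_part (exch S i k)) = x i ^ nat (pos_part (- exch S i k)) * x i powi exch S i k"
    if "i \<in> vertices S" for i
  proof -
    have p: "x i ^ nat (pos_part a) = x i powi pos_part a" for a by (simp add: power_int_def pos_part_def)
    have "pos_part (exch S i k) = pos_part (- exch S i k) + exch S i k" by (simp add: pos_part_def)
    then show ?thesis unfolding p using assms[OF that] by (simp flip: power_int_add)
  qed
  then show ?thesis by (simp add: pos_mon_def neg_mon_def yhat_def flip: prod.distrib)
qed

lemma exchange_sum_eq: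
  assumes "\<And>i. i \<in> vertices S \<Longrightarrow> x i \<noteq> 0"
  shows "pos_mon S x k + neg_mon S x k = neg_mon S x k * (1 + yhat S x k)"
  by (simp add: pos_mon_eq[OF assms] algebra_simps)

lemma pos_mon_cong: "(\<And>i. i \<in> vertices S \<Longrightarrow> exch S i k \<noteq> 0 \<Longrightarrow> x i = x' i) \<Longrightarrow> pos_mon S x k = pos_mon S x' k"
  and neg_mon_cong: "(\<And>i. i \<in> vertices S \<Longrightarrow> exch S i k \<noteq> 0 \<Longrightarrow> x i = x' i) \<Longrightarrow> neg_mon S x k = neg_mon S x' k"
  unfolding pos_mon_def neg_mon_def
  by (intro prod.cong; force simp: pos_part_def)+

lemma field_hom_pos_mon: "field_hom h \<Longrightarrow> h (pos_mon S x k) = pos_mon S (\<lambda>i. h (x i)) k"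
  and field_hom_neg_mon: "field_hom h \<Longrightarrow> h (neg_mon S x k) = neg_mon S (\<lambda>i. h (x i)) k"
  and field_hom_yhat: "field_hom h \<Longrightarrow> h (yhat S x k) = yhat S (\<lambda>i. h (x i)) k"
  by (simp_all add: pos_mon_def neg_mon_def yhat_def field_hom_simps)

lemma field_hom_mutate_cluster:
  "field_hom h \<Longrightarrow> h (mutate_cluster k S x i) = mutate_cluster k S (\<lambda>i. h (x i)) i"
  by (simp add: mutate_cluster_eq field_hom_simps field_hom_pos_mon field_hom_neg_mon)

text \<open>Setting all variables to 1 turns the binomial into 2.\<close>

lemma exchange_sum_nz: "pos_mon S indet k + neg_mon S indet k \<noteq> 0"
proof
  assume z: "pos_mon S indet k + neg_mon S indet k = 0"
  have "subst_rel (\<lambda>_. 1) (pos_mon S indet k + neg_mon S indet k) (pos_mon S (\<lambda>_. 1) k + neg_mon S (\<lambda>_. 1) k)"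
    unfolding pos_mon_def neg_mon_def
    by (intro subst_rel_add subst_rel_prod subst_rel_power subst_rel_indet)
  then have "subst_rel (\<lambda>_. 1) 0 (2::ratfun)" unfolding z by (simp add: pos_mon_def neg_mon_def)
  from subst_rel_unique[OF this subst_rel_0] show False using ratfun_two_nz by simp
qed

lemma yhat_indet_nz: "1 + yhat S indet k \<noteq> 0"
  using exchange_sum_nz[of S k] exchange_sum_eq[of S indet k] indet_nz by auto

text \<open>The automorphism substituting the mutated cluster for the initial one. As it is an
  involution, an element is a Laurent polynomial in the adjacent cluster exactly if its image lies
  in \<open>laurent (vertices S)\<close>, so one Laurent ring serves for all clusters.\<close>

definition mutation :: "seed \<Rightarrow> nat \<Rightarrow> ratfun \<Rightarrow> ratfun" where
  "mutation S k = (SOME h. field_hom h \<and> (\<forall>i. h (indet i) = mutate_cluster k S indet i))"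

lemma mutation_cong: "mutate_cluster k S indet = mutate_cluster k' S' indet \<Longrightarrow> mutation S k = mutation S' k'"
  by (simp add: mutation_def)

lemma mutation_mutate [simp]: "mutation (mutate k S) k = mutation S k"
  by (rule mutation_cong) simp

lemma mutation_negate [simp]: "mutation (negate S) k = mutation S k"
  by (rule mutation_cong) simp

context
  fixes S :: seed and k :: nat
  assumes S: "is_seed S" and k: "k \<in> mutable S"
begin

lemma mutate_cluster_indet_nz: "mutate_cluster k S indet i \<noteq> 0"
  by (simp add: mutate_cluster_eq exchange_sum_nz indet_nz)

lemma mons_mutate_cluster:
  "pos_mon S (mutate_cluster k S x) k = pos_mon S x k"
  "neg_mon S (mutate_cluster k S x) k = neg_mon S x k"
  by (rule pos_mon_cong neg_mon_cong, use seed_diag[OF S k] in \<open>auto simp: mutate_cluster_eq\<close>)+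

lemma mutation: "field_hom (mutation S k)" "mutation S k (indet i) = mutate_cluster k S indet i"
proof -
  let ?w = "mutate_cluster k S indet"
  \<comment> \<open>The substitution is its own left inverse, because the exchange binomial of k
    does not involve x_k.\<close>
  have "subst_rel ?w (?w i) (indet i)" for i
  proof (cases "i = k")
    case True
    have "subst_rel ?w ((pos_mon S indet k + neg_mon S indet k) / indet k)
        ((pos_mon S ?w k + neg_mon S ?w k) / ?w k)"
      unfolding pos_mon_def neg_mon_def
      by (intro subst_rel_divide subst_rel_add subst_rel_prod subst_rel_power subst_rel_indet mutate_cluster_indet_nz)
    moreover have "(pos_mon S ?w k + neg_mon S ?w k) / ?w k = indet k"
      unfolding mons_mutate_cluster using exchange_sum_nz[of S k] by (simp add: mutate_cluster_eq)
    ultimately show ?thesis using True by (simp add: mutate_cluster_eq)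
  next
    case False
    then show ?thesis using subst_rel_indet[of ?w i] by (simp add: mutate_cluster_eq)
  qed
  then obtain h where "field_hom h" "\<And>i. h (indet i) = ?w i"
    using substitution_exists[of ?w ?w] by blast
  then have "\<exists>h. field_hom h \<and> (\<forall>i. h (indet i) = ?w i)" by blast
  from someI_ex[OF this] show "field_hom (mutation S k)" "mutation S k (indet i) = ?w i"
    unfolding mutation_def by auto
qed

lemma mutation_indet: "i \<noteq> k \<Longrightarrow> mutation S k (indet i) = indet i"
  by (simp add: mutation mutate_cluster_eq)

lemma mutation_indet_self: "mutation S k (indet k) = (pos_mon S indet k + neg_mon S indet k) / indet k"
  by (simp add: mutation mutate_cluster_eq)

lemmas mutation_simps = field_hom_simps[OF mutation(1)]

lemma mutation_involution [simp]: "mutation S k (mutation S k f) = f"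
proof (rule field_hom_eqI[OF field_hom_comp[OF mutation(1) mutation(1)] field_hom_id])
  fix i
  show "mutation S k (mutation S k (indet i)) = indet i"
  proof (cases "i = k")
    case True
    have "mutation S k (mutation S k (indet k)) = mutate_cluster k S (mutate_cluster k S indet) k"
      unfolding mutation(2) by (simp add: field_hom_mutate_cluster[OF mutation(1)] mutation(2))
    also have "\<dots> = indet k"
      unfolding mutate_cluster_eq[of k S "mutate_cluster k S indet"] mons_mutate_cluster
      using exchange_sum_nz[of S k] by (simp add: mutate_cluster_eq)
    finally show ?thesis using True by simp
  next
    case False then show ?thesis by (simp add: mutation_indet)
  qed
qed

end

section \<open>Laurent rings and upper bounds\<close>

definition laurent :: "nat set \<Rightarrow> ratfun set" where
  "laurent V = ring_span (indet ` V \<union> (\<lambda>i. inverse (indet i)) ` V)"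

lemma laurent_indet: "i \<in> V \<Longrightarrow> indet i \<in> laurent V" "i \<in> V \<Longrightarrow> inverse (indet i) \<in> laurent V"
  by (auto simp: laurent_def intro!: ring_span_incl)

lemmas laurent_intros = ring_span_intros[where G = "indet ` V \<union> (\<lambda>i. inverse (indet i)) ` V" for V, folded laurent_def]

lemma laurent_indet_powi: "i \<in> V \<Longrightarrow> indet i powi n \<in> laurent V"
  by (intro laurent_intros laurent_indet)

lemma laurent_graded: "f \<in> laurent V \<Longrightarrow> f \<in> graded_sum (\<lambda>d. homog c d \<inter> laurent V)"
  unfolding laurent_def
  by (rule ring_span_homog) (auto intro: homog_indet homog_inverse)

lemma neg_mon_unit:
  "neg_mon S indet k \<in> laurent (vertices S)" "inverse (neg_mon S indet k) \<in> laurent (vertices S)"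
  "neg_mon S indet k \<noteq> 0"
proof -
  show "neg_mon S indet k \<in> laurent (vertices S)"
    unfolding neg_mon_def by (intro laurent_intros laurent_indet)
  have "inverse (neg_mon S indet k) = (\<Prod>i \<in> vertices S. inverse (indet i) ^ nat (pos_part (- exch S i k)))"
    by (simp add: neg_mon_def prod_inversef[symmetric] power_inverse)
  then show "inverse (neg_mon S indet k) \<in> laurent (vertices S)"
    by (simp only:) (intro laurent_intros laurent_indet)
  show "neg_mon S indet k \<noteq> 0"
    by (cases "finite (vertices S)") (auto simp: neg_mon_def indet_nz)
qed

lemma yhat_unit:
  "yhat S indet k \<in> laurent (vertices S)" "inverse (yhat S indet k) \<in> laurent (vertices S)"
  "yhat S indet k \<noteq> 0"
proof -
  show "yhat S indet k \<in> laurent (vertices S)"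
    unfolding yhat_def by (intro laurent_intros(9) laurent_indet_powi)
  have "inverse (yhat S indet k) = (\<Prod>i \<in> vertices S. indet i powi (- exch S i k))"
    by (simp add: yhat_def prod_inversef[symmetric] power_int_minus)
  then show "inverse (yhat S indet k) \<in> laurent (vertices S)"
    by (simp only:) (intro laurent_intros(9) laurent_indet_powi)
  show "yhat S indet k \<noteq> 0"
    by (cases "finite (vertices S)") (auto simp: yhat_def indet_nz)
qed

lemma homog_yhat: "yhat S indet k \<in> homog c (\<Sum>i \<in> vertices S. c i * exch S i k)"
proof -
  have "yhat S indet k \<in> homog c (\<Sum>i \<in> vertices S. exch S i k * c i)"
    unfolding yhat_def by (intro homog_prod homog_power_int homog_indet)
  then show ?thesis by (simp add: mult.commute)
qed

text \<open>Only the inverse of the new variable can leave the Laurent ring. It is x_k divided by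
  \<open>neg_mon\<close> (1 + \<open>yhat\<close>), and \<open>neg_mon\<close> is a unit.\<close>

lemma mutation_laurent_localized:
  assumes S: "is_seed S" and k: "k \<in> mutable S" and f: "f \<in> laurent (vertices S)"
  shows "\<exists>n. (1 + yhat S indet k) ^ n * mutation S k f \<in> laurent (vertices S)"
proof -
  let ?V = "vertices S"
  let ?g = "mutation S k ` (indet ` ?V \<union> (\<lambda>i. inverse (indet i)) ` ?V)"
  have kV: "k \<in> ?V" using k by (rule seed_vertex)
  have ex: "mutation S k (indet k) = neg_mon S indet k * (1 + yhat S indet k) / indet k"
    using exchange_sum_eq[of S indet k] indet_nz by (simp add: mutation_indet_self[OF S k])
  have cancel: "q * inverse (n * q / m) = inverse n * m" if "q \<noteq> 0" for q n m :: ratfun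
    using that by (cases "n = 0"; cases "m = 0") (simp_all add: field_simps)
  have y: "1 + yhat S indet k \<in> laurent ?V" by (intro laurent_intros yhat_unit)
  have gen: "\<exists>n. (1 + yhat S indet k) ^ n * x \<in> laurent ?V" if "x \<in> ?g" for x
  proof -
    from that obtain i where i: "i \<in> ?V" "x = mutation S k (indet i) \<or> x = inverse (mutation S k (indet i))"
      by (auto simp: mutation_simps[OF S k])
    consider "i \<noteq> k" | "i = k" "x = mutation S k (indet k)" | "i = k" "x = inverse (mutation S k (indet k))"
      using i(2) by blast
    then show ?thesis
    proof cases
      case 1
      then show ?thesis using i laurent_indet[of i ?V]
        by (intro exI[of _ 0]) (auto simp: mutation_indet[OF S k])
    next
      case 2
      have "x \<in> laurent ?V" unfolding 2(2) ex divide_inverse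
        by (intro laurent_intros(4) neg_mon_unit y laurent_indet kV)
      then show ?thesis by (intro exI[of _ 0]) simp
    next
      case 3
      have "(1 + yhat S indet k) ^ 1 * x = inverse (neg_mon S indet k) * indet k"
        unfolding 3(2) ex power_one_right using cancel[OF yhat_indet_nz] .
      also have "\<dots> \<in> laurent ?V" by (intro laurent_intros(4) neg_mon_unit laurent_indet kV)
      finally show ?thesis by blast
    qed
  qed
  have "mutation S k f \<in> ring_span ?g"
    using f unfolding laurent_def
    by (rule field_hom_ring_span[OF mutation(1)[OF S k]]) (auto intro!: ring_span_incl)
  then show ?thesis
    unfolding laurent_def by (rule ring_span_localize) (use y gen in \<open>simp_all add: laurent_def\<close>)
qed

text \<open>The upper bound of Berenstein, Fomin and Zelevinsky, the intersection of the Laurent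
  rings of the initial cluster and of its neighbours; Laurentness in a neighbour is tested by
  \<open>mutation S j\<close>.\<close>

definition upper_bound :: "seed \<Rightarrow> ratfun set" where
  "upper_bound S = {f \<in> laurent (vertices S). \<forall>j\<in>mutable S. mutation S j f \<in> laurent (vertices S)}"

text \<open>If \<open>T\<close> is homogeneous of degree zero, then \<open>v\<close>, which is monic of degree one modulo \<open>T\<close>, is
  not a zero divisor modulo \<open>T\<close>.\<close>

lemma laurent_coprime:
  assumes T: "T \<in> laurent V" "T \<in> homog c 0" "T \<noteq> 0"
    and t: "t \<in> homog c 1" "t \<noteq> 0" "t \<in> laurent V" "inverse t \<in> laurent V"
    and a: "a \<in> homog c 0" "a \<in> laurent V" and w: "w \<in> laurent V"
    and f: "T ^ n * f \<in> laurent V" "(t + a + T * w) ^ m * f \<in> laurent V"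
  shows "f \<in> laurent V"
proof -
  let ?v = "t + a + T * w"
  let ?J = "(*) T ` laurent V"
  have J: "0 \<in> ?J" "\<And>x y. x \<in> ?J \<Longrightarrow> y \<in> ?J \<Longrightarrow> x + y \<in> ?J" "\<And>x. x \<in> ?J \<Longrightarrow> - x \<in> ?J"
    "\<And>x z. x \<in> ?J \<Longrightarrow> z \<in> laurent V \<Longrightarrow> z * x \<in> ?J"
  proof -
    show "0 \<in> ?J" by (rule image_eqI[of _ _ 0]) (auto intro: laurent_intros)
    show "x + y \<in> ?J" if "x \<in> ?J" "y \<in> ?J" for x y
      using that by (auto simp flip: distrib_left intro!: imageI laurent_intros(3))
    show "- x \<in> ?J" if "x \<in> ?J" for x
      using that by (auto simp flip: mult_minus_right intro!: imageI laurent_intros(5) simp del: mult_minus_right)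
    show "z * x \<in> ?J" if "x \<in> ?J" "z \<in> laurent V" for x z
      using that by (auto simp: mult.left_commute intro!: imageI laurent_intros(4))
  qed
  have graded: "?J \<subseteq> graded_sum (\<lambda>d. homog c d \<inter> ?J)"
  proof
    fix x assume "x \<in> ?J"
    then obtain g where g: "g \<in> laurent V" "x = T * g" by blast
    obtain I h where I: "finite I" "\<And>d. d \<in> I \<Longrightarrow> h d \<in> homog c d \<inter> laurent V" "g = sum h I"
      by (rule graded_sumE[OF laurent_graded[OF g(1), of c]]) blast
    have "x = (\<Sum>d\<in>I. T * h d)" by (simp add: g(2) I(3) sum_distrib_left)
    moreover have "T * h d \<in> homog c d \<inter> ?J" if "d \<in> I" for d
      using I(2)[OF that] homog_mult[OF T(2), of "h d" d] by auto
    ultimately show "x \<in> graded_sum (\<lambda>d. homog c d \<inter> ?J)"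
      unfolding graded_sum_def using I(1) by (intro CollectI exI[of _ "\<lambda>d. T * h d"] exI[of _ I]) simp
  qed
  \<comment> \<open>Multiplication by v is injective modulo T: the summand T w h lies in J, so it
    remains to divide by t + a.\<close>
  have step: "h \<in> ?J" if h: "h \<in> laurent V" "?v * h \<in> ?J" for h
  proof (rule monic_division[OF J(1-3) graded t(1,2)])
    show "inverse t * x \<in> ?J" "a * x \<in> ?J" if "x \<in> ?J" for x using J(4) that t(4) a(2) by auto
    show "a \<in> homog c 0" by (rule a(1))
    show "h \<in> graded_sum (homog c)"
      using laurent_graded[OF h(1), of c] unfolding graded_sum_def by blast
    have "?v * h + - (T * (w * h)) \<in> ?J"
      using h w by (intro J(2,3)) (auto intro!: imageI laurent_intros(4))
    then show "(t + a) * h \<in> ?J" by (simp add: algebra_simps)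
  qed
  have v: "?v \<in> laurent V" by (intro laurent_intros t a w T)
  have steps: "h \<in> ?J" if "h \<in> laurent V" "?v ^ m * h \<in> ?J" for h m
    using that
  proof (induction m)
    case (Suc m)
    have "?v ^ m * h \<in> ?J"
      by (rule step) (use Suc.prems v in \<open>auto simp: mult.assoc intro!: laurent_intros(4,7)\<close>)
    then show ?case using Suc by blast
  qed simp
  show ?thesis using f(1)
  proof (induction n)
    case (Suc n)
    \<comment> \<open>Since v^m f is Laurent, v^m times T^(n+1) f is divisible by T. Cancelling v
      modulo T and then one factor T lowers the exponent from n + 1 to n.\<close>
    have "?v ^ m * (T ^ Suc n * f) = T * (T ^ n * (?v ^ m * f))" by (simp add: algebra_simps)
    also have "\<dots> \<in> ?J" by (intro imageI laurent_intros(4,7) T f(2))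
    finally obtain g where "g \<in> laurent V" "T ^ Suc n * f = T * g" using steps[OF Suc.prems] by blast
    then have "T ^ n * f \<in> laurent V" using T(3) by (simp add: mult.assoc)
    then show ?case by (rule Suc.IH)
  qed simp
qed

section \<open>Mutation invariance of the upper bound\<close>

text \<open>Without an arrow between j and k the two mutations commute, so the image of f under both
  is cleared of denominators by a power of 1 + \<open>yhat\<close> at j and also by one at k. Really
  full rank yields a weight in which the first \<open>yhat\<close> has degree one and the second
  degree zero, and \<open>laurent_coprime\<close> applies.\<close>

lemma mutation_pair_zero:
  assumes S: "is_seed S" and rank: "really_full_rank S" and jk: "j \<in> mutable S" "k \<in> mutable S" "j \<noteq> k"
    and zero: "exch S k j = 0" and f: "f \<in> upper_bound S"
  shows "mutation (mutate k S) j (mutation S k f) \<in> laurent (vertices S)"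
proof -
  let ?V = "vertices S"
  have zero': "exch S j k = 0" using seed_zero[OF S jk(1,2)] zero by simp
  have "mutate_cluster j (mutate k S) indet = mutate_cluster j S indet"
  proof -
    have "exch (mutate k S) i j = exch S i j" for i
      using jk(3) zero by (auto simp: exch_mutate pos_part_def)
    then show ?thesis by (simp add: mutate_cluster_eq pos_mon_def neg_mon_def)
  qed
  then have eq: "mutation (mutate k S) j = mutation S j" by (rule mutation_cong)
  note mj = mutation[OF S jk(1)] and mk = mutation[OF S jk(2)]
  have cj: "pos_mon S (\<lambda>i. mutation S k (indet i)) j = pos_mon S indet j"
    "neg_mon S (\<lambda>i. mutation S k (indet i)) j = neg_mon S indet j"
    by (rule pos_mon_cong neg_mon_cong, metis mutation_indet[OF S jk(2)] zero)+
  have ck: "pos_mon S (\<lambda>i. mutation S j (indet i)) k = pos_mon S indet k"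
    "neg_mon S (\<lambda>i. mutation S j (indet i)) k = neg_mon S indet k"
    by (rule pos_mon_cong neg_mon_cong, metis mutation_indet[OF S jk(1)] zero')+
  have comm: "mutation S j (mutation S k g) = mutation S k (mutation S j g)" for g
  proof (rule field_hom_eqI[OF field_hom_comp[OF mj(1) mk(1)] field_hom_comp[OF mk(1) mj(1)]])
    fix i
    consider "i = j" | "i = k" | "i \<noteq> j" "i \<noteq> k" by blast
    then show "mutation S j (mutation S k (indet i)) = mutation S k (mutation S j (indet i))"
    proof cases
      case 1
      then show ?thesis using jk(3)
        by (simp add: mutation_indet[OF S jk(2)] mutation_indet_self[OF S jk(1)] field_hom_simps[OF mk(1)]
          field_hom_pos_mon[OF mk(1)] field_hom_neg_mon[OF mk(1)] cj)
    next
      case 2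
      then show ?thesis using jk(3)
        by (simp add: mutation_indet[OF S jk(1)] mutation_indet_self[OF S jk(2)] field_hom_simps[OF mj(1)]
          field_hom_pos_mon[OF mj(1)] field_hom_neg_mon[OF mj(1)] ck)
    qed (simp add: mutation_indet[OF S jk(1)] mutation_indet[OF S jk(2)])
  qed
  let ?f = "mutation S j (mutation S k f)"
  have fk: "mutation S k f \<in> laurent ?V" and fj: "mutation S j f \<in> laurent ?V"
    using f jk by (auto simp: upper_bound_def)
  obtain m where m: "(1 + yhat S indet j) ^ m * ?f \<in> laurent ?V"
    using mutation_laurent_localized[OF S jk(1) fk] ..
  obtain n where n: "(1 + yhat S indet k) ^ n * ?f \<in> laurent ?V"
    using mutation_laurent_localized[OF S jk(2) fj] unfolding comm ..
  have "\<exists>c. \<forall>i\<in>mutable S. (if i = j then 1 else 0) = (\<Sum>l\<in>?V. c l * exch S l i)"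
    using rank unfolding really_full_rank_def by (rule allE[of _ "\<lambda>i. if i = j then 1 else 0"])
  then obtain c where c: "\<forall>i\<in>mutable S. (if i = j then 1 else 0) = (\<Sum>l\<in>?V. c l * exch S l i)" ..
  have t: "yhat S indet j \<in> homog c 1" "yhat S indet k \<in> homog c 0"
    using homog_yhat[of S j c] homog_yhat[of S k c] bspec[OF c jk(1)] bspec[OF c jk(2)] jk(3) by auto
  have "?f \<in> laurent ?V"
  proof (rule laurent_coprime[of "1 + yhat S indet k" ?V c "yhat S indet j" 1 0 n ?f m])
    show "1 + yhat S indet k \<in> homog c 0" using t(2) homog_1 by (rule homog_add[rotated])
  qed (use t n m yhat_unit yhat_indet_nz homog_1 in
      \<open>auto intro!: laurent_intros simp: add.commute\<close>)
  then show ?thesis by (simp add: eq)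
qed

lemma laurent_monomial:
  assumes "W \<subseteq> V"
  shows "(\<Prod>i\<in>W. indet i ^ e i) \<in> laurent V" "inverse (\<Prod>i\<in>W. indet i ^ e i) \<in> laurent V"
    "(\<Prod>i\<in>W. indet i ^ e i) \<noteq> 0"
proof -
  show "(\<Prod>i\<in>W. indet i ^ e i) \<in> laurent V"
    using assms by (intro laurent_intros laurent_indet) auto
  have "inverse (\<Prod>i\<in>W. indet i ^ e i) = (\<Prod>i\<in>W. inverse (indet i) ^ e i)"
    by (simp add: prod_inversef[symmetric] power_inverse)
  also have "\<dots> \<in> laurent V" using assms by (intro laurent_intros laurent_indet) auto
  finally show "inverse (\<Prod>i\<in>W. indet i ^ e i) \<in> laurent V" .
  show "(\<Prod>i\<in>W. indet i ^ e i) \<noteq> 0"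
    by (cases "finite W") (auto simp: indet_nz)
qed

lemma homog_monomial_0:
  assumes "\<And>i. i \<in> W \<Longrightarrow> c i = 0" shows "(\<Prod>i\<in>W. indet i ^ e i) \<in> homog c 0"
proof -
  have "indet i ^ e i \<in> homog c 0" if "i \<in> W" for i
    using homog_power[OF homog_indet, of i "e i" c] assms[OF that] by simp
  then have "(\<Prod>i\<in>W. indet i ^ e i) \<in> homog c (\<Sum>i\<in>W. 0)" by (rule homog_prod)
  then show ?thesis by simp
qed

lemma prod_two:
  fixes h :: "nat \<Rightarrow> ratfun"
  assumes "finite V" "j \<in> V" "k \<in> V" "j \<noteq> k"
  shows "prod h V = h j * h k * prod h (V - {j, k})"
proof -
  have "V = insert j (insert k (V - {j, k}))" using assms by blast
  then have "prod h V = prod h (insert j (insert k (V - {j, k})))" by simp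
  also have "\<dots> = h j * (h k * prod h (V - {j, k}))"
    using assms by (subst prod.insert) auto
  finally show ?thesis by (simp add: mult.assoc)
qed

text \<open>In the application A has x_j in its denominator and is not of degree zero. Keeping the
  powers of A apart leaves a linear coefficient d of degree zero, which is what
  \<open>laurent_coprime\<close> demands of the summand next to t.\<close>

lemma binomial_expand:
  assumes "q \<in> homog c 0" "q \<in> laurent V" "q' \<in> homog c 0" "q' \<in> laurent V" "A \<in> laurent V" "0 < n"
  shows "\<exists>d e. d \<in> homog c 0 \<and> d \<in> laurent V \<and> e \<in> laurent V \<and>
    (q + q' * A ^ n) ^ m = q ^ m + A * d + A\<^sup>2 * e"
proof -
  \<comment> \<open>For n = 1 the term is linear in A with coefficient q'; for larger n it is
    already divisible by the square of A.\<close>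
  have "\<exists>d e. d \<in> homog c 0 \<and> d \<in> laurent V \<and> e \<in> laurent V \<and> q' * A ^ n = A * d + A\<^sup>2 * e"
  proof (cases "n = 1")
    case True
    then show ?thesis using assms by (intro exI[of _ q'] exI[of _ 0]) (auto intro: laurent_intros)
  next
    case False
    then obtain l where "n = l + 2" using assms(6) by (metis Suc_1 add_Suc_right add.commute less_Suc_eq_0_disj
        nat_less_le not_less_eq plus_1_eq_Suc add_2_eq_Suc' not0_implies_Suc One_nat_def)
    then show ?thesis using assms
      by (intro exI[of _ 0] exI[of _ "q' * A ^ l"])
        (auto intro!: laurent_intros homog_0 simp: power_add power2_eq_square mult_ac)
  qed
  then obtain d1 e1 where 1: "d1 \<in> homog c 0" "d1 \<in> laurent V" "e1 \<in> laurent V" "q' * A ^ n = A * d1 + A\<^sup>2 * e1"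
    by blast
  show ?thesis
  proof (induction m)
    case 0
    show ?case by (intro exI[of _ 0]) (auto intro: laurent_intros homog_0)
  next
    case (Suc m)
    then obtain d e where 2: "d \<in> homog c 0" "d \<in> laurent V" "e \<in> laurent V"
      "(q + q' * A ^ n) ^ m = q ^ m + A * d + A\<^sup>2 * e" by blast
    have "(q + q' * A ^ n) ^ Suc m = (q + q' * A ^ n) * (q ^ m + A * d + A\<^sup>2 * e)"
      unfolding power_Suc 2(4) ..
    also have "\<dots> = (q + (A * d1 + A\<^sup>2 * e1)) * (q ^ m + A * d + A\<^sup>2 * e)"
      unfolding 1(4) ..
    also have "\<dots> = q ^ Suc m + A * (q * d + d1 * q ^ m)
        + A\<^sup>2 * (d1 * d + q * e + e1 * q ^ m + A * (d1 * e + e1 * d) + A\<^sup>2 * (e1 * e))"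
      by (simp add: algebra_simps power2_eq_square)
    finally have eq: "(q + q' * A ^ n) ^ Suc m = q ^ Suc m + A * (q * d + d1 * q ^ m)
        + A\<^sup>2 * (d1 * d + q * e + e1 * q ^ m + A * (d1 * e + e1 * d) + A\<^sup>2 * (e1 * e))" .
    have "q * d + d1 * q ^ m \<in> homog c 0"
      using homog_mult[OF assms(1) 2(1)] homog_mult[OF 1(1) homog_power[OF assms(1), of m]]
      by (simp add: homog_add)
    moreover have "q * d + d1 * q ^ m \<in> laurent V"
      by (intro laurent_intros assms 1 2)
    moreover have "d1 * d + q * e + e1 * q ^ m + A * (d1 * e + e1 * d) + A\<^sup>2 * (e1 * e) \<in> laurent V"
      by (intro laurent_intros assms 1 2)
    ultimately show ?case using eq by blast
  qed
qed

text \<open>Let F be the element whose Laurentness is claimed. It has denominators bounded in two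
  ways: coming from the cluster mutated at k, by powers of T; coming from the cluster mutated at j,
  three mutations away, by powers of v. Graded by the exponent of x_j, T has degree zero and v is
  x_j plus a term of degree zero modulo T, so \<open>laurent_coprime\<close> removes both
  denominators.\<close>

lemma mutation_pair_pos:
  assumes S: "is_seed S" and jk: "j \<in> mutable S" "k \<in> mutable S" "j \<noteq> k"
    and pos: "0 < exch S k j" and f: "f \<in> upper_bound S"
  shows "mutation (mutate k S) j (mutation S k f) \<in> laurent (vertices S)"
proof -
  define V where "V = vertices S"
  define W where "W = V - {j, k}"
  define S' where "S' = mutate k S"
  have S': "is_seed S'" "j \<in> mutable S'" "vertices S' = V"
    using is_seed_mutate[OF S jk(2)] jk by (simp_all add: S'_def V_def)
  have V: "finite V" "j \<in> V" "k \<in> V" using seed_finite[OF S] jk seed_vertex by (auto simp: V_def)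
  have W: "W \<subseteq> V" by (auto simp: W_def)
  have neg: "exch S j k < 0" using seed_sign[OF S jk(2,1)] pos by simp
  define m where "m = nat (exch S k j)"
  define n where "n = nat (- exch S j k)"
  have mn: "exch S k j = int m" "exch S j k = - int n" "0 < n" using pos neg by (simp_all add: m_def n_def)
  \<comment> \<open>The exchange monomials of j in S, of k in S and of j in S', with the powers of
    x_j and x_k taken out.\<close>
  define pp pn qp qn rp rn where "pp = (\<Prod>i\<in>W. indet i ^ nat (pos_part (exch S i j)))"
    and "pn = (\<Prod>i\<in>W. indet i ^ nat (pos_part (- exch S i j)))"
    and "qp = (\<Prod>i\<in>W. indet i ^ nat (pos_part (exch S i k)))"
    and "qn = (\<Prod>i\<in>W. indet i ^ nat (pos_part (- exch S i k)))"
    and "rp = (\<Prod>i\<in>W. indet i ^ nat (pos_part (exch S' i j)))"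
    and "rn = (\<Prod>i\<in>W. indet i ^ nat (pos_part (- exch S' i j)))"
  note defs = pp_def pn_def qp_def qn_def rp_def rn_def
  have units: "z \<in> laurent V" "inverse z \<in> laurent V" "z \<noteq> 0" if "z \<in> {pp, pn, qp, qn, rp, rn}" for z
  proof -
    from that have "z \<in> range (\<lambda>e. \<Prod>i\<in>W. indet i ^ e i)"
      unfolding defs by (elim insertE emptyE) (erule ssubst, rule rangeI)+
    then obtain e where z: "z = (\<Prod>i\<in>W. indet i ^ e i)" by (rule rangeE)
    show "z \<in> laurent V" "inverse z \<in> laurent V" "z \<noteq> 0" unfolding z by (rule laurent_monomial[OF W])+
  qed
  define c where "c i = (if i = j then 1 else 0 :: int)" for i
  have deg0: "z \<in> homog c 0" if "z \<in> {pp, pn, qp, qn, rp, rn}" for z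
    using that homog_monomial_0[of W c] unfolding defs by (auto simp: c_def W_def)
  have diag: "exch S j j = 0" "exch S k k = 0" using S jk seed_diag by auto
  have mons: "pos_mon S x j = pp * x k ^ m" "neg_mon S x j = pn"
      "pos_mon S x k = qp" "neg_mon S x k = qn * x j ^ n"
      "pos_mon S' x j = rp" "neg_mon S' x j = rn * x k ^ m"
    if "\<And>i. i \<in> W \<Longrightarrow> x i = indet i" for x
  proof -
    have W_cong: "(\<Prod>i\<in>W. x i ^ e i) = (\<Prod>i\<in>W. indet i ^ e i)" for e
      using that by (intro prod.cong) auto
    have "exch S' k j = - int m" "exch S' j j = 0"
      using mn diag jk(3) by (simp_all add: S'_def exch_mutate pos_part_def)
    then show "pos_mon S x j = pp * x k ^ m" "neg_mon S x j = pn"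
      "pos_mon S x k = qp" "neg_mon S x k = qn * x j ^ n"
      "pos_mon S' x j = rp" "neg_mon S' x j = rn * x k ^ m"
      unfolding pos_mon_def neg_mon_def S'(3) V_def[symmetric] prod_two[OF V jk(3)] W_def[symmetric] W_cong defs
      by (simp_all add: mn diag pos_part_def max_def)
  qed
  \<comment> \<open>Column j of S' is column j of S plus m times the positive part of column k.
    Positive and negative parts may cancel in this sum, so the identity is stated with the negative
    parts moved across.\<close>
  have exp: "nat (pos_part (exch S' i j)) + nat (pos_part (- exch S i j))
      = nat (pos_part (- exch S' i j)) + (nat (pos_part (exch S i j)) + m * nat (pos_part (exch S i k)))"
    if "i \<in> W" for i
  proof -
    define z where "z = int m * pos_part (exch S i k)"
    have z: "0 \<le> z" "nat z = m * nat (pos_part (exch S i k))"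
      by (simp_all add: z_def pos_part_def nat_mult_distrib)
    have "exch S' i j = exch S i j + z"
      using that mn jk(3) by (simp add: S'_def exch_mutate W_def z_def pos_part_def)
    then show ?thesis using z(1) unfolding z(2)[symmetric] unfolding pos_part_def by linarith
  qed
  have rel: "rp * pn = rn * (pp * qp ^ m)"
  proof -
    have "rp * pn = (\<Prod>i\<in>W. indet i ^ (nat (pos_part (exch S' i j)) + nat (pos_part (- exch S i j))))"
      unfolding defs by (simp add: power_add prod.distrib)
    also have "\<dots> = (\<Prod>i\<in>W. indet i ^ (nat (pos_part (- exch S' i j))
        + (nat (pos_part (exch S i j)) + m * nat (pos_part (exch S i k)))))"
      using exp by (intro prod.cong) auto
    also have "\<dots> = rn * (pp * qp ^ m)"
      unfolding defs by (simp add: power_add prod.distrib power_mult mult.commute[of m] prod_power_distrib)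
    finally show ?thesis .
  qed
  \<comment> \<open>T is the exchange binomial of j in S' up to the Laurent monomial r, and A is the
    variable that this mutation puts in place of x_j.\<close>
  define r where "r = rn / pn"
  define T where "T = pp * qp ^ m + pn * indet k ^ m"
  define A where "A = r * T / indet j"
  have nz: "pp \<noteq> 0" "pn \<noteq> 0" "qp \<noteq> 0" "qn \<noteq> 0" "rp \<noteq> 0" "rn \<noteq> 0" using units(3) by auto
  have r: "r \<in> laurent V" "inverse r \<in> laurent V" "r \<noteq> 0" "r \<in> homog c 0"
    using units nz homog_mult[OF deg0[of rn] homog_inverse[OF deg0[of pn]]]
    by (auto simp: r_def divide_inverse intro!: laurent_intros(4))
  have rp: "rp = r * (pp * qp ^ m)" using rel nz by (simp add: r_def field_simps)
  have rn: "rn = r * pn" using nz by (simp add: r_def)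
  have sum': "pos_mon S' indet j + neg_mon S' indet j = r * T"
    unfolding mons(5,6)[of indet, OF refl] rp rn T_def by (simp add: algebra_simps)
  note mj = mutation[OF S jk(1)] and mk = mutation[OF S jk(2)] and mj' = mutation[OF S'(1,2)]
  have A_eq: "mutation S' j (indet j) = A"
    by (simp add: mutation_indet_self[OF S'(1,2)] sum' A_def)
  have A_nz: "A \<noteq> 0" unfolding A_eq[symmetric] using field_hom_eq_0_iff[OF mj'(1)] indet_nz by simp
  have fixed: "mutation S j (indet i) = indet i" "mutation S k (indet i) = indet i" "mutation S' j (indet i) = indet i"
    if "i \<in> W" for i
    using that by (auto simp: W_def mutation_indet[OF S jk(1)] mutation_indet[OF S jk(2)] mutation_indet[OF S'(1,2)])
  \<comment> \<open>Mutation at j being an involution, F is \<rho> applied to the Laurent polynomial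
    \<open>mutation S j f\<close>. So only the images a and b of x_j and x_k under \<rho>
    matter.\<close>
  define \<rho> where "\<rho> g = mutation S' j (mutation S k (mutation S j g))" for g
  have \<rho>: "field_hom \<rho>"
    unfolding \<rho>_def[abs_def] by (rule field_hom_comp[OF mj'(1) field_hom_comp[OF mk(1) mj(1)]])
  define B where "B = qp + qn * A ^ n"
  define b where "b = \<rho> (indet k)"
  define a where "a = \<rho> (indet j)"
  have mk_k: "mutation S' j (mutation S k (indet k)) = B / indet k"
    using jk(3) mons(3,4)[of "\<lambda>i. mutation S' j (indet i)", OF fixed(3)]
    by (simp add: mutation_indet_self[OF S jk(2)] field_hom_simps[OF mj'(1)] field_hom_pos_mon[OF mj'(1)]
        field_hom_neg_mon[OF mj'(1)] mutation_indet[OF S'(1,2)] A_eq B_def)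
  have b: "b = B / indet k"
    using jk(3) by (simp add: b_def \<rho>_def mutation_indet[OF S jk(1)] mk_k)
  have a: "a = (pp * b ^ m + pn) / A"
  proof -
    let ?x = "\<lambda>i. mutation S' j (mutation S k (indet i))"
    have x: "?x i = indet i" if "i \<in> W" for i using fixed[OF that] by simp
    have "a = (pos_mon S ?x j + neg_mon S ?x j) / ?x j"
      by (simp add: a_def \<rho>_def mutation_indet_self[OF S jk(1)] field_hom_simps[OF mj'(1)] field_hom_simps[OF mk(1)]
        field_hom_pos_mon[OF mj'(1)] field_hom_neg_mon[OF mj'(1)] field_hom_pos_mon[OF mk(1)] field_hom_neg_mon[OF mk(1)])
    also have "?x j = A" using jk(3) by (simp add: mutation_indet[OF S jk(2)] A_eq)
    finally show ?thesis using mons(1,2)[of ?x, OF x] by (simp add: mk_k b)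
  qed
  have ab_nz: "a \<noteq> 0" "b \<noteq> 0" using field_hom_eq_0_iff[OF \<rho>] indet_nz by (simp_all add: a_def b_def)
  have T: "T \<in> laurent V" "T \<in> homog c 0"
  proof -
    show "T \<in> laurent V" unfolding T_def by (intro laurent_intros units laurent_indet V) auto
    have "indet k ^ m \<in> homog c 0" "qp ^ m \<in> homog c 0"
      using homog_power[OF homog_indet, of k m c] homog_power[OF deg0[of qp], of m] jk(3) by (simp_all add: c_def)
    then have "pp * qp ^ m \<in> homog c 0" "pn * indet k ^ m \<in> homog c 0"
      using homog_mult[OF deg0[of pp], of _ 0] homog_mult[OF deg0[of pn], of _ 0] by auto
    then show "T \<in> homog c 0" unfolding T_def by (rule homog_add)
  qed
  have A: "A \<in> laurent V" unfolding A_def divide_inverse by (intro laurent_intros(4) r T laurent_indet V)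
  have T_nz: "T \<noteq> 0" using A_nz by (auto simp: A_def)
  obtain d e where de: "d \<in> homog c 0" "d \<in> laurent V" "e \<in> laurent V" "B ^ m = qp ^ m + A * d + A\<^sup>2 * e"
    using binomial_expand[OF deg0[of qp] units(1)[of qp] deg0[of qn] units(1)[of qn] A mn(3), of m]
    unfolding B_def by auto
  define g where "g = qn * A ^ (n - 1)"
  have B: "B = qp + A * g" using mn(3) by (simp add: B_def g_def power_eq_if)
  have g: "g \<in> laurent V" unfolding g_def by (intro laurent_intros units A) auto
  \<comment> \<open>Modulo A, B^m is qp^m, so pp B^m + pn x_k^m is congruent to T, which equals A
    x_j / r. Hence the A in the denominator of a x_k^m cancels, and Y is the quotient.\<close>
  define Y where "Y = indet j * inverse r + pp * d + A * (pp * e)"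
  have Y: "Y \<in> laurent V" unfolding Y_def by (intro laurent_intros units laurent_indet V r de A) auto
  have bk: "b * indet k = B" by (simp add: b indet_nz)
  have aY: "a * indet k ^ m = Y"
  proof -
    have "A * a = pp * b ^ m + pn" using A_nz by (simp add: a)
    then have "A * (a * indet k ^ m) = (pp * b ^ m + pn) * indet k ^ m" by (simp add: mult.assoc[symmetric])
    also have "\<dots> = pp * (b * indet k) ^ m + pn * indet k ^ m"
      by (simp add: power_mult_distrib algebra_simps)
    also have "\<dots> = T + A * (pp * d + A * (pp * e))"
      unfolding bk de(4) T_def by (simp add: algebra_simps power2_eq_square)
    also have "T = A * (indet j * inverse r)"
      using r(3) indet_nz[of j] by (simp add: A_def field_simps)
    finally have "A * (a * indet k ^ m) = A * Y" by (simp add: Y_def algebra_simps)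
    then show ?thesis using A_nz by simp
  qed
  \<comment> \<open>B and Y are the numerators of b and a, so one factor v clears the inverse of
    either. The unit in front gives x_j the coefficient 1, and w collects the terms divisible by A,
    hence by T.\<close>
  define v where "v = r * inverse qp * (B * Y)"
  define w where "w = r * inverse (indet j) * (r * inverse qp * (qp * (pp * e) + g * Y))"
  have v_eq: "v = indet j + r * pp * d + T * w"
  proof -
    have "v = r * inverse r * (inverse qp * qp) * indet j + r * (inverse qp * qp) * pp * d
        + A * (r * inverse qp * (qp * (pp * e) + g * Y))"
      unfolding v_def B Y_def by (simp add: algebra_simps)
    also have "\<dots> = indet j + r * pp * d + A * (r * inverse qp * (qp * (pp * e) + g * Y))"
      using r(3) nz(3) by simp
    also have "A = T * (r * inverse (indet j))" by (simp add: A_def divide_inverse)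
    finally show ?thesis by (simp add: w_def mult.assoc)
  qed
  have w: "w \<in> laurent V" unfolding w_def
    by (intro laurent_intros(3,4) units laurent_indet V r de Y g) auto
  have BL: "B \<in> laurent V" unfolding B by (intro laurent_intros units A g) auto
  have vL: "v \<in> laurent V" unfolding v_def by (intro laurent_intros(4) units r BL Y) auto
  let ?F = "mutation S' j (mutation S k f)"
  have fk: "mutation S k f \<in> laurent V" and fj: "mutation S j f \<in> laurent V"
    using f jk by (auto simp: upper_bound_def V_def)
  obtain N where N: "(1 + yhat S' indet j) ^ N * ?F \<in> laurent V"
    using mutation_laurent_localized[OF S'(1,2), of "mutation S k f"] fk by (auto simp: S'(3))
  have "T = inverse r * neg_mon S' indet j * (1 + yhat S' indet j)"
    using exchange_sum_eq[of S' indet j] indet_nz r(3) sum' by (simp add: field_simps)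
  then have "T ^ N * ?F = (inverse r * neg_mon S' indet j) ^ N * ((1 + yhat S' indet j) ^ N * ?F)"
    by (simp only: power_mult_distrib mult.assoc)
  also have "\<dots> \<in> laurent V"
    using neg_mon_unit(1)[of S' j] by (intro laurent_intros(4,7) N r) (simp add: S'(3))
  finally have TN: "T ^ N * ?F \<in> laurent V" .
  have gens: "\<exists>M. v ^ M * z \<in> laurent V" if "z \<in> \<rho> ` (indet ` V \<union> (\<lambda>i. inverse (indet i)) ` V)" for z
  proof -
    have ik: "inverse (indet k) ^ l \<in> laurent V" for l by (intro laurent_intros(7) laurent_indet V)
    have bL: "b \<in> laurent V" unfolding b divide_inverse by (intro laurent_intros(4) BL laurent_indet V)
    have aL: "a \<in> laurent V"
    proof -
      have "a = Y * inverse (indet k) ^ m" using indet_nz[of k] unfolding aY[symmetric]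
        by (simp add: power_inverse mult.assoc)
      then show ?thesis by (simp only:) (intro laurent_intros(4) Y ik)
    qed
    have va: "v * inverse a \<in> laurent V"
    proof -
      have "v * inverse a = r * inverse qp * (B * indet k ^ m)"
        unfolding v_def aY[symmetric] using ab_nz(1) by (simp add: field_simps)
      then show ?thesis by (simp only:) (intro laurent_intros(4,7) units r BL laurent_indet V, auto)
    qed
    have vb: "v * inverse b \<in> laurent V"
    proof -
      have "v * inverse b = r * inverse qp * (indet k * Y)"
        unfolding v_def bk[symmetric] using ab_nz(2) by (simp add: field_simps)
      then show ?thesis by (simp only:) (intro laurent_intros(4,7) units r Y laurent_indet V, auto)
    qed
    obtain i where i: "i \<in> V" "z = \<rho> (indet i) \<or> z = inverse (\<rho> (indet i))"
      using \<open>z \<in> _\<close> by (auto simp: field_hom_simps[OF \<rho>])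
    consider "i = j" | "i = k" | "i \<in> W" using i(1) by (auto simp: W_def)
    then show ?thesis
    proof cases
      case 1
      then show ?thesis using i(2) aL va unfolding a_def[symmetric]
        by (metis power_0 power_one_right mult_1 a_def)
    next
      case 2
      then show ?thesis using i(2) bL vb unfolding b_def[symmetric]
        by (metis power_0 power_one_right mult_1 b_def)
    next
      case 3
      then have "\<rho> (indet i) = indet i" by (simp add: \<rho>_def fixed)
      then have "z \<in> laurent V" using i laurent_indet[of i V] by auto
      then show ?thesis by (intro exI[of _ 0]) simp
    qed
  qed
  have "\<rho> (mutation S j f) \<in> ring_span (\<rho> ` (indet ` V \<union> (\<lambda>i. inverse (indet i)) ` V))"
    using fj unfolding laurent_def by (rule field_hom_ring_span[OF \<rho>]) (auto intro!: ring_span_incl)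
  then have "\<exists>M. v ^ M * \<rho> (mutation S j f) \<in> laurent V"
    unfolding laurent_def by (rule ring_span_localize) (use vL gens in \<open>simp_all add: laurent_def\<close>)
  then obtain M where M: "v ^ M * ?F \<in> laurent V"
    by (auto simp: \<rho>_def mutation_involution[OF S jk(1)])
  have "?F \<in> laurent V"
  proof (rule laurent_coprime[OF T T_nz _ indet_nz laurent_indet(1) laurent_indet(2) _ _ w TN])
    show "indet j \<in> homog c 1" using homog_indet[of j c] by (simp add: c_def)
    show "j \<in> V" "j \<in> V" by (rule V)+
    show "r * pp * d \<in> homog c 0"
      using homog_mult[OF homog_mult[OF r(4) deg0[of pp]] de(1)] by simp
    show "r * pp * d \<in> laurent V" by (intro laurent_intros(4) r units de) auto
    show "(indet j + r * pp * d + T * w) ^ M * ?F \<in> laurent V" using M unfolding v_eq .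
  qed
  then show ?thesis by (simp add: S'_def V_def)
qed

lemma upper_bound_negate: "upper_bound (negate S) = upper_bound S"
  by (simp add: upper_bound_def)

lemma mutation_pair:
  assumes S: "is_seed S" "really_full_rank S" and jk: "j \<in> mutable S" "k \<in> mutable S" "j \<noteq> k"
    and f: "f \<in> upper_bound S"
  shows "mutation (mutate k S) j (mutation S k f) \<in> laurent (vertices S)"
proof -
  consider "exch S k j = 0" | "0 < exch S k j" | "exch S k j < 0" by linarith
  then show ?thesis
  proof cases
    case 1 then show ?thesis using mutation_pair_zero[OF S jk _ f] by simp
  next
    case 2 then show ?thesis using mutation_pair_pos[OF S(1) jk _ f] by simp
  next
    case 3
    have "mutation (mutate k (negate S)) j (mutation (negate S) k f) \<in> laurent (vertices (negate S))"
      by (rule mutation_pair_pos) (use 3 jk f is_seed_negate[OF S(1)] upper_bound_negate in auto)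
    then show ?thesis by (simp add: mutate_negate)
  qed
qed

lemma upper_bound_mutation:
  assumes "is_seed S" "really_full_rank S" "k \<in> mutable S" "f \<in> upper_bound S"
  shows "mutation S k f \<in> upper_bound (mutate k S)"
proof -
  have "mutation (mutate k S) j (mutation S k f) \<in> laurent (vertices S)" if "j \<in> mutable S" for j
  proof (cases "j = k")
    case True
    then show ?thesis using assms by (simp add: upper_bound_def)
  next
    case False
    then show ?thesis using mutation_pair assms that by blast
  qed
  then show ?thesis using assms by (auto simp: upper_bound_def)
qed

section \<open>Sink-recurrent seeds\<close>

text \<open>h is the composite of the mutations along the path, so it substitutes the cluster x for
  the initial one. That it carries upper bounds into upper bounds is invariance under mutation,
  applied backwards along the path.\<close>

lemma reachable_hom:
  assumes S: "is_seed S" and reach: "reachable S T x"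
  shows "is_seed T \<and> vertices T = vertices S \<and> mutable T = mutable S \<and> frozen T = frozen S \<and>
    (\<exists>h. field_hom h \<and> (\<forall>i. x i = h (indet i)) \<and> (really_full_rank S \<longrightarrow> really_full_rank T \<and>
      (\<forall>f\<in>upper_bound T. h f \<in> upper_bound S)))"
  using reach
proof induction
  case initial
  show ?case using S field_hom_id by auto
next
  case (step T x k)
  from step.IH have T: "is_seed T" "vertices T = vertices S" "mutable T = mutable S" "frozen T = frozen S"
    by simp_all
  from step.IH obtain h where h: "field_hom h" "\<And>i. x i = h (indet i)"
    "really_full_rank S \<Longrightarrow> really_full_rank T"
    "\<And>f. really_full_rank S \<Longrightarrow> f \<in> upper_bound T \<Longrightarrow> h f \<in> upper_bound S" by blast
  note k = \<open>k \<in> mutable T\<close>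
  let ?h = "\<lambda>f. h (mutation T k f)"
  have "field_hom ?h" by (rule field_hom_comp[OF h(1) mutation(1)[OF T(1) k]])
  moreover have "mutate_cluster k T x i = ?h (indet i)" for i
    unfolding mutation(2)[OF T(1) k] field_hom_mutate_cluster[OF h(1)] h(2) ..
  moreover have "really_full_rank (mutate k T)" if "really_full_rank S"
    using really_full_rank_mutate[OF T(1) k h(3)[OF that]] .
  moreover have "?h f \<in> upper_bound S" if rank: "really_full_rank S" and f: "f \<in> upper_bound (mutate k T)" for f
  proof (rule h(4)[OF rank])
    \<comment> \<open>Invariance is applied to \<open>mutate k T\<close>, whose mutation at k leads
      back to T.\<close>
    show "mutation T k f \<in> upper_bound T"
      using upper_bound_mutation[OF is_seed_mutate[OF T(1) k] really_full_rank_mutate[OF T(1) k h(3)[OF rank]] _ f, of k] k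
      by simp
  qed
  ultimately show ?case using T is_seed_mutate[OF T(1) k] by auto
qed

lemma reachable_seed:
  assumes "is_seed S" "reachable S T x"
  shows "is_seed T" "vertices T = vertices S" "mutable T = mutable S" "frozen T = frozen S"
  using reachable_hom[OF assms] by simp_all

lemma reachable_nz:
  assumes "is_seed S" "reachable S T x"
  shows "x i \<noteq> 0" "1 + yhat T x j \<noteq> 0"
proof -
  obtain h where h: "field_hom h" "\<And>i. x i = h (indet i)" using reachable_hom[OF assms] by blast
  then have x: "x = (\<lambda>i. h (indet i))" by auto
  show "x i \<noteq> 0" by (simp add: h indet_nz field_hom_simps[OF h(1)])
  have "1 + yhat T x j = h (1 + yhat T indet j)"
    unfolding x by (simp add: field_hom_simps[OF h(1)] field_hom_yhat[OF h(1)])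
  then show "1 + yhat T x j \<noteq> 0" using field_hom_eq_0_iff[OF h(1)] yhat_indet_nz by metis
qed

lemma reachable_fixed:
  assumes "is_seed S" "reachable S T x" "i \<notin> mutable S" shows "x i = indet i"
  using assms(2)
proof induction
  case (step T x k)
  then show ?case using assms reachable_seed(3)[OF assms(1) step.hyps(1)] by (auto simp: mutate_cluster_eq)
qed simp

definition frozen_gens :: "seed \<Rightarrow> ratfun set" where
  "frozen_gens S = indet ` frozen S \<union> (\<lambda>f. inverse (indet f)) ` frozen S"

definition cluster_ring :: "seed \<Rightarrow> ratfun set" where
  "cluster_ring S = ring_span (cluster_variables S \<union> frozen_gens S)"

lemmas cluster_ring_intros = ring_span_intros[where G = "cluster_variables S \<union> frozen_gens S" for S, folded cluster_ring_def]

lemma cluster_algebra_eq: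
  "cluster_algebra S = ring_of_type_algebra \<lparr>carrier := cluster_ring S\<rparr>"
  by (simp add: cluster_algebra_def cluster_ring_def ring_span_def frozen_gens_def Un_assoc)

lemma cluster_ring_mutable:
  assumes "reachable S T x" "i \<in> mutable T" shows "x i \<in> cluster_ring S"
  unfolding cluster_ring_def using assms
  by (intro ring_span_incl UnI1) (auto simp: cluster_variables_def)

lemma cluster_ring_frozen:
  "f \<in> frozen S \<Longrightarrow> indet f \<in> cluster_ring S" "f \<in> frozen S \<Longrightarrow> inverse (indet f) \<in> cluster_ring S"
  by (auto simp: cluster_ring_def frozen_gens_def intro: ring_span_incl)

lemma upper_bound_indet:
  assumes "is_seed S"
  shows "i \<in> vertices S \<Longrightarrow> indet i \<in> upper_bound S"
    "i \<in> frozen S \<Longrightarrow> inverse (indet i) \<in> upper_bound S"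
proof -
  have mut: "mutation S j (indet i) \<in> laurent (vertices S)" if "i \<in> vertices S" "j \<in> mutable S" for i j
  proof (cases "i = j")
    case True
    have "mutation S j (indet j) = neg_mon S indet j * (1 + yhat S indet j) * inverse (indet j)"
      using exchange_sum_eq[of S indet j] indet_nz by (simp add: mutation_indet_self[OF assms that(2)] divide_inverse)
    also have "\<dots> \<in> laurent (vertices S)"
      using that True by (intro laurent_intros(1,3,4) neg_mon_unit yhat_unit laurent_indet) auto
    finally show ?thesis using True by simp
  next
    case False
    then show ?thesis using laurent_indet(1)[OF that(1)] by (simp add: mutation_indet[OF assms that(2)])
  qed
  then show "i \<in> vertices S \<Longrightarrow> indet i \<in> upper_bound S" by (auto simp: upper_bound_def laurent_indet)
  assume i: "i \<in> frozen S"
  then have "i \<in> vertices S" by (simp add: vertices_def)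
  moreover have "mutation S j (inverse (indet i)) = inverse (indet i)" if "j \<in> mutable S" for j
  proof -
    have "i \<noteq> j" using i that assms unfolding is_seed_def by blast
    then show ?thesis
      by (simp add: field_hom_inverse[OF mutation(1)[OF assms that]] mutation_indet[OF assms that])
  qed
  ultimately show "inverse (indet i) \<in> upper_bound S" by (auto simp: upper_bound_def laurent_indet)
qed

lemma upper_bound_subring:
  assumes S: "is_seed S" and "G \<subseteq> upper_bound S" shows "ring_span G \<subseteq> upper_bound S"
proof
  fix f assume "f \<in> ring_span G"
  then show "f \<in> upper_bound S"
  proof (induction rule: ring_span_induct)
    case (incl x) then show ?case using assms by blast
  next
    case one
    show ?case unfolding upper_bound_def
      by (auto simp: field_hom_one[OF mutation(1)[OF S]] intro: laurent_intros)
  next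
    case (minus x)
    then show ?case unfolding upper_bound_def
      by (auto simp: field_hom_minus[OF mutation(1)[OF S]] intro: laurent_intros)
  next
    case (add x y)
    then show ?case unfolding upper_bound_def
      by (auto simp: field_hom_add[OF mutation(1)[OF S]] intro: laurent_intros)
  next
    case (mult x y)
    then show ?case unfolding upper_bound_def
      by (auto simp: field_hom_mult[OF mutation(1)[OF S]] intro: laurent_intros)
  qed
qed

text \<open>A variable of a seed lies in the upper bound of that seed, and h of
  \<open>reachable_hom\<close> carries this bound into the one of S.\<close>

lemma cluster_ring_upper_bound:
  assumes S: "is_seed S" "really_full_rank S"
  shows "cluster_ring S \<subseteq> upper_bound S"
  unfolding cluster_ring_def
proof (rule upper_bound_subring[OF S(1)], rule Un_least)
  show "frozen_gens S \<subseteq> upper_bound S"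
    using upper_bound_indet[OF S(1)] by (auto simp: frozen_gens_def vertices_def)
  show "cluster_variables S \<subseteq> upper_bound S"
  proof
    fix f assume "f \<in> cluster_variables S"
    then obtain T x i where T: "reachable S T x" "i \<in> mutable T" "f = x i" by (auto simp: cluster_variables_def)
    from reachable_hom[OF S(1) T(1)] S(2) obtain h where
      h: "\<And>i. x i = h (indet i)" "\<And>g. g \<in> upper_bound T \<Longrightarrow> h g \<in> upper_bound S" and T': "is_seed T" by blast
    show "f \<in> upper_bound S"
      unfolding T(3) h(1) by (intro h(2) upper_bound_indet(1)[OF T'] seed_vertex T(2))
  qed
qed

section \<open>Freezing, and changing the initial seed\<close>

text \<open>Freezing restricts the permitted mutations but changes neither the matrix nor the
  exchange relations.\<close>

lemma reachable_freeze:
  assumes "I \<subseteq> mutable S" "is_seed S" "reachable (freeze I S) T x"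
  shows "\<exists>T'. reachable S T' x \<and> T = freeze I T' \<and> I \<subseteq> mutable T'"
  using assms(3)
proof induction
  case initial
  then show ?case using assms reachable.initial by blast
next
  case (step T x k)
  then obtain T' where T': "reachable S T' x" "T = freeze I T'" "I \<subseteq> mutable T'" by blast
  have k: "k \<in> mutable T'" using step.hyps(2) T' by simp
  have "mutate k T = freeze I (mutate k T')"
    unfolding T'(2) by (rule seed.equality) (auto simp: exch_mutate fun_eq_iff)
  moreover have "mutate_cluster k T x = mutate_cluster k T' x"
    unfolding T'(2) by (simp add: mutate_cluster_def vertices_freeze[OF T'(3)])
  ultimately show ?case using reachable.step[OF T'(1) k] T'(3) by (intro exI[of _ "mutate k T'"]) simp
qed

lemma cluster_variables_freeze:
  assumes "I \<subseteq> mutable S" "is_seed S" shows "cluster_variables (freeze I S) \<subseteq> cluster_variables S"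
proof
  fix f assume "f \<in> cluster_variables (freeze I S)"
  then obtain T x i where T: "reachable (freeze I S) T x" "i \<in> mutable T" "f = x i"
    by (auto simp: cluster_variables_def)
  from reachable_freeze[OF assms T(1)] obtain T' where "reachable S T' x" "T = freeze I T'" by blast
  then show "f \<in> cluster_variables S" using T by (auto simp: cluster_variables_def)
qed

lemma cluster_ring_indet: "i \<in> vertices S \<Longrightarrow> indet i \<in> cluster_ring S"
  using cluster_ring_mutable[OF reachable.initial] cluster_ring_frozen(1) by (auto simp: vertices_def)

text \<open>The only generators that freezing can add are inverses of variables in I, and the
  product over I clears each of them.\<close>

lemma cluster_ring_freeze:
  assumes I: "I \<subseteq> mutable S" "is_seed S" and f: "f \<in> cluster_ring (freeze I S)"
  shows "\<exists>n. (\<Prod>i\<in>I. indet i) ^ n * f \<in> cluster_ring S"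
proof -
  have fin: "finite I" using I unfolding is_seed_def by (metis finite_subset)
  have V: "i \<in> I \<Longrightarrow> i \<in> vertices S" for i using I by (auto simp: vertices_def)
  have p: "(\<Prod>i\<in>J. indet i) \<in> cluster_ring S" if "J \<subseteq> I" for J
    using that V by (intro cluster_ring_intros(9) cluster_ring_indet) auto
  have "\<exists>n. (\<Prod>i\<in>I. indet i) ^ n * x \<in> cluster_ring S"
    if x: "x \<in> cluster_variables (freeze I S) \<union> frozen_gens (freeze I S)" for x
  proof -
    consider "x \<in> cluster_variables S" | "x \<in> frozen_gens S" | i where "i \<in> I" "x = indet i" | i where "i \<in> I" "x = inverse (indet i)"
      using x cluster_variables_freeze[OF I] unfolding frozen_gens_def freeze_simps image_Un by blast
    then show ?thesis
    proof cases
      case 1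
      then show ?thesis by (intro exI[of _ 0]) (auto simp: cluster_ring_def intro: ring_span_incl)
    next
      case 2
      then show ?thesis by (intro exI[of _ 0]) (auto simp: cluster_ring_def intro: ring_span_incl)
    next
      case 3
      then show ?thesis using cluster_ring_indet V by (intro exI[of _ 0]) auto
    next
      case 4
      have "(\<Prod>i\<in>I. indet i) = indet i * (\<Prod>i\<in>I - {i}. indet i)" using fin 4 by (simp add: prod.remove)
      then have "(\<Prod>i\<in>I. indet i) ^ 1 * x = (\<Prod>i\<in>I - {i}. indet i)" using 4 indet_nz[of i] by simp
      then show ?thesis using p[of "I - {i}"] by (metis Diff_subset)
    qed
  qed
  then have gen: "\<exists>n. (\<Prod>i\<in>I. indet i) ^ n * x \<in> ring_span (cluster_variables S \<union> frozen_gens S)"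
    if "x \<in> cluster_variables (freeze I S) \<union> frozen_gens (freeze I S)" for x
    using that unfolding cluster_ring_def .
  show ?thesis using f unfolding cluster_ring_def
    by (rule ring_span_localize[OF _ p[OF order_refl, unfolded cluster_ring_def] gen])
qed

lemma upper_bound_freeze:
  assumes "I \<subseteq> mutable S" shows "upper_bound S \<subseteq> upper_bound (freeze I S)"
proof -
  have "mutation (freeze I S) j = mutation S j" for j
    by (rule mutation_cong) (simp add: mutate_cluster_def vertices_freeze[OF assms])
  then show ?thesis by (auto simp: upper_bound_def vertices_freeze[OF assms])
qed

lemma reachable_mutate:
  assumes S: "is_seed S" "k \<in> mutable S" and "reachable (mutate k S) T x"
  shows "reachable S T (\<lambda>i. mutation S k (x i))"
  using assms(3)
proof induction
  case initial
  have "(\<lambda>i. mutation S k (indet i)) = mutate_cluster k S indet" by (auto simp: mutation[OF S])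
  then show ?case using reachable.step[OF reachable.initial S(2)] by simp
next
  case (step T x j)
  have "(\<lambda>i. mutation S k (mutate_cluster j T x i)) = mutate_cluster j T (\<lambda>i. mutation S k (x i))"
    by (auto simp: field_hom_mutate_cluster[OF mutation(1)[OF S]])
  then show ?case using reachable.step[OF step.IH step.hyps(2)] by simp
qed

text \<open>Each cluster algebra is written in the variables of its own initial cluster, so that of
  \<open>mutate k S\<close> is carried to that of S by the substitution
  \<open>mutation S k\<close>.\<close>

lemma cluster_ring_mutate:
  assumes S: "is_seed S" "k \<in> mutable S" and f: "f \<in> cluster_ring (mutate k S)"
  shows "mutation S k f \<in> cluster_ring S"
  using f unfolding cluster_ring_def
proof (rule field_hom_ring_span[OF mutation(1)[OF S]])
  fix x assume "x \<in> cluster_variables (mutate k S) \<union> frozen_gens (mutate k S)"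
  then show "mutation S k x \<in> ring_span (cluster_variables S \<union> frozen_gens S)"
  proof
    assume "x \<in> cluster_variables (mutate k S)"
    then obtain T y i where "reachable (mutate k S) T y" "i \<in> mutable T" "x = y i" by (auto simp: cluster_variables_def)
    then show ?thesis using cluster_ring_mutable[OF reachable_mutate[OF S]] by (auto simp: cluster_ring_def)
  next
    assume x: "x \<in> frozen_gens (mutate k S)"
    then obtain i where i: "i \<in> frozen S" "x = indet i \<or> x = inverse (indet i)" by (auto simp: frozen_gens_def)
    have "i \<noteq> k" using i(1) S unfolding is_seed_def by blast
    then have "mutation S k x = x"
      using i(2) by (auto simp: field_hom_inverse[OF mutation(1)[OF S]] mutation_indet[OF S])
    then show ?thesis using x by (auto simp: frozen_gens_def intro: ring_span_incl)
  qed
qed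

lemma upper_bound_cluster_ring_mutate:
  assumes S: "is_seed S" "really_full_rank S" "k \<in> mutable S"
    and U: "upper_bound (mutate k S) \<subseteq> cluster_ring (mutate k S)"
  shows "upper_bound S \<subseteq> cluster_ring S"
proof
  fix f assume "f \<in> upper_bound S"
  then have "mutation S k f \<in> cluster_ring (mutate k S)"
    using upper_bound_mutation[OF S] U by blast
  from cluster_ring_mutate[OF S(1,3) this] show "f \<in> cluster_ring S" by (simp add: mutation_involution[OF S(1,3)])
qed

section \<open>Gradings and symmetries of cluster algebras\<close>

text \<open>If all weighted column sums vanish, the two monomials of every exchange relation have
  the same degree, and \<open>weight_mutate\<close> keeps the sums zero for the transported weight
  c'.\<close>

lemma homog_reachable:
  assumes S: "is_seed S" and c: "\<And>j. j \<in> mutable S \<Longrightarrow> (\<Sum>i\<in>vertices S. c i * exch S i j) = 0"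
    and reach: "reachable S T x"
  shows "\<exists>c'. (\<forall>i\<in>vertices S. x i \<in> homog c (c' i)) \<and>
    (\<forall>j\<in>mutable S. (\<Sum>i\<in>vertices S. c' i * exch T i j) = 0)"
  using reach
proof induction
  case initial
  then show ?case using homog_indet c by (intro exI[of _ c]) auto
next
  case (step T x k)
  then obtain c' where c': "\<forall>i\<in>vertices S. x i \<in> homog c (c' i)"
    "\<forall>j\<in>mutable S. (\<Sum>i\<in>vertices S. c' i * exch T i j) = 0" by blast
  note T = reachable_seed[OF S step.hyps(1)]
  note k = \<open>k \<in> mutable T\<close>
  let ?c = "mutate_weight k T c'"
  have kV: "k \<in> vertices S" using k T by (simp add: vertices_def)
  let ?d = "\<Sum>i\<in>vertices S. c' i * pos_part (- exch T i k)"
  have deg: "x i ^ nat (pos_part e) \<in> homog c (c' i * pos_part e)" if "i \<in> vertices S" for i e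
    using homog_power[OF bspec[OF c'(1) that], of "nat (pos_part e)"] by (simp add: pos_part_def mult.commute)
  have "pos_mon T x k \<in> homog c (\<Sum>i\<in>vertices S. c' i * pos_part (exch T i k))"
    "neg_mon T x k \<in> homog c ?d"
    unfolding pos_mon_def neg_mon_def T by (intro homog_prod deg; assumption)+
  moreover have "(\<Sum>i\<in>vertices S. c' i * pos_part (exch T i k)) = ?d"
  proof -
    have "(\<Sum>i\<in>vertices S. c' i * pos_part (exch T i k)) - ?d = (\<Sum>i\<in>vertices S. c' i * exch T i k)"
      by (simp add: sum_subtractf[symmetric] right_diff_distrib[symmetric] pos_part_diff)
    then show ?thesis using c'(2) k T by simp
  qed
  ultimately have "(pos_mon T x k + neg_mon T x k) * inverse (x k) \<in> homog c (?d + - c' k)"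
    by (intro homog_mult homog_add homog_inverse) (use c'(1) kV in auto)
  then have "mutate_cluster k T x i \<in> homog c (?c i)" if "i \<in> vertices S" for i
    using that c'(1) T by (auto simp: mutate_cluster_eq mutate_weight_def divide_inverse)
  moreover have "(\<Sum>i\<in>vertices S. ?c i * exch (mutate k T) i j) = 0" if "j \<in> mutable S" for j
    using weight_mutate[OF T(1) k, of c' j] c'(2) k that T by auto
  ultimately show ?case by blast
qed

text \<open>A frozen s with zero row never enters an exchange relation. The lemma is applied to the
  scaling of x_s alone and to mutation at s.\<close>

lemma invariant_reachable:
  assumes S: "is_seed S" and s: "s \<notin> mutable S" "\<And>j. j \<in> mutable S \<Longrightarrow> exch S s j = 0"
    and h: "field_hom h" "\<And>i. i \<in> vertices S \<Longrightarrow> i \<noteq> s \<Longrightarrow> h (indet i) = indet i"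
    and reach: "reachable S T x"
  shows "(\<forall>j\<in>mutable S. exch T s j = 0) \<and> (\<forall>i\<in>vertices S. i \<noteq> s \<longrightarrow> h (x i) = x i)"
  using reach
proof induction
  case initial
  then show ?case using s h by auto
next
  case (step T x k)
  note T = reachable_seed[OF S step.hyps(1)]
  have k: "k \<in> mutable S" using step.hyps(2) T by simp
  then have ks: "k \<noteq> s" "k \<in> vertices S" using s by (auto simp: vertices_def)
  have "exch (mutate k T) s j = 0" if "j \<in> mutable S" for j
    using step.IH k that by (auto simp: exch_mutate pos_part_def)
  moreover have "h (mutate_cluster k T x i) = mutate_cluster k T x i" if i: "i \<in> vertices S" "i \<noteq> s" for i
  proof (cases "i = k")
    case True
    have eq: "pos_mon T (\<lambda>i. h (x i)) k = pos_mon T x k" "neg_mon T (\<lambda>i. h (x i)) k = neg_mon T x k"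
      by (rule pos_mon_cong neg_mon_cong, metis T(2) k step.IH)+
    show ?thesis using step.IH ks True
      by (simp add: mutate_cluster_eq field_hom_simps[OF h(1)] field_hom_pos_mon[OF h(1)] field_hom_neg_mon[OF h(1)] eq)
  next
    case False
    then show ?thesis using step.IH i by (simp add: mutate_cluster_eq)
  qed
  ultimately show ?case by blast
qed

text \<open>For an isolated vertex \<open>s\<close>, the cluster algebra is \<open>B[x\<^sub>s, x\<^sub>s']\<close>, where \<open>B\<close> is generated by
  the cluster variables not involving \<open>x\<^sub>s\<close>.\<close>

definition core_gens :: "seed \<Rightarrow> nat \<Rightarrow> ratfun set" where
  "core_gens S s = cluster_variables (freeze {s} S) \<union> frozen_gens S"

definition isolated_ring :: "seed \<Rightarrow> nat \<Rightarrow> ratfun set" where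
  "isolated_ring S s = ring_span (core_gens S s \<union> {indet s, mutate_cluster s S indet s})"

lemma isolated_ring_cluster_ring:
  assumes "is_seed S" "s \<in> mutable S" shows "isolated_ring S s \<subseteq> cluster_ring S"
  unfolding isolated_ring_def cluster_ring_def
proof (rule ring_span_mono, rule Un_least)
  show "core_gens S s \<subseteq> ring_span (cluster_variables S \<union> frozen_gens S)"
    using cluster_variables_freeze[of "{s}" S] assms by (auto simp: core_gens_def intro: ring_span_incl)
  have "indet s \<in> cluster_ring S" by (rule cluster_ring_mutable[OF reachable.initial assms(2)])
  moreover have "mutate_cluster s S indet s \<in> cluster_ring S"
    using cluster_ring_mutable[OF reachable.step[OF reachable.initial assms(2)]] assms(2) by simp
  ultimately show "{indet s, mutate_cluster s S indet s} \<subseteq> ring_span (cluster_variables S \<union> frozen_gens S)"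
    by (simp add: cluster_ring_def)
qed

section \<open>Upper bounds at an isolated vertex and at a sink\<close>

lemma frozen_monomial:
  assumes "\<And>i. i \<in> W \<Longrightarrow> e i \<noteq> 0 \<Longrightarrow> i \<in> F"
  shows "(\<Prod>i\<in>W. indet i powi e i) \<in> ring_span (indet ` F \<union> (\<lambda>f. inverse (indet f)) ` F)"
proof (intro ring_span_prod)
  fix i assume i: "i \<in> W"
  show "indet i powi e i \<in> ring_span (indet ` F \<union> (\<lambda>f. inverse (indet f)) ` F)"
  proof (cases "e i = 0")
    case False
    then show ?thesis using assms[OF i] by (intro ring_span_power_int ring_span_incl) auto
  qed (simp add: ring_span_1)
qed

lemma yhat_frozen:
  assumes "\<And>i. i \<in> vertices S \<Longrightarrow> exch S i k \<noteq> 0 \<Longrightarrow> i \<in> frozen S"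
  shows "yhat S indet k \<in> ring_span (frozen_gens S)" "inverse (yhat S indet k) \<in> ring_span (frozen_gens S)"
proof -
  show "yhat S indet k \<in> ring_span (frozen_gens S)"
    unfolding yhat_def frozen_gens_def by (rule frozen_monomial) (use assms in auto)
  have "inverse (yhat S indet k) = (\<Prod>i\<in>vertices S. indet i powi (- exch S i k))"
    by (simp add: yhat_def prod_inversef[symmetric] power_int_minus)
  also have "\<dots> \<in> ring_span (frozen_gens S)"
    unfolding frozen_gens_def by (rule frozen_monomial) (use assms in auto)
  finally show "inverse (yhat S indet k) \<in> ring_span (frozen_gens S)" .
qed

lemma neg_mon_frozen:
  assumes "\<And>i. i \<in> vertices S \<Longrightarrow> exch S i k < 0 \<Longrightarrow> i \<in> frozen S"
  shows "neg_mon S indet k \<in> ring_span (frozen_gens S)" "inverse (neg_mon S indet k) \<in> ring_span (frozen_gens S)"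
proof -
  have eq: "neg_mon S indet k = (\<Prod>i\<in>vertices S. indet i powi pos_part (- exch S i k))"
    unfolding neg_mon_def by (intro prod.cong) (auto simp: power_int_def pos_part_def)
  show "neg_mon S indet k \<in> ring_span (frozen_gens S)"
    unfolding eq frozen_gens_def by (rule frozen_monomial) (use assms in \<open>auto simp: pos_part_def\<close>)
  have "inverse (neg_mon S indet k) = (\<Prod>i\<in>vertices S. indet i powi (- pos_part (- exch S i k)))"
    by (simp add: eq prod_inversef[symmetric] power_int_minus)
  also have "\<dots> \<in> ring_span (frozen_gens S)"
    unfolding frozen_gens_def by (rule frozen_monomial) (use assms in \<open>auto simp: pos_part_def\<close>)
  finally show "inverse (neg_mon S indet k) \<in> ring_span (frozen_gens S)" .
qed

text \<open>Expand f in powers of x_s with coefficients b_d in the ring B of elements not involving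
  x_s. Mutation at s sends x_s to N / x_s with N = u (1 + z), and Laurentness of the image makes b_d
  divisible by N^(-d) when d is negative. The quotient lies in B, because B has a grading in which z
  has degree one, and the negative powers of x_s combine with N to powers of x_s'.\<close>

lemma isolated_upper_bound:
  assumes S: "is_seed S" "really_full_rank S" and s: "s \<in> mutable S"
    and isolated: "\<And>i. i \<in> mutable S \<Longrightarrow> exch S i s = 0"
    and U: "upper_bound (freeze {s} S) \<subseteq> cluster_ring (freeze {s} S)"
  shows "upper_bound S \<subseteq> isolated_ring S s"
proof
  fix f assume f: "f \<in> upper_bound S"
  define V where "V = vertices S"
  define S0 where "S0 = freeze {s} S"
  define B where "B = ring_span (core_gens S s)"
  note B_intros = ring_span_intros[where G = "core_gens S s", folded B_def]
  have S0: "is_seed S0" "vertices S0 = V" "really_full_rank S0" "mutable S0 = mutable S - {s}" "exch S0 = exch S"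
    "frozen S0 = frozen S \<union> {s}"
    using is_seed_freeze[OF S(1), of "{s}"] really_full_rank_freeze[OF S(2), of "{s}"] s
    by (auto simp: S0_def V_def vertices_freeze)
  have isolated': "exch S s j = 0" if "j \<in> mutable S" for j using seed_zero[OF S(1) s that] isolated that by simp
  have sV: "s \<in> V" using s by (simp add: V_def vertices_def)
  have s_frozen: "s \<notin> frozen S" using S(1) s unfolding is_seed_def by blast
  have col_frozen: "i \<in> frozen S" if "i \<in> V" "exch S i s \<noteq> 0" for i
    using that isolated by (auto simp: V_def vertices_def)
  define z where "z = yhat S indet s"
  define u where "u = neg_mon S indet s"
  have span_B: "ring_span (frozen_gens S) \<subseteq> B" unfolding B_def
    by (rule ring_span_mono) (auto simp: core_gens_def intro: ring_span_incl)
  have zB: "z \<in> B" "inverse z \<in> B" "z \<noteq> 0" and uB: "u \<in> B" "inverse u \<in> B" "u \<noteq> 0"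
    using yhat_frozen[of S s] neg_mon_frozen[of S s] col_frozen span_B neg_mon_unit(3) yhat_unit(3)
    by (auto simp: z_def u_def V_def)
  have exch_s: "mutate_cluster s S indet s = u * (1 + z) / indet s"
    using exchange_sum_eq[of S indet s] indet_nz by (simp add: mutate_cluster_eq u_def z_def)
  have fixed_B: "h b = b" if h: "field_hom h" "\<And>i. i \<in> V \<Longrightarrow> i \<noteq> s \<Longrightarrow> h (indet i) = indet i" and b: "b \<in> B" for h b
    using b unfolding B_def
  proof (induction rule: ring_span_induct)
    case (incl x)
    then show ?case unfolding core_gens_def
    proof
      assume "x \<in> cluster_variables (freeze {s} S)"
      then obtain T y i where T: "reachable S0 T y" "i \<in> mutable T" "x = y i" by (auto simp: cluster_variables_def S0_def)
      have "\<forall>i\<in>V. i \<noteq> s \<longrightarrow> h (y i) = y i"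
        using invariant_reachable[OF S0(1) _ _ h(1) _ T(1), of s] h(2) isolated' by (auto simp: S0)
      moreover have "i \<in> V" "i \<noteq> s" using T(2) reachable_seed(3)[OF S0(1) T(1)] S0 by (auto simp: V_def vertices_def)
      ultimately show ?thesis using T(3) by simp
    next
      assume "x \<in> frozen_gens S"
      then obtain i where "i \<in> frozen S" "x = indet i \<or> x = inverse (indet i)" by (auto simp: frozen_gens_def)
      moreover have "h (indet i) = indet i"
        using calculation s_frozen by (intro h(2)) (auto simp: V_def vertices_def)
      ultimately show ?thesis by (auto simp: field_hom_inverse[OF h(1)])
    qed
  qed (simp_all add: field_hom_simps[OF h(1)])
  define \<delta> where "\<delta> i = (if i = s then 1 else 0 :: int)" for i
  have B_deg0: "b \<in> homog \<delta> 0" if "b \<in> B" for b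
    using fixed_B[OF scale(1)[of \<delta>] _ that] by (simp add: homog_def scale \<delta>_def)
  have xs: "indet s powi d \<in> homog \<delta> d" for d
    using homog_power_int[OF homog_indet[of s \<delta>], of d] by (simp add: \<delta>_def)
  have "f \<in> cluster_ring S0" using upper_bound_freeze[of "{s}" S] s f U by (auto simp: S0_def)
  then have "f \<in> graded_sum (\<lambda>d. (\<lambda>b. b * indet s powi d) ` B)"
    unfolding cluster_ring_def
  proof (rule ring_span_graded_sum[rotated -1])
    let ?P = "\<lambda>d. (\<lambda>b. b * indet s powi d) ` B"
    show "0 \<in> ?P d" for d by (rule image_eqI[of _ _ 0]) (simp_all add: B_intros)
    show "x + y \<in> ?P d" if "x \<in> ?P d" "y \<in> ?P d" for x y d
      using that by (auto simp flip: distrib_right intro!: imageI B_intros(3))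
    show "- x \<in> ?P d" if "x \<in> ?P d" for x d
    proof -
      from that obtain b where b: "b \<in> B" "x = b * indet s powi d" by blast
      show ?thesis by (rule image_eqI[of _ _ "- b"]) (simp_all add: b B_intros(5))
    qed
    show "1 \<in> ?P 0" by (rule image_eqI[of _ _ 1]) (simp_all add: B_intros)
    show "x * y \<in> ?P (d + e)" if xy: "x \<in> ?P d" "y \<in> ?P e" for x y d e
    proof -
      from xy obtain a b where b: "a \<in> B" "b \<in> B" "x = a * indet s powi d" "y = b * indet s powi e" by blast
      show ?thesis by (rule image_eqI[of _ _ "a * b"]) (simp_all add: b B_intros(4) power_int_add indet_nz)
    qed
    show "\<exists>d. x \<in> ?P d" if "x \<in> cluster_variables S0 \<union> frozen_gens S0" for x
    proof -
      have "x \<in> core_gens S s \<or> x = indet s \<or> x = inverse (indet s)"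
        using that by (auto simp: core_gens_def S0_def frozen_gens_def)
      then show ?thesis
      proof (elim disjE)
        assume "x \<in> core_gens S s"
        then have "x \<in> B" by (simp add: B_def ring_span_incl)
        then show ?thesis by (intro exI[of _ 0] image_eqI[of _ _ x]) auto
      next
        assume "x = indet s"
        then show ?thesis by (intro exI[of _ 1] image_eqI[of _ _ 1]) (auto intro: B_intros)
      next
        assume "x = inverse (indet s)"
        then show ?thesis by (intro exI[of _ "-1"] image_eqI[of _ _ 1]) (auto intro: B_intros simp: power_int_minus)
      qed
    qed
  qed
  then obtain I p where I: "finite I" "\<And>d. d \<in> I \<Longrightarrow> p d \<in> (\<lambda>b. b * indet s powi d) ` B" "f = sum p I"
    by (rule graded_sumE) blast
  then have "\<exists>b. \<forall>d\<in>I. b d \<in> B \<and> p d = b d * indet s powi d" by (intro bchoice) auto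
  then obtain b where b: "\<And>d. d \<in> I \<Longrightarrow> b d \<in> B" "\<And>d. d \<in> I \<Longrightarrow> p d = b d * indet s powi d" by blast
  define N where "N = u * (1 + z)"
  have N_nz: "N \<noteq> 0" using uB(3) yhat_indet_nz[of S s] by (simp add: N_def z_def)
  have NB: "N \<in> B" unfolding N_def by (intro B_intros zB uB)
  note ms = mutation[OF S(1) s]
  define q where "q d = b d * N powi d * indet s powi (- d)" for d
  have "mutation S s (p d) = q d" if "d \<in> I" for d
  proof -
    have "mutation S s (b d) = b d"
      by (rule fixed_B[OF ms(1) _ b(1)[OF that]]) (simp add: mutation_indet[OF S(1) s])
    moreover have "mutation S s (indet s) = N * inverse (indet s)"
      unfolding ms(2) exch_s N_def by (simp add: divide_inverse)
    ultimately show ?thesis unfolding b(2)[OF that] q_def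
      by (simp add: field_hom_simps[OF ms(1)] power_int_mult_distrib power_int_minus power_int_inverse)
  qed
  then have sum_q: "mutation S s f = sum q I" by (simp add: I(3) field_hom_sum[OF ms(1)])
  have q_homog: "q d \<in> homog \<delta> (- d)" if "d \<in> I" for d
  proof -
    have "N powi d \<in> homog \<delta> 0" using homog_power_int[OF B_deg0[OF NB], of d] by simp
    then show ?thesis unfolding q_def
      using homog_mult[OF homog_mult[OF B_deg0[OF b(1)[OF that]]] xs[of "- d"]] by fastforce
  qed
  \<comment> \<open>The q d are the homogeneous components of \<open>mutation S s f\<close> for the
    degree in x_s, and the components of a Laurent polynomial are Laurent.\<close>
  have qL: "q d \<in> laurent V" if d: "d \<in> I" for d
  proof -
    have "mutation S s f \<in> laurent V" using f s by (simp add: upper_bound_def V_def)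
    then obtain K g where K: "finite K" "\<And>e. e \<in> K \<Longrightarrow> g e \<in> homog \<delta> e \<inter> laurent V" "mutation S s f = sum g K"
      using graded_sumE[OF laurent_graded] by metis
    have sum: "sum (\<lambda>e. q (- e)) (uminus ` I) = sum g K"
      using sum_q K(3) by (simp add: sum.reindex)
    have "(if - d \<in> uminus ` I then q (- (- d)) else 0) = (if - d \<in> K then g (- d) else 0)"
      by (rule homog_components_unique[of _ _ _ \<delta>, OF _ K(1) _ _ sum]) (use I(1) q_homog K(2) in auto)
    then show ?thesis using d K(2)[of "- d"] by (auto intro: laurent_intros split: if_splits)
  qed
  have bL: "b d * N powi d \<in> laurent V" if "d \<in> I" for d
  proof -
    have "q d * indet s powi d = b d * N powi d"
      using indet_nz[of s] by (simp add: q_def power_int_minus)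
    then show ?thesis using laurent_intros(4)[OF qL[OF that] laurent_indet_powi[OF sV, of d]] by simp
  qed
  \<comment> \<open>A second weight, with value 1 on column s and 0 on the other mutable columns: z
    gets degree one, and the exchange relations of the seed with s frozen are homogeneous.\<close>
  have "\<exists>c. \<forall>j\<in>mutable S. (if j = s then 1 else 0) = (\<Sum>i\<in>V. c i * exch S i j)"
    using S(2) unfolding really_full_rank_def V_def by (rule allE[of _ "\<lambda>j. if j = s then 1 else 0"])
  then obtain c where c0: "\<forall>j\<in>mutable S. (if j = s then 1 else 0) = (\<Sum>i\<in>V. c i * exch S i j)" ..
  have cs: "\<And>j. j \<in> mutable S0 \<Longrightarrow> (\<Sum>i\<in>vertices S0. c i * exch S0 i j) = 0"
    and c1: "(\<Sum>i\<in>V. c i * exch S i s) = 1"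
    using c0 s by (auto simp: S0)
  have z1: "z \<in> homog c 1" using homog_yhat[of S s c] c1 by (simp add: z_def V_def)
  have B_graded: "B \<subseteq> graded_sum (\<lambda>d. homog c d \<inter> B)"
  proof
    fix x assume "x \<in> B"
    then show "x \<in> graded_sum (\<lambda>d. homog c d \<inter> B)" unfolding B_def
    proof (rule ring_span_homog[rotated])
      fix x assume "x \<in> core_gens S s"
      then show "\<exists>d. x \<in> homog c d" unfolding core_gens_def
      proof
        assume "x \<in> cluster_variables (freeze {s} S)"
        then obtain T y i where T: "reachable S0 T y" "i \<in> mutable T" "x = y i" by (auto simp: cluster_variables_def S0_def)
        have "i \<in> vertices S0" using T(2) reachable_seed(3)[OF S0(1) T(1)] by (auto simp: vertices_def)
        then show ?thesis using homog_reachable[OF S0(1) cs T(1)] T(3) by blast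
      next
        assume "x \<in> frozen_gens S"
        then obtain i where "x = indet i \<or> x = inverse (indet i)" by (auto simp: frozen_gens_def)
        then show ?thesis using homog_indet[of i c] homog_inverse[OF homog_indet[of i c]] by blast
      qed
    qed
  qed
  \<comment> \<open>Here \<open>monic_division\<close> runs with the subring B as J. About the
    quotient l it is only known that it is a Laurent polynomial, hence a sum of homogeneous
    elements.\<close>
  have div1: "l \<in> B" if l: "l \<in> laurent V" "(1 + z) * l \<in> B" for l
  proof (rule monic_division[OF _ _ _ B_graded z1 zB(3) _ homog_1])
    show "l \<in> graded_sum (homog c)" using laurent_graded[OF l(1), of c] unfolding graded_sum_def by blast
    show "(z + 1) * l \<in> B" using l(2) by (simp add: add.commute)
  qed (auto intro: B_intros zB)
  have z1L: "1 + z \<in> laurent V" unfolding z_def V_def by (intro laurent_intros yhat_unit)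
  have div: "l \<in> B" if "l \<in> laurent V" "(1 + z) ^ n * l \<in> B" for l n
    using that
  proof (induction n)
    case (Suc n)
    have "(1 + z) ^ n * l \<in> B"
      by (rule div1) (use Suc.prems z1L in \<open>auto simp: mult.assoc intro!: laurent_intros(4,7)\<close>)
    then show ?case using Suc by blast
  qed simp
  have core: "B \<subseteq> isolated_ring S s" unfolding B_def isolated_ring_def
    by (rule ring_span_mono) (auto intro: ring_span_incl)
  have "p d \<in> isolated_ring S s" if d: "d \<in> I" for d
  proof (cases "0 \<le> d")
    case True
    have "indet s ^ nat d \<in> isolated_ring S s"
      unfolding isolated_ring_def by (intro ring_span_power ring_span_incl) simp
    then have "b d * indet s ^ nat d \<in> isolated_ring S s"
      using core b(1)[OF d] unfolding isolated_ring_def by (intro ring_span_mult) auto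
    then show ?thesis using b(2)[OF d] True by (simp add: power_int_def)
  next
    case False
    define e where "e = nat (- d)"
    define l where "l = b d * N powi d"
    have l: "b d = N ^ e * l" using False N_nz by (simp add: l_def e_def power_int_def field_simps)
    have "(1 + z) ^ e * l = inverse u ^ e * b d"
      unfolding l N_def using uB(3) by (simp add: power_mult_distrib power_inverse)
    also have "\<dots> \<in> B" by (intro B_intros(4,7) uB b(1) d)
    finally have lB: "l \<in> B" using div bL[OF d] by (simp add: l_def)
    have "indet s powi d = inverse (indet s) ^ e" using False by (simp add: power_int_def e_def)
    then have "p d = l * (N / indet s) ^ e"
      unfolding b(2)[OF d] l divide_inverse power_mult_distrib by (simp only: mult_ac)
    moreover have "N / indet s \<in> isolated_ring S s"
      unfolding isolated_ring_def by (rule ring_span_incl) (simp add: exch_s N_def)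
    ultimately show ?thesis
      using core lB unfolding isolated_ring_def by (auto intro: ring_span_mult ring_span_power)
  qed
  then show "f \<in> isolated_ring S s" unfolding I(3) isolated_ring_def by (intro ring_span_sum) auto
qed

text \<open>The loci where x and p are invertible cover the spectrum, so an element regular on both
  is regular. If one factor x already moves g into the ring, a x + b p = 1 trades p^(m+1) for p^m;
  an outer induction removes the powers of x.\<close>

lemma comaximal_descent:
  assumes x: "x \<in> ring_span G" "p \<in> ring_span G" and ab: "a \<in> ring_span G" "b \<in> ring_span G" "a * x + b * p = 1"
    and f: "x ^ n * f \<in> ring_span G" "p ^ m * f \<in> ring_span G"
  shows "f \<in> ring_span G"
proof -
  have step: "g \<in> ring_span G" if "x * g \<in> ring_span G" "p ^ m * g \<in> ring_span G" for g m
    using that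
  proof (induction m)
    case (Suc m)
    let ?h = "p ^ m * g"
    have "?h = (a * x + b * p) * ?h" by (simp add: ab(3))
    also have "\<dots> = a * (p ^ m * (x * g)) + b * (p ^ Suc m * g)" by (simp add: algebra_simps)
    also have "\<dots> \<in> ring_span G" by (intro ring_span_add ring_span_mult ring_span_power ab Suc.prems x)
    finally show ?case using Suc by blast
  qed simp
  show ?thesis using f
  proof (induction n)
    case (Suc n)
    have "p ^ m * (x ^ n * f) = x ^ n * (p ^ m * f)" by (simp add: algebra_simps)
    also have "\<dots> \<in> ring_span G" by (intro ring_span_mult ring_span_power x Suc.prems)
    finally have "x ^ n * f \<in> ring_span G" by (intro step[of "x ^ n * f" m]) (use Suc.prems in \<open>simp_all add: mult.assoc\<close>)
    then show ?case using Suc by blast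
  qed simp
qed

lemma discrete_upper_bound:
  assumes "is_seed S" "really_full_rank S" "\<And>i j. \<not> arrow S i j"
  shows "upper_bound S \<subseteq> cluster_ring S"
  using assms
proof (induction "card (mutable S)" arbitrary: S)
  case 0
  have "finite (mutable S)" using 0(2) unfolding is_seed_def by blast
  with 0(1) have "mutable S = {}" by simp
  then have "upper_bound S \<subseteq> laurent (frozen S)" by (auto simp: upper_bound_def vertices_def)
  also have "\<dots> \<subseteq> cluster_ring S" unfolding laurent_def cluster_ring_def
    by (rule ring_span_mono) (auto simp: frozen_gens_def intro: ring_span_incl)
  finally show ?case .
next
  case (Suc n)
  then obtain s where s: "s \<in> mutable S" by (metis card.empty equals0I nat.distinct(1))
  have zero: "exch S i j = 0" if "i \<in> mutable S" "j \<in> mutable S" for i j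
    using that Suc.prems(3)[of i j] Suc.prems(3)[of j i] seed_sign[OF Suc.prems(1), of j i]
    by (auto simp: arrow_def)
  have "upper_bound (freeze {s} S) \<subseteq> cluster_ring (freeze {s} S)"
  proof (rule Suc.hyps(1))
    show "n = card (mutable (freeze {s} S))" using Suc.hyps(2) s by simp
    show "is_seed (freeze {s} S)" "really_full_rank (freeze {s} S)"
      using s Suc.prems is_seed_freeze really_full_rank_freeze by auto
    show "\<not> arrow (freeze {s} S) i j" for i j using Suc.prems(3)[of i j] by (auto simp: arrow_def)
  qed
  then have "upper_bound S \<subseteq> isolated_ring S s"
    using isolated_upper_bound[OF Suc.prems(1,2) s] zero s by blast
  then show ?case using isolated_ring_cluster_ring[OF Suc.prems(1) s] by blast
qed

lemma N_in_subset: "N_in S s \<subseteq> mutable S"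
  by (auto simp: N_in_def)

lemma freeze_freeze: "freeze {s} (freeze I S) = freeze (I \<union> {s}) S"
proof -
  have "mutable S - I - {s} = mutable S - (I \<union> {s})" "frozen S \<union> I \<union> {s} = frozen S \<union> (I \<union> {s})" by blast+
  then show ?thesis unfolding freeze_def by simp
qed

text \<open>The mutable neighbours of a sink are exactly the vertices in \<open>N_in S s\<close>, so
  s is isolated once these are frozen.\<close>

lemma isolated_N_in:
  assumes S: "is_seed S" and rank: "really_full_rank S" and s: "is_sink S s"
    and U: "upper_bound (freeze (N_in S s \<union> {s}) S) \<subseteq> cluster_ring (freeze (N_in S s \<union> {s}) S)"
  shows "s \<in> mutable (freeze (N_in S s) S)"
    "\<And>i. i \<in> mutable (freeze (N_in S s) S) \<Longrightarrow> exch S i s = 0"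
    "upper_bound (freeze (N_in S s) S) \<subseteq> isolated_ring (freeze (N_in S s) S) s"
proof -
  have sm: "s \<in> mutable S" using s by (simp add: is_sink_def)
  have "s \<notin> N_in S s" using seed_diag[OF S sm] by (auto simp: N_in_def arrow_def)
  then show 1: "s \<in> mutable (freeze (N_in S s) S)" using sm by simp
  show 2: "exch S i s = 0" if "i \<in> mutable (freeze (N_in S s) S)" for i
    using that s sm by (force simp: N_in_def arrow_def is_sink_def)
  show "upper_bound (freeze (N_in S s) S) \<subseteq> isolated_ring (freeze (N_in S s) S) s"
    by (rule isolated_upper_bound) (use 1 2 S rank U is_seed_freeze really_full_rank_freeze N_in_subset
      in \<open>auto simp: freeze_freeze\<close>)
qed

text \<open>At a sink the exponents of mutable variables in \<open>yhat\<close> are nonnegative, and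
  positive exactly on \<open>N_in S s\<close>; negative exponents belong to frozen variables, which
  are invertible.\<close>

lemma yhat_sink_divisible:
  assumes S: "is_seed S" and s: "is_sink S s"
  shows "\<exists>q. q \<in> cluster_ring S \<and> yhat S indet s = (\<Prod>v\<in>N_in S s. indet v) * q"
    "neg_mon S indet s \<in> cluster_ring S" "inverse (neg_mon S indet s) \<in> cluster_ring S"
proof -
  have sm: "s \<in> mutable S" and nonneg: "\<And>v. v \<in> mutable S \<Longrightarrow> 0 \<le> exch S v s" using s by (auto simp: is_sink_def)
  have fin: "finite (vertices S)" using seed_finite[OF S] .
  have N: "N_in S s = {v \<in> mutable S. 0 < exch S v s}" using sm by (auto simp: N_in_def arrow_def)
  \<comment> \<open>The exponents left after one factor x_v has been split off for each v in
    \<open>N_in S s\<close>.\<close>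
  define e where "e v = exch S v s - (if v \<in> N_in S s then 1 else 0)" for v
  have "yhat S indet s = (\<Prod>v\<in>vertices S. (if v \<in> N_in S s then indet v else 1) * indet v powi e v)"
    unfolding yhat_def e_def
    by (intro prod.cong) (auto simp: indet_nz power_int_diff)
  also have "\<dots> = (\<Prod>v\<in>vertices S. if v \<in> N_in S s then indet v else 1) * (\<Prod>v\<in>vertices S. indet v powi e v)"
    by (rule prod.distrib)
  also have "(\<Prod>v\<in>vertices S. if v \<in> N_in S s then indet v else 1) = (\<Prod>v\<in>vertices S \<inter> N_in S s. indet v)"
    using fin by (simp add: prod.inter_restrict)
  also have "vertices S \<inter> N_in S s = N_in S s" using N_in_subset[of S s] by (auto simp: vertices_def)
  finally have eq: "yhat S indet s = (\<Prod>v\<in>N_in S s. indet v) * (\<Prod>v\<in>vertices S. indet v powi e v)" .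
  have "(\<Prod>v\<in>vertices S. indet v powi e v) \<in> cluster_ring S"
  proof (rule cluster_ring_intros(9))
    fix v assume v: "v \<in> vertices S"
    show "indet v powi e v \<in> cluster_ring S"
    proof (cases "v \<in> frozen S")
      case True
      then show ?thesis by (intro cluster_ring_intros(10) cluster_ring_frozen)
    next
      case False
      then have "0 \<le> e v" using nonneg v by (auto simp: e_def N vertices_def)
      then show ?thesis using cluster_ring_indet[OF v] by (simp add: power_int_def cluster_ring_intros(7))
    qed
  qed
  then show "\<exists>q. q \<in> cluster_ring S \<and> yhat S indet s = (\<Prod>v\<in>N_in S s. indet v) * q" using eq by blast
  have sub: "ring_span (frozen_gens S) \<subseteq> cluster_ring S" unfolding cluster_ring_def
    by (rule ring_span_mono) (auto intro: ring_span_incl)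
  have "i \<in> frozen S" if "i \<in> vertices S" "exch S i s < 0" for i
    using that nonneg by (force simp: vertices_def)
  then show "neg_mon S indet s \<in> cluster_ring S" "inverse (neg_mon S indet s) \<in> cluster_ring S"
    using neg_mon_frozen[of S s] sub by auto
qed

text \<open>The open subsets \<open>x\<^sub>s \<noteq> 0\<close> and \<open>\<Prod>\<^sub>v x\<^sub>v \<noteq> 0\<close>, for \<open>v\<close> in \<open>N_in S s\<close>, cover the cluster variety, since
  \<open>x\<^sub>s x\<^sub>s'\<close> is a unit modulo the second product.\<close>

lemma sink_comaximal:
  assumes S: "is_seed S" and s: "is_sink S s"
  shows "\<exists>a b. a \<in> cluster_ring S \<and> b \<in> cluster_ring S \<and> a * indet s + b * (\<Prod>v\<in>N_in S s. indet v) = 1"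
proof -
  have sm: "s \<in> mutable S" using s by (simp add: is_sink_def)
  obtain q where q: "q \<in> cluster_ring S" "yhat S indet s = (\<Prod>v\<in>N_in S s. indet v) * q"
    using yhat_sink_divisible(1)[OF S s] by blast
  let ?u = "neg_mon S indet s" and ?x = "mutate_cluster s S indet s"
  have x: "?x \<in> cluster_ring S"
    using cluster_ring_mutable[OF reachable.step[OF reachable.initial sm]] sm by simp
  have "?x * indet s = ?u * (1 + yhat S indet s)"
    using exchange_sum_eq[of S indet s] indet_nz by (simp add: mutate_cluster_eq)
  then have "inverse ?u * ?x * indet s = 1 + yhat S indet s"
    using neg_mon_unit(3)[of S s] by (simp add: mult.assoc)
  then have "(inverse ?u * ?x) * indet s + (- q) * (\<Prod>v\<in>N_in S s. indet v) = 1"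
    unfolding q(2) by simp
  moreover have "inverse ?u * ?x \<in> cluster_ring S" "- q \<in> cluster_ring S"
    using yhat_sink_divisible(3)[OF S s] x q(1) by (auto intro: cluster_ring_intros)
  ultimately show ?thesis by blast
qed

text \<open>In the sink case an element of the upper bound lies in the cluster algebra with s frozen
  and in the one with \<open>N_in S s\<close> frozen. They are contained in the localizations at x_s
  and at the product over \<open>N_in S s\<close>, and these cover by
  \<open>sink_comaximal\<close>.\<close>

theorem sink_recurrent_upper_bound:
  assumes "sink_recurrent S" "is_seed S" "really_full_rank S"
  shows "upper_bound S \<subseteq> cluster_ring S"
  using assms
proof (induction rule: sink_recurrent.induct)
  case (discrete S)
  then show ?case using discrete_upper_bound by blast
next
  case (mutation S T)
  from mutation.hyps(2)[unfolded mutation_equivalent_def] mutation.prems mutation.IH show ?case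
  proof (induction rule: rtranclp_induct)
    case (step T T')
    then obtain k where k: "k \<in> mutable T" "T' = mutate k T" by blast
    have T: "T = mutate k T'" "k \<in> mutable T'" using k by simp_all
    have "is_seed T" "really_full_rank T"
      unfolding T(1) using is_seed_mutate really_full_rank_mutate step.prems T(2) by blast+
    then have "upper_bound T \<subseteq> cluster_ring T" using step by blast
    then show ?case
      using upper_bound_cluster_ring_mutate[OF step.prems(1,2) T(2)] T(1) by simp
  qed
next
  case (sink S s)
  have sm: "s \<in> mutable S" using sink.hyps(2) by (simp add: is_sink_def)
  note N = N_in_subset[of S s]
  let ?p = "\<Prod>v\<in>N_in S s. indet v"
  have U1: "upper_bound (freeze {s} S) \<subseteq> cluster_ring (freeze {s} S)"
    by (rule sink.IH(1)) (use sm sink.prems in \<open>simp_all add: is_seed_freeze really_full_rank_freeze\<close>)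
  have U2: "upper_bound (freeze (N_in S s \<union> {s}) S) \<subseteq> cluster_ring (freeze (N_in S s \<union> {s}) S)"
    by (rule sink.IH(2)) (use sm N sink.prems in \<open>simp_all add: is_seed_freeze really_full_rank_freeze\<close>)
  note iso = isolated_N_in[OF sink.hyps(1) sink.prems(2) sink.hyps(2) U2]
  show ?case
  proof
    fix f assume f: "f \<in> upper_bound S"
    have "f \<in> cluster_ring (freeze {s} S)" using upper_bound_freeze[of "{s}" S] sm f U1 by blast
    then obtain n where n: "(\<Prod>i\<in>{s}. indet i) ^ n * f \<in> cluster_ring S"
      using cluster_ring_freeze[of "{s}" S] sm sink.hyps(1) by blast
    have "f \<in> isolated_ring (freeze (N_in S s) S) s" using upper_bound_freeze[OF N] f iso(3) by blast
    then have "f \<in> cluster_ring (freeze (N_in S s) S)"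
      using isolated_ring_cluster_ring[OF is_seed_freeze[OF sink.hyps(1) N] iso(1)] by blast
    then obtain m where m: "?p ^ m * f \<in> cluster_ring S"
      using cluster_ring_freeze[OF N sink.hyps(1)] by blast
    obtain a b where ab: "a \<in> cluster_ring S" "b \<in> cluster_ring S" "a * indet s + b * ?p = 1"
      using sink_comaximal[OF sink.hyps(1,2)] by blast
    have "indet s \<in> cluster_ring S" "?p \<in> cluster_ring S"
      using sm N by (auto intro!: cluster_ring_intros(9) cluster_ring_indet simp: vertices_def)
    with ab n m show "f \<in> cluster_ring S" unfolding cluster_ring_def
      by (intro comaximal_descent[of "indet s" _ ?p a b n f m]) auto
  qed
qed

section \<open>Deletion at a sink\<close>

lemma prod_power_int: "(\<Prod>i\<in>A. h i) powi n = (\<Prod>i\<in>A. h i powi n)" for h :: "'b \<Rightarrow> 'c::field"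
  by (induction A rule: infinite_finite_induct) (simp_all add: power_int_mult_distrib)

lemma power_int_sum: "w \<noteq> 0 \<Longrightarrow> w powi (\<Sum>i\<in>A. e i) = (\<Prod>i\<in>A. w powi e i)" for w :: "'c::field"
  by (induction A rule: infinite_finite_induct) (simp_all add: power_int_add)

text \<open>Only entries between mutable vertices occur in this mutation rule. Therefore equality of
  the \<open>yhat\<close> of two seeds with the same mutable block is preserved under mutation,
  whatever their frozen rows.\<close>

lemma yhat_mutate:
  assumes T: "is_seed T" and kj: "k \<in> mutable T" "j \<in> mutable T" and x: "\<And>i. i \<in> vertices T \<Longrightarrow> x i \<noteq> 0"
  shows "yhat (mutate k T) (mutate_cluster k T x) j = (if j = k then inverse (yhat T x k)
    else yhat T x j * yhat T x k powi pos_part (exch T k j) * (1 + yhat T x k) powi (- exch T k j))"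
proof -
  define V where "V = vertices T - {k}"
  have fin: "finite (vertices T)" and k: "k \<in> vertices T" using seed_finite[OF T] seed_vertex kj by auto
  have split: "prod h (vertices T) = h k * prod h V" for h :: "nat \<Rightarrow> ratfun"
    using fin k by (simp add: V_def prod.remove)
  have diag: "exch T k k = 0" using seed_diag[OF T kj(1)] .
  define x' where "x' = mutate_cluster k T x"
  have x'V: "(\<Prod>i\<in>V. x' i powi e i) = (\<Prod>i\<in>V. x i powi e i)" for e
    by (intro prod.cong) (auto simp: x'_def mutate_cluster_eq V_def)
  have yk: "yhat T x k = (\<Prod>i\<in>V. x i powi exch T i k)" by (simp add: yhat_def split diag)
  have y': "yhat (mutate k T) x' j = x' k powi exch (mutate k T) k j * (\<Prod>i\<in>V. x i powi exch (mutate k T) i j)"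
    by (simp add: yhat_def split x'V)
  show ?thesis
  proof (cases "j = k")
    case True
    have "(\<Prod>i\<in>V. x i powi exch (mutate k T) i k) = inverse (\<Prod>i\<in>V. x i powi exch T i k)"
      by (simp add: exch_mutate power_int_minus prod_inversef[symmetric])
    then have "yhat (mutate k T) x' k = inverse (yhat T x k)"
      using y'[unfolded True] diag by (simp add: yk exch_mutate)
    then show ?thesis using True by (simp add: x'_def)
  next
    case False
    define m where "m = exch T k j"
    define nk where "nk = (\<Prod>i\<in>V. x i powi pos_part (- exch T i k))"
    have nz: "x i \<noteq> 0" if "i \<in> V" for i using x that by (auto simp: V_def)
    have nk_nz: "nk \<noteq> 0" unfolding nk_def using nz fin by (auto simp: V_def)
    have "neg_mon T x k = nk"
      using diag by (simp add: neg_mon_def split nk_def pos_part_def power_int_def)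
    then have x'k: "x' k = nk * (1 + yhat T x k) * inverse (x k)"
      using exchange_sum_eq[of T x k] x by (simp add: x'_def mutate_cluster_eq divide_inverse)
    \<comment> \<open>By \<open>exch_mutate'\<close> the exponent of x_i gains a multiple by m of
      the negative part in column k. These gains multiply to nk^m, which cancels against the power
      of nk contained in x_k'.\<close>
    have "x i powi exch (mutate k T) i j = x i powi exch T i j * (x i powi pos_part (- exch T i k)) powi m
        * (x i powi exch T i k) powi pos_part m" if "i \<in> V" for i
      using nz[OF that] that False
      by (simp add: exch_mutate' V_def m_def power_int_add flip: power_int_mult)
    then have "(\<Prod>i\<in>V. x i powi exch (mutate k T) i j)
        = (\<Prod>i\<in>V. x i powi exch T i j) * nk powi m * yhat T x k powi pos_part m"
      by (simp add: prod.distrib nk_def yk prod_power_int)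
    then have "yhat (mutate k T) x' j = x' k powi (- m) *
        ((\<Prod>i\<in>V. x i powi exch T i j) * nk powi m * yhat T x k powi pos_part m)"
      using False by (simp add: y' exch_mutate m_def)
    also have "x' k powi (- m) = inverse (nk powi m) * (1 + yhat T x k) powi (- m) * x k powi m"
      unfolding x'k power_int_mult_distrib by (simp add: power_int_minus power_int_inverse)
    also have "inverse (nk powi m) * (1 + yhat T x k) powi (- m) * x k powi m *
        ((\<Prod>i\<in>V. x i powi exch T i j) * nk powi m * yhat T x k powi pos_part m)
        = (inverse (nk powi m) * nk powi m) * ((x k powi m * (\<Prod>i\<in>V. x i powi exch T i j)) * yhat T x k powi pos_part m
            * (1 + yhat T x k) powi (- m))"
      by (simp only: mult_ac)
    also have "inverse (nk powi m) * nk powi m = 1" using nk_nz by simp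
    also have "x k powi m * (\<Prod>i\<in>V. x i powi exch T i j) = yhat T x j"
      by (simp add: yhat_def split m_def)
    finally show ?thesis using False by (simp add: x'_def m_def)
  qed
qed

lemma quotient_basis_kernel:
  "quotient_basis F \<chi> G \<pi> \<Longrightarrow> (\<forall>g\<in>G. (\<Sum>f\<in>F. \<pi> g f * v f) = 0) \<longleftrightarrow> (\<exists>d. \<forall>f\<in>F. v f = d * \<chi> f)"
  unfolding quotient_basis_def by (elim conjE) (erule allE)

lemma quotient_basis_projection:
  assumes "quotient_basis F \<chi> G \<pi>" "g \<in> G" shows "(\<Sum>f\<in>F. \<pi> g f * \<chi> f) = 0"
proof -
  have "\<exists>d. \<forall>f\<in>F. \<chi> f = d * \<chi> f" by (rule exI[of _ 1]) simp
  then show ?thesis using quotient_basis_kernel[OF assms(1)] assms(2) by blast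
qed

section \<open>The substitution comparing the deletion with the original seed\<close>

locale sink_deletion =
  fixes S D :: seed and s :: nat and \<pi> :: "nat \<Rightarrow> nat \<Rightarrow> int" and c :: "nat \<Rightarrow> int"
    and \<iota> :: "nat \<Rightarrow> nat \<Rightarrow> int" and a b l :: nat
  assumes S: "is_seed S" and rank: "really_full_rank S" and sink: "is_sink S s"
    and mutable_D: "mutable D = mutable S - N_in S s - {s}"
    and seed_D: "is_seed D"
    and exch_D: "\<And>i j. i \<in> mutable D \<Longrightarrow> j \<in> mutable D \<Longrightarrow> exch D i j = exch S i j"
    and exch_D_frozen: "\<And>g j. g \<in> frozen D \<Longrightarrow> j \<in> mutable D \<Longrightarrow>
      exch D g j = (\<Sum>f\<in>frozen S \<union> N_in S s. \<pi> g f * exch S f j)"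
    and quot: "quotient_basis (frozen S \<union> N_in S s) (\<lambda>f. exch S f s) (frozen D) \<pi>"
    and c_weight: "\<And>j. j \<in> mutable D \<union> {s} \<Longrightarrow>
      (\<Sum>i\<in>mutable D \<union> (frozen S \<union> N_in S s). c i * exch S i j) = (if j = s then 1 else 0)"
    and \<iota>_basis: "\<And>g g'. g \<in> frozen D \<Longrightarrow> g' \<in> frozen D \<Longrightarrow>
      (\<Sum>f\<in>frozen S \<union> N_in S s. \<pi> g' f * \<iota> g f) = (if g' = g then 1 else 0)"
    and \<iota>_weight: "\<And>g. g \<in> frozen D \<Longrightarrow> (\<Sum>f\<in>frozen S \<union> N_in S s. c f * \<iota> g f) = 0"
    and fresh: "a \<notin> vertices D" "b \<notin> vertices D" "a \<noteq> b" "\<And>i. i \<in> vertices S \<Longrightarrow> i < l"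
begin

abbreviation F where "F \<equiv> frozen S \<union> N_in S s"

lemma s_mutable: "s \<in> mutable S" and col_s: "v \<in> mutable S \<Longrightarrow> 0 \<le> exch S v s"
  using sink by (auto simp: is_sink_def)

lemma F_finite: "finite F" and D_finite: "finite (mutable D)" "finite (frozen D)"
  and M_F: "mutable D \<inter> F = {}" and s_F: "s \<notin> F" and s_D: "s \<notin> mutable D"
  and D_disjoint: "mutable D \<inter> frozen D = {}" and F_V: "F \<subseteq> vertices S"
proof -
  have S': "finite (mutable S)" "finite (frozen S)" "mutable S \<inter> frozen S = {}"
    and D': "finite (mutable D)" "finite (frozen D)" "mutable D \<inter> frozen D = {}"
    using S seed_D unfolding is_seed_def by blast+
  show "finite F" using S' N_in_subset[of S s] finite_subset by blast
  have "s \<notin> N_in S s" using seed_diag[OF S s_mutable] by (auto simp: N_in_def arrow_def)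
  then show "s \<notin> F" using S'(3) s_mutable by blast
  show "mutable D \<inter> F = {}" "s \<notin> mutable D" using S'(3) mutable_D by blast+
  show "F \<subseteq> vertices S" using N_in_subset[of S s] by (auto simp: vertices_def)
qed (use seed_D in \<open>auto simp: is_seed_def\<close>)

lemma vertices_S: "vertices S = insert s (mutable D \<union> F)"
  using mutable_D N_in_subset[of S s] s_mutable by (auto simp: vertices_def)

lemma col_s_zero: "i \<in> mutable D \<union> {s} \<Longrightarrow> exch S i s = 0"
  using col_s seed_diag[OF S s_mutable] s_mutable mutable_D by (force simp: N_in_def arrow_def)

lemma row_s_zero: "j \<in> mutable D \<union> {s} \<Longrightarrow> exch S s j = 0"
  using col_s_zero[of j] seed_zero[OF S s_mutable, of j] mutable_D s_mutable by auto

definition mon :: "(nat \<Rightarrow> int) \<Rightarrow> ratfun" where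
  "mon v = (\<Prod>f\<in>F. indet f powi v f)"

lemma mon_nz: "mon v \<noteq> 0"
  using F_finite by (simp add: mon_def indet_nz)

lemma mon_add: "mon (\<lambda>f. v f + w f) = mon v * mon w"
  by (simp add: mon_def power_int_add indet_nz prod.distrib)

lemma mon_uminus: "mon (\<lambda>f. - v f) = inverse (mon v)"
  by (simp add: mon_def power_int_minus prod_inversef[symmetric])

lemma mon_0: "mon (\<lambda>f. 0) = 1"
  by (simp add: mon_def)

lemma mon_scale: "mon (\<lambda>f. n * v f) = mon v powi n"
  by (simp add: mon_def prod_power_int mult.commute[of n] power_int_mult)

lemma mon_sum: "mon (\<lambda>f. \<Sum>g\<in>A. v g f) = (\<Prod>g\<in>A. mon (v g))"
  by (induction A rule: infinite_finite_induct) (simp_all add: mon_0 mon_add)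

lemma mon_cong: "(\<And>f. f \<in> F \<Longrightarrow> v f = w f) \<Longrightarrow> mon v = mon w"
  by (simp add: mon_def)

definition z :: ratfun where "z = mon (\<lambda>f. exch S f s)"

lemma z_eq: "yhat S indet s = z"
proof -
  have "yhat S indet s = (\<Prod>i\<in>mutable D \<union> {s}. indet i powi exch S i s) * z"
    unfolding yhat_def vertices_S z_def mon_def
    using F_finite D_finite M_F s_F s_D by (simp add: prod.union_disjoint)
  also have "(\<Prod>i\<in>mutable D \<union> {s}. indet i powi exch S i s) = 1"
    by (intro prod.neutral) (use col_s_zero in auto)
  finally show ?thesis by simp
qed

lemma z_nz: "z \<noteq> 0" "1 + z \<noteq> 0"
  using mon_nz yhat_indet_nz[of S s] by (auto simp: z_def z_eq)

definition y :: ratfun where "y = (1 + z) / indet s"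

lemma z_y: "indet s * y - 1 = z"
  by (simp add: y_def indet_nz)

lemma weight_chi: "(\<Sum>f\<in>F. c f * exch S f s) = 1"
proof -
  have "(\<Sum>i\<in>mutable D \<union> F. c i * exch S i s) = (\<Sum>i\<in>mutable D. c i * exch S i s) + (\<Sum>i\<in>F. c i * exch S i s)"
    using F_finite D_finite M_F by (simp add: sum.union_disjoint)
  also have "(\<Sum>i\<in>mutable D. c i * exch S i s) = 0"
    by (intro sum.neutral) (use col_s_zero in auto)
  finally show ?thesis using c_weight[of s] by simp
qed

lemmas proj_kernel = quotient_basis_kernel[OF quot]
  and proj_chi = quotient_basis_projection[OF quot]

text \<open>The exponent lattice is the direct sum of the lifts \<iota> g and of the column of s,
  with coordinates \<pi> and c. Once the lifts are subtracted, the rest is killed by \<pi>, hence a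
  multiple of that column, and c determines the multiple.\<close>

lemma split_lattice:
  assumes "f \<in> F"
  shows "v f = (\<Sum>g\<in>frozen D. (\<Sum>f\<in>F. \<pi> g f * v f) * \<iota> g f) + (\<Sum>f\<in>F. c f * v f) * exch S f s"
proof -
  let ?p = "\<lambda>g. \<Sum>f\<in>F. \<pi> g f * v f"
  define u where "u f = v f - (\<Sum>g\<in>frozen D. ?p g * \<iota> g f)" for f
  have lin: "(\<Sum>f\<in>F. w f * u f) = (\<Sum>f\<in>F. w f * v f) - (\<Sum>g\<in>frozen D. ?p g * (\<Sum>f\<in>F. w f * \<iota> g f))" for w
  proof -
    have "(\<Sum>f\<in>F. w f * (\<Sum>g\<in>frozen D. ?p g * \<iota> g f)) = (\<Sum>g\<in>frozen D. ?p g * (\<Sum>f\<in>F. w f * \<iota> g f))"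
      unfolding sum_distrib_left by (subst sum.swap) (simp add: mult_ac)
    then show ?thesis by (simp add: u_def right_diff_distrib sum_subtractf)
  qed
  have "(\<Sum>f\<in>F. \<pi> h f * u f) = 0" if h: "h \<in> frozen D" for h
  proof -
    have "(\<Sum>g\<in>frozen D. ?p g * (\<Sum>f\<in>F. \<pi> h f * \<iota> g f)) = (\<Sum>g\<in>frozen D. if g = h then ?p g else 0)"
      by (intro sum.cong) (auto simp: \<iota>_basis h)
    then show ?thesis using h D_finite(2) by (simp add: lin)
  qed
  then obtain d where d: "\<And>f. f \<in> F \<Longrightarrow> u f = d * exch S f s"
    using proj_kernel[of u] by blast
  have "(\<Sum>f\<in>F. c f * u f) = (\<Sum>f\<in>F. c f * v f)" by (simp add: lin \<iota>_weight)
  moreover have "(\<Sum>f\<in>F. c f * u f) = d * (\<Sum>f\<in>F. c f * exch S f s)"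
    unfolding sum_distrib_left by (intro sum.cong) (auto simp: d)
  ultimately have "d = (\<Sum>f\<in>F. c f * v f)" using weight_chi by simp
  then show ?thesis using d[OF assms] by (simp add: u_def)
qed

text \<open>The values of \<theta>: mutable variables are twisted by a power of z to degree zero,
  frozen ones become the monomials of the lifts, a and b become x_s and y. The remaining variables
  are shifted by l beyond those of S.\<close>

definition target :: "nat \<Rightarrow> ratfun" where
  "target i = (if i \<in> mutable D then indet i * z powi (- c i)
     else if i \<in> frozen D then mon (\<iota> i)
     else if i = a then indet s else if i = b then y else indet (i + l))"

text \<open>A left inverse of the substitution \<open>target\<close>, with z going to x_a x_b - 1 as
  dictated by z = x_s y - 1. It is what \<open>substitution_exists\<close> requires to extend
  \<open>target\<close> to the field.\<close>

definition retr :: "nat \<Rightarrow> ratfun" where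
  "retr i = (if i \<in> mutable D then indet i * (indet a * indet b - 1) powi c i
     else if i \<in> F then (indet a * indet b - 1) powi c i * (\<Prod>g\<in>frozen D. indet g powi \<pi> g i)
     else if i = s then indet a else if l \<le> i then indet (i - l) else indet i)"

text \<open>The product of the two variables has degree one in the first, so it is not 1.\<close>

lemma ab_nz: "indet a * indet b - 1 \<noteq> 0"
proof
  let ?c = "\<lambda>i. if i = a then 1 else 0 :: int"
  assume "indet a * indet b - 1 = 0"
  then have "indet a * indet b = 1" by simp
  moreover have "indet a * indet b \<in> homog ?c 1"
    using homog_mult[OF homog_indet[of a ?c] homog_indet[of b ?c]] fresh(3) by simp
  ultimately show False using two_powi_inj[of 1 0] by (simp add: homog_def scale_simps)
qed

lemma retr_F: "f \<in> F \<Longrightarrow> retr f = (indet a * indet b - 1) powi c f * (\<Prod>g\<in>frozen D. indet g powi \<pi> g f)"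
  using M_F by (auto simp: retr_def)

lemma retr_mon: "subst_rel retr (mon v) ((indet a * indet b - 1) powi (\<Sum>f\<in>F. c f * v f) *
    (\<Prod>g\<in>frozen D. indet g powi (\<Sum>f\<in>F. \<pi> g f * v f)))"
proof -
  have nz: "retr f \<noteq> 0" if "f \<in> F" for f
    using that ab_nz D_finite(2) by (simp add: retr_F indet_nz)
  have "subst_rel retr (mon v) (\<Prod>f\<in>F. retr f powi v f)"
    unfolding mon_def by (intro subst_rel_prod subst_rel_power_int subst_rel_indet nz)
  also have "(\<Prod>f\<in>F. retr f powi v f) = (\<Prod>f\<in>F. (indet a * indet b - 1) powi (c f * v f) *
      (\<Prod>g\<in>frozen D. indet g powi (\<pi> g f * v f)))"
    by (intro prod.cong) (simp_all add: retr_F power_int_mult_distrib prod_power_int power_int_mult)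
  also have "\<dots> = (\<Prod>f\<in>F. (indet a * indet b - 1) powi (c f * v f)) *
      (\<Prod>g\<in>frozen D. \<Prod>f\<in>F. indet g powi (\<pi> g f * v f))"
    unfolding prod.distrib by (subst prod.swap) simp
  also have "(\<Prod>f\<in>F. (indet a * indet b - 1) powi (c f * v f)) = (indet a * indet b - 1) powi (\<Sum>f\<in>F. c f * v f)"
    using ab_nz F_finite by (simp add: power_int_sum)
  also have "(\<Prod>g\<in>frozen D. \<Prod>f\<in>F. indet g powi (\<pi> g f * v f)) = (\<Prod>g\<in>frozen D. indet g powi (\<Sum>f\<in>F. \<pi> g f * v f))"
    using indet_nz F_finite by (simp add: power_int_sum)
  finally show ?thesis .
qed

lemma retr_z: "subst_rel retr z (indet a * indet b - 1)"
  using retr_mon[of "\<lambda>f. exch S f s"] by (simp add: z_def weight_chi proj_chi)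

lemma retr_target: "subst_rel retr (target i) (indet i)"
proof -
  consider "i \<in> mutable D" | "i \<in> frozen D" | "i = a" | "i = b" | "i \<notin> vertices D" "i \<noteq> a" "i \<noteq> b"
    by (auto simp: vertices_def)
  then show ?thesis
  proof cases
    case 1
    have "subst_rel retr (indet i * z powi (- c i)) (retr i * (indet a * indet b - 1) powi (- c i))"
      by (intro subst_rel_mult subst_rel_power_int subst_rel_indet retr_z ab_nz)
    then show ?thesis using 1 ab_nz by (simp add: target_def retr_def mult.assoc flip: power_int_add)
  next
    case 2
    have "(\<Prod>g\<in>frozen D. indet g powi (\<Sum>f\<in>F. \<pi> g f * \<iota> i f)) = (\<Prod>g\<in>frozen D. if g = i then indet g else 1)"
      by (intro prod.cong) (auto simp: \<iota>_basis 2)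
    then show ?thesis using 2 retr_mon[of "\<iota> i"] D_disjoint D_finite(2) by (auto simp: target_def \<iota>_weight)
  next
    case 3
    have "retr s = indet a" using s_D s_F by (simp add: retr_def)
    then show ?thesis using 3 fresh subst_rel_indet[of retr s] by (simp add: target_def vertices_def)
  next
    case 4
    have bs: "retr s = indet a" using s_D s_F by (simp add: retr_def)
    have "subst_rel retr y ((1 + (indet a * indet b - 1)) / retr s)"
      unfolding y_def using bs indet_nz
      by (intro subst_rel_divide subst_rel_add subst_rel_1 retr_z subst_rel_indet) auto
    then show ?thesis using 4 fresh bs indet_nz[of a] by (simp add: target_def vertices_def)
  next
    case 5
    have "retr (i + l) = indet i"
      using fresh(4)[of "i + l"] vertices_S by (auto simp: retr_def)
    then show ?thesis using 5 subst_rel_indet[of retr "i + l"] by (simp add: target_def vertices_def)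
  qed
qed

definition \<theta> :: "ratfun \<Rightarrow> ratfun" where
  "\<theta> = (SOME h. field_hom h \<and> (\<forall>i. h (indet i) = target i))"

lemma \<theta>: "field_hom \<theta>" "\<theta> (indet i) = target i"
proof -
  obtain h where "field_hom h" "\<And>i. h (indet i) = target i"
    using substitution_exists[of retr target, OF retr_target] by blast
  then have "\<exists>h. field_hom h \<and> (\<forall>i. h (indet i) = target i)" by blast
  from someI_ex[OF this] show "field_hom \<theta>" "\<theta> (indet i) = target i" unfolding \<theta>_def by auto
qed

lemmas \<theta>_simps = field_hom_simps[OF \<theta>(1)]

lemma \<theta>_indet: "i \<in> mutable D \<Longrightarrow> \<theta> (indet i) = indet i * z powi (- c i)"
  "g \<in> frozen D \<Longrightarrow> \<theta> (indet g) = mon (\<iota> g)" "\<theta> (indet a) = indet s" "\<theta> (indet b) = y"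
  using D_disjoint fresh by (auto simp: \<theta> target_def vertices_def)

lemma mon_split: "mon v = \<theta> (\<Prod>g\<in>frozen D. indet g powi (\<Sum>f\<in>F. \<pi> g f * v f)) * z powi (\<Sum>f\<in>F. c f * v f)"
proof -
  have "mon v = mon (\<lambda>f. (\<Sum>g\<in>frozen D. (\<Sum>f\<in>F. \<pi> g f * v f) * \<iota> g f) + (\<Sum>f\<in>F. c f * v f) * exch S f s)"
    by (intro mon_cong split_lattice)
  also have "\<dots> = (\<Prod>g\<in>frozen D. mon (\<iota> g) powi (\<Sum>f\<in>F. \<pi> g f * v f)) * z powi (\<Sum>f\<in>F. c f * v f)"
    by (simp only: mon_add mon_sum mon_scale z_def)
  also have "(\<Prod>g\<in>frozen D. mon (\<iota> g) powi (\<Sum>f\<in>F. \<pi> g f * v f))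
      = \<theta> (\<Prod>g\<in>frozen D. indet g powi (\<Sum>f\<in>F. \<pi> g f * v f))"
    by (simp add: \<theta>_simps \<theta>_indet)
  finally show ?thesis .
qed

section \<open>Matching the seeds of the deletion with those of S0\<close>

definition S0 :: seed where "S0 = freeze (N_in S s \<union> {s}) S"

lemma S0: "is_seed S0" "mutable S0 = mutable D" "frozen S0 = F \<union> {s}" "vertices S0 = vertices S" "exch S0 = exch S"
proof -
  have "N_in S s \<union> {s} \<subseteq> mutable S" using N_in_subset s_mutable by auto
  then show "is_seed S0" "vertices S0 = vertices S"
    unfolding S0_def using is_seed_freeze[OF S] vertices_freeze by auto
qed (auto simp: S0_def mutable_D)

text \<open>Corresponding seeds of \<open>D\<close> and of \<open>S0\<close>: the cluster variables agree up to frozen Laurent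
  monomials, and the variables \<open>yhat\<close> agree exactly. This determines the frozen rows, whose entries
  are not related linearly after a mutation.\<close>

definition corr :: "seed \<Rightarrow> (nat \<Rightarrow> ratfun) \<Rightarrow> seed \<Rightarrow> (nat \<Rightarrow> ratfun) \<Rightarrow> bool" where
  "corr TD xD T x \<longleftrightarrow> reachable D TD xD \<and> reachable S0 T x \<and>
     (\<forall>i\<in>mutable D. \<forall>j\<in>mutable D. exch TD i j = exch T i j) \<and> (\<forall>j\<in>mutable D. exch T s j = 0) \<and>
     (\<forall>i\<in>mutable D. \<exists>v. x i = mon v * \<theta> (xD i)) \<and> (\<forall>j\<in>mutable D. yhat T x j = \<theta> (yhat TD xD j))"

lemma prod_vertices_S: "(\<Prod>i\<in>vertices S. h i) = h s * ((\<Prod>i\<in>mutable D. h i) * (\<Prod>i\<in>F. h i))" for h :: "nat \<Rightarrow> ratfun"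
  unfolding vertices_S using F_finite D_finite M_F s_F s_D by (simp add: prod.union_disjoint)

lemma prod_vertices_D: "(\<Prod>i\<in>vertices D. h i) = (\<Prod>i\<in>mutable D. h i) * (\<Prod>i\<in>frozen D. h i)" for h :: "nat \<Rightarrow> ratfun"
  unfolding vertices_def using D_finite D_disjoint by (simp add: prod.union_disjoint)

lemma corr_initial: "corr D indet S0 indet"
proof -
  have "\<exists>v. indet i = mon v * \<theta> (indet i)" if "i \<in> mutable D" for i
    using that z_nz by (intro exI[of _ "\<lambda>f. c i * exch S f s"])
      (simp add: mon_scale \<theta>_indet z_def[symmetric] power_int_minus)
  moreover have "yhat S0 indet j = \<theta> (yhat D indet j)" if j: "j \<in> mutable D" for j
  proof -
    let ?M = "\<Prod>i\<in>mutable D. indet i powi exch S i j"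
    have sj: "exch S s j = 0" using row_s_zero j by auto
    have "yhat S0 indet j = ?M * mon (\<lambda>f. exch S f j)"
      by (simp add: yhat_def S0 prod_vertices_S mon_def sj)
    also have "mon (\<lambda>f. exch S f j) = \<theta> (\<Prod>g\<in>frozen D. indet g powi exch D g j) * z powi (\<Sum>f\<in>F. c f * exch S f j)"
      by (subst mon_split) (simp add: exch_D_frozen j)
    also have "(\<Sum>f\<in>F. c f * exch S f j) = - (\<Sum>i\<in>mutable D. c i * exch S i j)"
    proof -
      have "j \<noteq> s" using j s_D by blast
      then show ?thesis using c_weight[of j] j F_finite D_finite(1) M_F by (simp add: sum.union_disjoint)
    qed
    also have "z powi (- (\<Sum>i\<in>mutable D. c i * exch S i j)) = (\<Prod>i\<in>mutable D. z powi (- c i * exch S i j))"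
      using z_nz D_finite by (simp add: power_int_sum flip: sum_negf)
    also have "?M * (\<theta> (\<Prod>g\<in>frozen D. indet g powi exch D g j) * (\<Prod>i\<in>mutable D. z powi (- c i * exch S i j)))
        = (\<Prod>i\<in>mutable D. (indet i * z powi (- c i)) powi exch S i j) * \<theta> (\<Prod>g\<in>frozen D. indet g powi exch D g j)"
      by (simp add: power_int_mult_distrib prod.distrib mult_ac flip: power_int_mult)
    also have "\<dots> = \<theta> (yhat D indet j)"
      by (simp add: yhat_def prod_vertices_D \<theta>_simps \<theta>_indet exch_D j)
    finally show ?thesis .
  qed
  ultimately show ?thesis
    using reachable.initial row_s_zero by (auto simp: corr_def S0 exch_D)
qed

text \<open>Equality of the \<open>yhat\<close> is carried over by \<open>yhat_mutate\<close>. The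
  new variable is \<open>neg_mon\<close> (1 + \<open>yhat\<close>) / x_k: the middle factors agree
  under \<theta>, while \<open>neg_mon\<close> and x_k differ from their counterparts by frozen
  monomials only.\<close>

lemma corr_step:
  assumes corr: "corr TD xD T x" and k: "k \<in> mutable D"
  shows "corr (mutate k TD) (mutate_cluster k TD xD) (mutate k T) (mutate_cluster k T x)"
proof -
  from corr have reach: "reachable D TD xD" "reachable S0 T x"
    and E: "\<And>i j. i \<in> mutable D \<Longrightarrow> j \<in> mutable D \<Longrightarrow> exch TD i j = exch T i j"
    and row: "\<And>j. j \<in> mutable D \<Longrightarrow> exch T s j = 0"
    and x: "\<And>i. i \<in> mutable D \<Longrightarrow> \<exists>v. x i = mon v * \<theta> (xD i)"
    and yh: "\<And>j. j \<in> mutable D \<Longrightarrow> yhat T x j = \<theta> (yhat TD xD j)"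
    by (auto simp: corr_def)
  note TD = reachable_seed[OF seed_D reach(1)] and T = reachable_seed[OF S0(1) reach(2), unfolded S0]
  note nzD = reachable_nz[OF seed_D reach(1)] and nz = reachable_nz[OF S0(1) reach(2)]
  have x_F: "x f = indet f" if "f \<in> F" for f
    using reachable_fixed[OF S0(1) reach(2)] M_F that by (auto simp: S0)
  have xD_G: "xD g = indet g" if "g \<in> frozen D" for g
    using reachable_fixed[OF seed_D reach(1)] D_disjoint that by auto
  have E': "exch (mutate k TD) i j = exch (mutate k T) i j" if "i \<in> mutable D" "j \<in> mutable D" for i j
    using that k by (simp add: exch_mutate E)
  have row': "exch (mutate k T) s j = 0" if "j \<in> mutable D" for j
    using that k row s_D by (auto simp: exch_mutate pos_part_def)
  have yh': "yhat (mutate k T) (mutate_cluster k T x) j = \<theta> (yhat (mutate k TD) (mutate_cluster k TD xD) j)"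
    if j: "j \<in> mutable D" for j
  proof -
    have kj: "k \<in> mutable T" "j \<in> mutable T" "k \<in> mutable TD" "j \<in> mutable TD" using k j T TD by auto
    show ?thesis
      unfolding yhat_mutate[OF T(1) kj(1,2) nz(1)] yhat_mutate[OF TD(1) kj(3,4) nzD(1)]
      using j k by (simp add: \<theta>_simps yh E)
  qed
  have "\<exists>v. mutate_cluster k T x k = mon v * \<theta> (mutate_cluster k TD xD k)"
  proof -
    obtain V where V: "\<And>i. i \<in> mutable D \<Longrightarrow> x i = mon (V i) * \<theta> (xD i)" using x by metis
    let ?e = "\<lambda>i. pos_part (- exch T i k)" and ?d = "\<lambda>i. pos_part (- exch TD i k)"
    have pow: "w ^ nat (pos_part e) = w powi pos_part e" for w :: ratfun and e
      by (simp add: power_int_def pos_part_def)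
    define P where "P = (\<Prod>i\<in>mutable D. \<theta> (xD i) powi ?e i)"
    have "neg_mon T x k = (\<Prod>i\<in>mutable D. x i powi ?e i) * mon ?e"
      unfolding neg_mon_def T(2) prod_vertices_S pow using row[OF k] x_F by (simp add: mon_def pos_part_def)
    also have "(\<Prod>i\<in>mutable D. x i powi ?e i) = (\<Prod>i\<in>mutable D. mon (\<lambda>f. ?e i * V i f)) * P"
      unfolding P_def by (simp add: V power_int_mult_distrib prod.distrib mon_scale)
    also have "(\<Prod>i\<in>mutable D. mon (\<lambda>f. ?e i * V i f)) = mon (\<lambda>f. \<Sum>i\<in>mutable D. ?e i * V i f)"
      by (rule mon_sum[symmetric])
    finally obtain v1 where v1: "neg_mon T x k = mon v1 * P"
      using mon_add by (metis (no_types, lifting) mult.assoc mult.commute)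
    have "\<theta> (neg_mon TD xD k) = P * (\<Prod>g\<in>frozen D. mon (\<iota> g) powi ?d g)"
      unfolding neg_mon_def TD(2) prod_vertices_D pow P_def
      using k by (simp add: \<theta>_simps \<theta>_indet xD_G E)
    also have "(\<Prod>g\<in>frozen D. mon (\<iota> g) powi ?d g) = mon (\<lambda>f. \<Sum>g\<in>frozen D. ?d g * \<iota> g f)"
      by (simp add: mon_sum mon_scale)
    finally obtain v2 where v2: "\<theta> (neg_mon TD xD k) = P * mon v2" by blast
    have "mutate_cluster k T x k = neg_mon T x k * (1 + yhat T x k) / x k"
      using exchange_sum_eq[of T x k] nz by (simp add: mutate_cluster_eq)
    moreover have "\<theta> (mutate_cluster k TD xD k) = \<theta> (neg_mon TD xD k) * (1 + yhat T x k) / \<theta> (xD k)"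
      using exchange_sum_eq[of TD xD k] nzD k by (simp add: mutate_cluster_eq \<theta>_simps yh)
    ultimately have "mutate_cluster k T x k = mon v1 * inverse (mon v2) * inverse (mon (V k)) * \<theta> (mutate_cluster k TD xD k)"
    proof -
      assume 1: "mutate_cluster k T x k = neg_mon T x k * (1 + yhat T x k) / x k"
        and 2: "\<theta> (mutate_cluster k TD xD k) = \<theta> (neg_mon TD xD k) * (1 + yhat T x k) / \<theta> (xD k)"
      have "mon v1 * inverse (mon v2) * inverse (mon (V k)) * (P * mon v2 * (1 + yhat T x k) / \<theta> (xD k))
          = (inverse (mon v2) * mon v2) * (mon v1 * P * (1 + yhat T x k) / (mon (V k) * \<theta> (xD k)))"
        by (simp only: divide_inverse inverse_mult_distrib mult_ac)
      then show ?thesis unfolding 1 2 v1 v2 V[OF k] using mon_nz[of v2] by simp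
    qed
    also have "mon v1 * inverse (mon v2) * inverse (mon (V k)) = mon (\<lambda>f. v1 f + - v2 f + - V k f)"
      by (simp only: mon_add mon_uminus)
    finally show ?thesis by blast
  qed
  then have "\<exists>v. mutate_cluster k T x i = mon v * \<theta> (mutate_cluster k TD xD i)" if "i \<in> mutable D" for i
    using x that by (cases "i = k") (auto simp: mutate_cluster_eq)
  then show ?thesis unfolding corr_def
    using reach TD(3) T(3) k E' row' yh' by (auto intro: reachable.step)
qed

lemma corr_D: "reachable D TD xD \<Longrightarrow> \<exists>T x. corr TD xD T x"
proof (induction rule: reachable.induct)
  case (step TD xD k)
  then show ?case using corr_step reachable_seed(3)[OF seed_D step.hyps(1)] by blast
qed (use corr_initial in blast)

lemma corr_S0: "reachable S0 T x \<Longrightarrow> \<exists>TD xD. corr TD xD T x"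
proof (induction rule: reachable.induct)
  case (step T x k)
  then show ?case using corr_step reachable_seed(3)[OF S0(1) step.hyps(1)] S0(2) by blast
qed (use corr_initial in blast)

end

lemma cring_ring_span: "cring ((ring_of_type_algebra :: ratfun ring)\<lparr>carrier := ring_span G\<rparr>)"
proof (intro cringI abelian_groupI comm_monoidI)
  fix x assume "x \<in> carrier ((ring_of_type_algebra :: ratfun ring)\<lparr>carrier := ring_span G\<rparr>)"
  then show "\<exists>y\<in>carrier ((ring_of_type_algebra :: ratfun ring)\<lparr>carrier := ring_span G\<rparr>).
      y \<oplus>\<^bsub>ring_of_type_algebra\<lparr>carrier := ring_span G\<rparr>\<^esub> x = \<zero>\<^bsub>ring_of_type_algebra\<lparr>carrier := ring_span G\<rparr>\<^esub>"
    by (intro bexI[of _ "- x"]) (auto intro: ring_span_minus)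
qed (auto simp: algebra_simps intro: ring_span_intros)

lemma finsum_type_algebra:
  "finite I \<Longrightarrow> finsum (ring_of_type_algebra :: ratfun ring) f I = sum f I"
proof -
  interpret K: cring "ring_of_type_algebra :: ratfun ring" by (rule cring_from_type_algebra)
  show "finite I \<Longrightarrow> ?thesis"
    by (induction I rule: finite_induct) (simp_all add: K.finsum_insert)
qed

lemma nat_pow_type_algebra: "x [^]\<^bsub>(ring_of_type_algebra :: ratfun ring)\<^esub> (n::nat) = x ^ n"
proof -
  interpret K: cring "ring_of_type_algebra :: ratfun ring" by (rule cring_from_type_algebra)
  show ?thesis by (induction n) (simp_all add: mult.commute)
qed

text \<open>Modulo x the element x y - 1 is -1. With x = x_s this makes z, and every factor of z,
  invertible modulo x_s.\<close>

lemma power_expand: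
  assumes "x \<in> ring_span G" "y \<in> ring_span G"
  shows "\<exists>h\<in>ring_span G. (x * y - 1) ^ n = (- 1) ^ n + x * h"
proof (induction n)
  case 0
  show ?case by (rule bexI[of _ 0]) (simp_all add: ring_span_0)
next
  case (Suc n)
  then obtain h where h: "h \<in> ring_span G" "(x * y - 1) ^ n = (- 1) ^ n + x * h" by blast
  have "(x * y - 1) ^ Suc n = (- 1) ^ Suc n + x * (y * ((- 1) ^ n + x * h) - h)"
    by (simp add: h(2) algebra_simps)
  moreover have "y * ((- 1) ^ n + x * h) - h \<in> ring_span G"
    by (intro ring_span_intros assms h)
  ultimately show ?case by blast
qed

lemma neg_one_power_unit: "(- 1) ^ n * ((- 1) ^ n * x) = x" for x :: ratfun
  by (simp add: mult.assoc[symmetric] flip: power_mult_distrib)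

section \<open>The fibre at x_s of the cluster algebra, of A' and of the deletion\<close>

locale sink_deletion_recurrent = sink_deletion +
  assumes recurrent: "sink_recurrent (freeze (N_in S s \<union> {s}) S)"
begin

abbreviation T0 where "T0 \<equiv> freeze (N_in S s) S"
abbreviation A' where "A' \<equiv> isolated_ring T0 s"
abbreviation C where "C \<equiv> \<theta> ` cluster_ring D"

lemmas A'_intros = ring_span_intros[where G = "core_gens T0 s \<union> {indet s, mutate_cluster s T0 indet s}",
  folded isolated_ring_def]

lemma corr_unit: "corr TD xD T x \<Longrightarrow> i \<in> mutable D \<Longrightarrow> \<exists>v. x i = mon v * \<theta> (xD i)"
  unfolding corr_def by blast

lemma S0_eq: "freeze {s} T0 = S0"
  by (simp add: S0_def freeze_freeze)

lemma frozen_T0: "frozen T0 = F"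
  by simp

text \<open>The Laurent phenomenon puts the cluster algebra into the upper bound of S, which is
  contained in that of T0, where s is isolated. Sink-recurrence enters through T0 with s
  frozen.\<close>

lemma cluster_ring_A': "cluster_ring S \<subseteq> A'"
proof -
  have sub: "N_in S s \<union> {s} \<subseteq> mutable S" using N_in_subset s_mutable by auto
  have "upper_bound (freeze (N_in S s \<union> {s}) S) \<subseteq> cluster_ring (freeze (N_in S s \<union> {s}) S)"
    by (rule sink_recurrent_upper_bound[OF recurrent is_seed_freeze[OF S sub] really_full_rank_freeze[OF rank sub]])
  from isolated_N_in(3)[OF S rank sink this] show ?thesis
    using cluster_ring_upper_bound[OF S rank] upper_bound_freeze[OF N_in_subset] by blast
qed

lemma A'_localized: "x \<in> A' \<Longrightarrow> \<exists>n. (\<Prod>v\<in>N_in S s. indet v) ^ n * x \<in> cluster_ring S"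
proof -
  assume x: "x \<in> A'"
  have "s \<in> mutable T0" using s_mutable s_F by simp
  then have "x \<in> cluster_ring T0"
    using x isolated_ring_cluster_ring[OF is_seed_freeze[OF S N_in_subset]] by blast
  then show ?thesis by (rule cluster_ring_freeze[OF N_in_subset S])
qed

definition u :: ratfun where "u = mon (\<lambda>f. pos_part (- exch S f s))"

lemma neg_mon_u: "neg_mon S indet s = u"
proof -
  have "neg_mon S indet s = indet s ^ nat (pos_part (- exch S s s)) *
      ((\<Prod>i\<in>mutable D. indet i ^ nat (pos_part (- exch S i s))) * (\<Prod>i\<in>F. indet i ^ nat (pos_part (- exch S i s))))"
    unfolding neg_mon_def by (rule prod_vertices_S)
  also have "(\<Prod>i\<in>mutable D. indet i ^ nat (pos_part (- exch S i s))) = 1"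
    by (intro prod.neutral) (use col_s_zero in \<open>auto simp: pos_part_def\<close>)
  also have "(\<Prod>i\<in>F. indet i ^ nat (pos_part (- exch S i s))) = u"
    unfolding u_def mon_def by (intro prod.cong) (auto simp: power_int_def pos_part_def)
  finally show ?thesis using col_s_zero[of s] by (simp add: pos_part_def)
qed

lemma exchange_s: "mutate_cluster s S indet s = u * y" "mutate_cluster s T0 indet s = u * y"
proof -
  show "mutate_cluster s S indet s = u * y"
    using exchange_sum_eq[of S indet s] indet_nz by (simp add: mutate_cluster_eq neg_mon_u z_eq y_def)
  then show "mutate_cluster s T0 indet s = u * y"
    by (simp add: mutate_cluster_def vertices_freeze[OF N_in_subset])
qed

lemma mon_frozen: "mon v \<in> ring_span (frozen_gens T0)"
  unfolding mon_def frozen_gens_def frozen_T0 by (rule frozen_monomial) auto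

lemma mon_A': "mon v \<in> A'"
proof -
  have "ring_span (frozen_gens T0) \<subseteq> A'" unfolding isolated_ring_def
    by (rule ring_span_mono) (auto simp: core_gens_def intro: ring_span_incl)
  then show ?thesis using mon_frozen by blast
qed

lemma xs_A': "indet s \<in> A'" and y_A': "y \<in> A'" and z_A': "z \<in> A'" "inverse z \<in> A'"
proof -
  show "indet s \<in> A'" unfolding isolated_ring_def by (rule ring_span_incl) simp
  have "u * y \<in> A'" unfolding isolated_ring_def by (rule ring_span_incl) (simp add: exchange_s)
  moreover have "inverse u \<in> A'" unfolding u_def mon_uminus[symmetric] by (rule mon_A')
  ultimately have "inverse u * (u * y) \<in> A'" by (rule A'_intros(4)[rotated])
  then show "y \<in> A'" using mon_nz by (simp add: u_def mult.assoc[symmetric])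
  show "z \<in> A'" "inverse z \<in> A'" unfolding z_def mon_uminus[symmetric] by (rule mon_A')+
qed

lemma y_cluster: "y \<in> cluster_ring S"
proof -
  have "mutate_cluster s S indet s \<in> cluster_ring S"
    using cluster_ring_mutable[OF reachable.step[OF reachable.initial s_mutable]] s_mutable by simp
  then have "inverse u * (u * y) \<in> cluster_ring S"
    using yhat_sink_divisible(3)[OF S sink] unfolding exchange_s neg_mon_u
    by (rule cluster_ring_intros(4)[rotated])
  then show ?thesis using mon_nz by (simp add: u_def mult.assoc[symmetric])
qed

text \<open>A cluster variable of D corresponds to one of S0 up to a frozen monomial, and frozen
  monomials are units of A'.\<close>

lemma \<theta>_A': "d \<in> cluster_ring D \<Longrightarrow> \<theta> d \<in> A'"
  unfolding cluster_ring_def isolated_ring_def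
proof (erule field_hom_ring_span[OF \<theta>(1)], fold isolated_ring_def)
  fix x assume "x \<in> cluster_variables D \<union> frozen_gens D"
  then show "\<theta> x \<in> A'"
  proof
    assume "x \<in> cluster_variables D"
    then obtain TD xD i where TD: "reachable D TD xD" "i \<in> mutable TD" "x = xD i" by (auto simp: cluster_variables_def)
    have i: "i \<in> mutable D" using reachable_seed(3)[OF seed_D TD(1)] TD(2) by simp
    obtain T xx where T: "corr TD xD T xx" using corr_D[OF TD(1)] by blast
    then obtain v where v: "xx i = mon v * \<theta> (xD i)" using corr_unit i by blast
    have "reachable S0 T xx" using T by (simp add: corr_def)
    moreover have "i \<in> mutable T" using reachable_seed(3)[OF S0(1) calculation] i S0 by simp
    ultimately have "xx i \<in> cluster_variables S0" by (auto simp: cluster_variables_def)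
    then have "xx i \<in> A'" unfolding isolated_ring_def core_gens_def S0_eq by (intro ring_span_incl) simp
    then have "mon (\<lambda>f. - v f) * xx i \<in> A'" by (intro A'_intros mon_A')
    then show ?thesis using mon_nz[of v] by (simp add: v TD(3) mon_uminus mult.assoc[symmetric])
  next
    assume "x \<in> frozen_gens D"
    then obtain g where "g \<in> frozen D" "x = indet g \<or> x = inverse (indet g)" by (auto simp: frozen_gens_def)
    then have "\<theta> x = mon (\<iota> g) \<or> \<theta> x = mon (\<lambda>f. - \<iota> g f)"
      by (auto simp: \<theta>_simps \<theta>_indet mon_uminus)
    then show ?thesis using mon_A' by auto
  qed
qed

text \<open>Cluster variables of S0 are images of those of D up to frozen monomials, and by
  \<open>mon_split\<close> a frozen monomial is an element of C times a power of z. As z = x_s y - 1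
  is already present, only its inverse is adjoined.\<close>

lemma A'_gens: "A' \<subseteq> ring_span (C \<union> {indet s, y} \<union> {inverse z})"
proof -
  define R where "R = ring_span (C \<union> {indet s, y} \<union> {inverse z})"
  note R_intros = ring_span_intros[where G = "C \<union> {indet s, y} \<union> {inverse z}", folded R_def]
  have gens: "indet s \<in> R" "y \<in> R" "inverse z \<in> R" and C: "\<And>d. d \<in> cluster_ring D \<Longrightarrow> \<theta> d \<in> R"
    unfolding R_def by (auto intro: ring_span_incl)
  have "indet s * y - 1 \<in> R" by (intro R_intros gens)
  then have z: "z \<in> R" by (simp add: z_y)
  have mon: "mon v \<in> R" for v
  proof -
    have "(\<Prod>g\<in>frozen D. indet g powi (\<Sum>f\<in>F. \<pi> g f * v f)) \<in> cluster_ring D"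
      by (intro cluster_ring_intros cluster_ring_frozen)
    then show ?thesis unfolding mon_split[of v] by (intro R_intros C z gens)
  qed
  have "x \<in> R" if "x \<in> core_gens T0 s \<union> {indet s, mutate_cluster s T0 indet s}" for x
  proof -
    consider "x \<in> cluster_variables S0" | "x \<in> frozen_gens T0" | "x = indet s" | "x = u * y"
      using \<open>x \<in> _\<close> unfolding core_gens_def S0_eq exchange_s by blast
    then show ?thesis
    proof cases
      case 1
      then obtain T xx i where T: "reachable S0 T xx" "i \<in> mutable T" "x = xx i" by (auto simp: cluster_variables_def)
      have i: "i \<in> mutable D" using reachable_seed(3)[OF S0(1) T(1)] T(2) S0 by simp
      obtain TD xD where TD: "corr TD xD T xx" using corr_S0[OF T(1)] by blast
      then obtain v where v: "xx i = mon v * \<theta> (xD i)" using corr_unit i by blast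
      have reach: "reachable D TD xD" using TD by (simp add: corr_def)
      have "xD i \<in> cluster_ring D"
        by (rule cluster_ring_mutable[OF reach]) (use reachable_seed(3)[OF seed_D reach] i in simp)
      then show ?thesis unfolding T(3) v by (intro R_intros mon C)
    next
      case 2
      then obtain f where f: "f \<in> F" "x = indet f \<or> x = inverse (indet f)" unfolding frozen_gens_def frozen_T0 by blast
      define v where "v i = (if i = f then 1 else 0 :: int)" for i
      have "mon v = (\<Prod>i\<in>F. if i = f then indet i else 1)" unfolding mon_def v_def by (intro prod.cong) auto
      also have "\<dots> = indet f" using f(1) F_finite by simp
      finally have "x = mon v \<or> x = mon (\<lambda>i. - v i)" using f(2) by (auto simp: mon_uminus)
      then show ?thesis using mon by blast
    next
      case 3 then show ?thesis using gens by simp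
    next
      case 4 then show ?thesis unfolding u_def by (simp only:) (intro R_intros gens mon)
    qed
  qed
  then show ?thesis unfolding isolated_ring_def R_def by (intro ring_span_mono) blast
qed

text \<open>Modulo \<open>x\<^sub>s\<close>, the unit \<open>z = x\<^sub>s y - 1\<close> becomes \<open>-1\<close>.\<close>

lemma A'_mod_xs:
  assumes "x \<in> A'" shows "\<exists>e\<in>ring_span (C \<union> {y}). \<exists>w\<in>A'. x = e + indet s * w"
proof -
  have Cy: "e \<in> A'" if "e \<in> ring_span (C \<union> {y})" for e
  proof -
    have "ring_span (C \<union> {y}) \<subseteq> A'" unfolding isolated_ring_def
      by (rule ring_span_mono, fold isolated_ring_def) (use \<theta>_A' y_A' in auto)
    then show ?thesis using that by blast
  qed
  have "x \<in> ring_span (C \<union> {indet s, y} \<union> {inverse z})" using assms A'_gens by blast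
  then show ?thesis
  proof (induction rule: ring_span_induct)
    case (incl x)
    then consider "x \<in> C \<union> {y}" | "x = indet s" | "x = inverse z" by blast
    then show ?case
    proof cases
      case 1
      then have "x \<in> ring_span (C \<union> {y})" by (rule ring_span_incl)
      then show ?thesis by (intro bexI[of _ x] bexI[of _ 0]) (auto intro: A'_intros)
    next
      case 2
      then show ?thesis by (intro bexI[of _ 0] bexI[of _ 1]) (auto intro: A'_intros ring_span_0)
    next
      case 3
      have "inverse z * (indet s * y - 1) = 1" using z_nz by (simp add: z_y)
      then have "x = - 1 + indet s * (y * inverse z)" by (simp add: 3 algebra_simps)
      moreover have "y * inverse z \<in> A'" by (intro A'_intros y_A' z_A')
      moreover have "- 1 \<in> ring_span (C \<union> {y})" by (intro ring_span_intros)
      ultimately show ?thesis by blast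
    qed
  next
    case one
    show ?case by (intro bexI[of _ 1] bexI[of _ 0]) (auto intro: A'_intros ring_span_1)
  next
    case (minus x)
    then obtain e w where "e \<in> ring_span (C \<union> {y})" "w \<in> A'" "x = e + indet s * w" by blast
    then show ?case by (intro bexI[of _ "- e"] bexI[of _ "- w"]) (auto intro: A'_intros ring_span_minus)
  next
    case (add x x')
    then obtain e w e' w' where *: "e \<in> ring_span (C \<union> {y})" "w \<in> A'" "x = e + indet s * w"
      "e' \<in> ring_span (C \<union> {y})" "w' \<in> A'" "x' = e' + indet s * w'" by blast
    then have "x + x' = (e + e') + indet s * (w + w')" by (simp add: algebra_simps)
    then show ?case using * by (blast intro: A'_intros ring_span_add)
  next
    case (mult x x')
    then obtain e w e' w' where *: "e \<in> ring_span (C \<union> {y})" "w \<in> A'" "x = e + indet s * w"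
      "e' \<in> ring_span (C \<union> {y})" "w' \<in> A'" "x' = e' + indet s * w'" by blast
    then have "x * x' = e * e' + indet s * (e * w' + w * e' + indet s * (w * w'))" by (simp add: algebra_simps)
    moreover have "e * w' + w * e' + indet s * (w * w') \<in> A'" by (intro A'_intros * Cy xs_A')
    moreover have "e * e' \<in> ring_span (C \<union> {y})" by (intro ring_span_mult *)
    ultimately show ?case by blast
  qed
qed

lemma cluster_ring_D_fixed:
  assumes h: "field_hom h" "\<And>i. i \<in> vertices D \<Longrightarrow> h (indet i) = indet i" and d: "d \<in> cluster_ring D"
  shows "h d = d"
  using d unfolding cluster_ring_def
proof (induction rule: ring_span_induct)
  case (incl x)
  then show ?case
  proof
    assume "x \<in> cluster_variables D"
    then obtain TD xD i where TD: "reachable D TD xD" "i \<in> mutable TD" "x = xD i" by (auto simp: cluster_variables_def)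
    have "\<forall>i\<in>vertices D. h (xD i) = xD i" using TD(1)
    proof induction
      case (step T x k)
      note T = reachable_seed[OF seed_D step.hyps(1)]
      have eq: "pos_mon T (\<lambda>i. h (x i)) k = pos_mon T x k" "neg_mon T (\<lambda>i. h (x i)) k = neg_mon T x k"
        by (rule pos_mon_cong neg_mon_cong, metis T(2) step.IH)+
      have "h (x k) = x k" using step T by (simp add: vertices_def)
      then show ?case using step.IH
        by (simp add: mutate_cluster_eq field_hom_simps[OF h(1)] field_hom_pos_mon[OF h(1)] field_hom_neg_mon[OF h(1)] eq)
    qed (use h in auto)
    then show ?thesis using TD reachable_seed(3)[OF seed_D TD(1)] by (simp add: vertices_def)
  next
    assume "x \<in> frozen_gens D"
    then show ?thesis using h by (auto simp: frozen_gens_def vertices_def field_hom_inverse[OF h(1)])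
  qed
qed (simp_all add: field_hom_simps[OF h(1)])

text \<open>After powers of z are cleared, the relation is pulled back along \<theta> to the
  variables of D, a and b. There x_a x_b - 1 is -1 modulo x_a, so the polynomial R is x_a times an
  element without negative degrees in x_a, although R has degree zero; hence R = 0. The degree in
  x_b then separates its coefficients. So y is transcendental over C, and C[y] meets x_s A' in
  zero.\<close>

lemma polynomial_independent:
  assumes r: "\<And>i. i \<le> n \<Longrightarrow> r i \<in> cluster_ring D"
    and eq: "(\<Sum>i\<le>n. \<theta> (r i) * y ^ i) = indet s * w" and w: "w \<in> A'" and i: "i \<le> n"
  shows "r i = 0"
proof -
  define G where "G = cluster_ring D \<union> {indet a, indet b}"
  have ga: "indet a \<in> ring_span G" "indet b \<in> ring_span G" by (auto simp: G_def intro: ring_span_incl)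
  have rG: "r i \<in> ring_span G" if "i \<le> n" for i using r[OF that] by (auto simp: G_def intro: ring_span_incl)
  have img: "\<exists>g\<in>ring_span G. x = \<theta> g" if "x \<in> ring_span (C \<union> {indet s, y})" for x
    using that
  proof (induction rule: ring_span_induct)
    case (incl x)
    then consider d where "d \<in> cluster_ring D" "x = \<theta> d" | "x = \<theta> (indet a)" | "x = \<theta> (indet b)"
      by (auto simp: \<theta>_indet)
    then show ?case using ga by cases (auto simp: G_def intro: ring_span_incl)
  next
    case one show ?case by (rule bexI[of _ 1]) (auto simp: \<theta>_simps intro: ring_span_1)
  next
    case (minus x) then show ?case by (metis \<theta>_simps(5) ring_span_minus)
  next
    case (add x x') then show ?case by (metis \<theta>_simps(3) ring_span_add)
  next
    case (mult x x') then show ?case by (metis \<theta>_simps(4) ring_span_mult)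
  qed
  have z_span: "z \<in> ring_span (C \<union> {indet s, y})"
  proof -
    have "indet s * y - 1 \<in> ring_span (C \<union> {indet s, y})"
      by (intro ring_span_diff ring_span_mult ring_span_1 ring_span_incl) auto
    then show ?thesis by (simp add: z_y)
  qed
  have "\<exists>m. z ^ m * w \<in> ring_span (C \<union> {indet s, y})"
  proof (rule ring_span_localize[OF subsetD[OF A'_gens w] z_span])
    fix x assume "x \<in> C \<union> {indet s, y} \<union> {inverse z}"
    then consider "x \<in> C \<union> {indet s, y}" | "x = inverse z" by blast
    then show "\<exists>m. z ^ m * x \<in> ring_span (C \<union> {indet s, y})"
    proof cases
      case 1 then show ?thesis by (intro exI[of _ 0]) (auto intro: ring_span_incl)
    next
      case 2 then show ?thesis using z_nz by (intro exI[of _ 1]) (simp add: ring_span_1)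
    qed
  qed
  then obtain m g where g: "g \<in> ring_span G" "z ^ m * w = \<theta> g" using img by blast
  define R where "R = (\<Sum>i\<le>n. r i * indet b ^ i)"
  have z_\<theta>: "z = \<theta> (indet a * indet b - 1)" by (simp add: \<theta>_simps \<theta>_indet z_y)
  have "\<theta> ((indet a * indet b - 1) ^ m * R) = z ^ m * (\<Sum>i\<le>n. \<theta> (r i) * y ^ i)"
    by (simp add: R_def \<theta>_simps \<theta>_indet z_y)
  also have "\<dots> = \<theta> (indet a * g)"
    unfolding eq by (simp add: \<theta>_simps \<theta>_indet g(2)[symmetric] mult.left_commute)
  finally have eq1: "(indet a * indet b - 1) ^ m * R = indet a * g" by (rule iffD1[OF field_hom_inj[OF \<theta>(1)]])
  obtain h where h: "h \<in> ring_span G" "(indet a * indet b - 1) ^ m = (- 1) ^ m + indet a * h"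
    using power_expand[OF ga] by blast
  have R: "R \<in> ring_span G" unfolding R_def by (intro ring_span_sum ring_span_mult ring_span_power ga rG) simp
  define g' where "g' = (- 1) ^ m * (g - h * R)"
  have g': "g' \<in> ring_span G" unfolding g'_def by (intro ring_span_intros g h R)
  have "(- 1) ^ m * R = indet a * (g - h * R)" using eq1 unfolding h(2) by (simp add: algebra_simps)
  then have "(- 1) ^ m * ((- 1) ^ m * R) = indet a * g'" by (simp add: g'_def mult.left_commute)
  then have R_eq: "R = indet a * g'" unfolding neg_one_power_unit .
  define \<alpha> where "\<alpha> i = (if i = a then 1 else 0 :: int)" for i
  define \<beta> where "\<beta> i = (if i = b then 1 else 0 :: int)" for i
  have fixed: "d \<in> homog \<alpha> 0" "d \<in> homog \<beta> 0" if "d \<in> cluster_ring D" for d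
  proof -
    have "i \<noteq> a \<and> i \<noteq> b" if "i \<in> vertices D" for i using that fresh by blast
    then have "scale \<alpha> (indet i) = indet i" "scale \<beta> (indet i) = indet i" if "i \<in> vertices D" for i
      using that by (simp_all add: scale \<alpha>_def \<beta>_def)
    then show "d \<in> homog \<alpha> 0" "d \<in> homog \<beta> 0"
      using cluster_ring_D_fixed[OF scale(1) _ that] by (simp_all add: homog_def)
  qed
  have b\<alpha>: "indet b \<in> homog \<alpha> 0" and a\<alpha>: "indet a \<in> homog \<alpha> 1" and b\<beta>: "indet b \<in> homog \<beta> 1"
    using homog_indet[of b \<alpha>] homog_indet[of a \<alpha>] homog_indet[of b \<beta>] fresh(3) by (auto simp: \<alpha>_def \<beta>_def)
  have R0: "R \<in> homog \<alpha> 0"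
  proof -
    have "r i * indet b ^ i \<in> homog \<alpha> 0" if "i \<le> n" for i
      using homog_mult[OF fixed(1)[OF r[OF that]] homog_power[OF b\<alpha>, of i]] by simp
    then have "(\<Sum>i\<in>I. r i * indet b ^ i) \<in> homog \<alpha> 0" if "I \<subseteq> {..n}" for I
      using that by (induction I rule: infinite_finite_induct) (auto simp: homog_0 homog_add)
    then show ?thesis unfolding R_def by blast
  qed
  \<comment> \<open>The generators have degree 0 or 1 in x_a, so g' has no component of degree -1,
    the only one that multiplication by x_a would bring to degree zero.\<close>
  have "g' \<in> graded_sum (\<lambda>d. if 0 \<le> d then homog \<alpha> d else {0})"
  proof (rule ring_span_graded_sum[OF _ _ _ _ _ _ g'])
    fix x assume "x \<in> G"
    then consider "x \<in> cluster_ring D" | "x = indet a" | "x = indet b" by (auto simp: G_def)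
    then show "\<exists>d. x \<in> (if 0 \<le> d then homog \<alpha> d else {0})"
      using fixed(1) a\<alpha> b\<alpha> by cases (auto intro: exI[of _ 0] exI[of _ 1])
  qed (auto simp: homog_0 homog_1 homog_add homog_minus homog_mult split: if_splits)
  then obtain I p where I: "finite I" "\<And>d. d \<in> I \<Longrightarrow> p d \<in> (if 0 \<le> d then homog \<alpha> d else {0})" "g' = sum p I"
    by (rule graded_sumE) blast
  have R_sum: "sum (\<lambda>_. R) {0} = sum (\<lambda>d. indet a * p (d - 1)) ((\<lambda>d. d + 1) ` I)"
    by (simp add: R_eq I(3) sum_distrib_left sum.reindex inj_on_def)
  have "(if (0::int) \<in> {0} then R else 0) = (if (0::int) \<in> (\<lambda>d. d + 1) ` I then indet a * p (0 - 1) else 0)"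
  proof (rule homog_components_unique[OF _ _ _ _ R_sum])
    show "indet a * p (d - 1) \<in> homog \<alpha> d" if "d \<in> (\<lambda>d. d + 1) ` I" for d
    proof -
      from that obtain e where e: "e \<in> I" "d = e + 1" by blast
      have "p e \<in> homog \<alpha> e" using I(2)[OF e(1)] homog_0 by (auto split: if_splits)
      from homog_mult[OF a\<alpha> this] show ?thesis by (simp add: e(2) add.commute)
    qed
  qed (use R0 I(1) in auto)
  also have "\<dots> = 0"
  proof -
    have "p (0 - 1) = 0" if "(0::int) \<in> (\<lambda>d. d + 1) ` I"
    proof -
      from that obtain d where "d \<in> I" "d + 1 = 0" by (metis imageE)
      then have "- 1 \<in> I" by (metis add_eq_0_iff2)
      from I(2)[OF this] show ?thesis by simp
    qed
    then show ?thesis by simp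
  qed
  finally have "R = 0" by simp
  define q where "q d = r (nat d) * indet b ^ nat d" for d :: int
  have "sum q (int ` {..n}) = R"
    by (simp add: R_def q_def sum.reindex)
  then have "sum q (int ` {..n}) = 0" using \<open>R = 0\<close> by simp
  moreover have "q d \<in> homog \<beta> d" if "d \<in> int ` {..n}" for d
  proof -
    from that obtain i where i: "i \<le> n" "d = int i" by auto
    show ?thesis using homog_mult[OF fixed(2)[OF r[OF i(1)]] homog_power[OF b\<beta>, of i]] by (simp add: i(2) q_def)
  qed
  ultimately have "\<forall>d\<in>int ` {..n}. q d = 0" by (intro homog_independent[of _ _ \<beta>]) auto
  then have "q (int i) = 0" using i by auto
  then show ?thesis by (simp add: q_def indet_nz)
qed

lemma sink_relation: "\<exists>q\<in>cluster_ring S. (\<Prod>v\<in>N_in S s. indet v) * q = indet s * y - 1"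
  using yhat_sink_divisible(1)[OF S sink] by (auto simp: z_eq z_y)

text \<open>With p the product over \<open>N_in S s\<close>, the relation p q = x_s y - 1 makes p
  invertible modulo x_s already in the cluster algebra A, so clearing powers of p costs nothing
  there. The two parts say that A / x_s A maps onto A' / x_s A' and does so injectively.\<close>

lemma A'_cluster_ring:
  assumes w: "w \<in> A'"
  shows "\<exists>x\<in>cluster_ring S. \<exists>v\<in>A'. w = x + indet s * v"
    and "indet s * w \<in> cluster_ring S \<Longrightarrow> w \<in> cluster_ring S"
proof -
  let ?p = "\<Prod>v\<in>N_in S s. indet v"
  obtain q where q: "q \<in> cluster_ring S" "?p * q = indet s * y - 1" using sink_relation by blast
  obtain n where n: "?p ^ n * w \<in> cluster_ring S" using A'_localized[OF w] by blast
  have xs: "indet s \<in> cluster_ring S" using s_mutable by (simp add: cluster_ring_indet vertices_def)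
  obtain h where h: "h \<in> cluster_ring S" "(indet s * y - 1) ^ n = (- 1) ^ n + indet s * h"
    using power_expand[of "indet s" "cluster_variables S \<union> frozen_gens S" y n] xs y_cluster
    unfolding cluster_ring_def by blast
  \<comment> \<open>p^n w lies in the cluster algebra, and multiplying it by q^n and the sign gives
    w back modulo x_s.\<close>
  let ?x = "(- 1) ^ n * (q ^ n * (?p ^ n * w))"
  have x: "?x \<in> cluster_ring S" by (intro cluster_ring_intros q n)
  have "q ^ n * (?p ^ n * w) = (indet s * y - 1) ^ n * w"
    by (simp add: q(2)[symmetric] power_mult_distrib mult_ac)
  also have "\<dots> = (- 1) ^ n * w + indet s * (h * w)" unfolding h(2) by (simp add: algebra_simps)
  finally have "?x = (- 1) ^ n * ((- 1) ^ n * w + indet s * (h * w))" by simp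
  also have "\<dots> = w + (- 1) ^ n * (indet s * (h * w))"
    unfolding distrib_left neg_one_power_unit ..
  finally have eq: "w = ?x + indet s * (- ((- 1) ^ n * (h * w)))" by (simp add: mult_ac)
  have "- ((- 1) ^ n * (h * w)) \<in> A'" using h cluster_ring_A' w by (intro A'_intros) auto
  then show "\<exists>x\<in>cluster_ring S. \<exists>v\<in>A'. w = x + indet s * v" using eq x by blast
  assume sw: "indet s * w \<in> cluster_ring S"
  have "w = ?x - (- 1) ^ n * (h * (indet s * w))" by (subst eq) (simp add: mult_ac)
  also have "\<dots> \<in> cluster_ring S" by (intro cluster_ring_intros x h sw)
  finally show "w \<in> cluster_ring S" .
qed

text \<open>E f is the polynomial whose value at y, with coefficients mapped by \<theta>, is
  congruent to f modulo x_s A'. It exists by \<open>A'_mod_xs\<close> and is unique by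
  \<open>polynomial_independent\<close>; uniqueness makes E a homomorphism. The two parts of
  \<open>A'_cluster_ring\<close> yield surjectivity and the kernel.\<close>

lemma fiber_map:
  obtains E where "E \<in> ring_hom (cluster_algebra S) (UP (cluster_algebra D))"
    "E ` carrier (cluster_algebra S) = carrier (UP (cluster_algebra D))"
    "\<And>f. f \<in> carrier (cluster_algebra S) \<Longrightarrow> E f = \<zero>\<^bsub>UP (cluster_algebra D)\<^esub> \<Longrightarrow> f \<in> PIdl\<^bsub>cluster_algebra S\<^esub> (indet s)"
    "E (indet s) = \<zero>\<^bsub>UP (cluster_algebra D)\<^esub>"
proof -
  define AD where "AD = cluster_algebra D"
  define P where "P = UP AD"
  let ?K = "ring_of_type_algebra :: ratfun ring"
  have AD: "cring AD" unfolding AD_def cluster_algebra_eq cluster_ring_def by (rule cring_ring_span)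
  have AD_simps: "carrier AD = cluster_ring D" "monoid.mult AD = (*)" "add AD = (+)" "\<one>\<^bsub>AD\<^esub> = 1" "\<zero>\<^bsub>AD\<^esub> = 0"
    by (simp_all add: AD_def cluster_algebra_eq)
  have \<theta>_hom: "\<theta> \<in> ring_hom AD ?K"
    by (rule ring_hom_memI) (simp_all add: AD_simps \<theta>_simps)
  interpret U: UP_pre_univ_prop AD ?K \<theta> P
    unfolding P_def by (intro UP_pre_univ_propI AD cring_from_type_algebra \<theta>_hom)
  define ev where "ev = eval AD ?K \<theta> y"
  have ev: "ev \<in> ring_hom P ?K" unfolding ev_def by (rule U.eval_ring_hom) simp
  have ev_simps: "ev (p \<oplus>\<^bsub>P\<^esub> q) = ev p + ev q" "ev (p \<otimes>\<^bsub>P\<^esub> q) = ev p * ev q" "ev \<one>\<^bsub>P\<^esub> = 1"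
    if "p \<in> carrier P" "q \<in> carrier P" for p q
    using ring_hom_memE[OF ev] that by simp_all
  have ev_one: "ev \<one>\<^bsub>P\<^esub> = 1" using ring_hom_memE(4)[OF ev] by simp
  have ev_zero: "ev \<zero>\<^bsub>P\<^esub> = 0"
  proof -
    have "ev \<zero>\<^bsub>P\<^esub> + ev \<zero>\<^bsub>P\<^esub> = ev \<zero>\<^bsub>P\<^esub> + 0" using ev_simps(1)[of "\<zero>\<^bsub>P\<^esub>" "\<zero>\<^bsub>P\<^esub>"] by simp
    then show ?thesis by (simp only: add_left_cancel)
  qed
  have ev_minus: "ev (\<ominus>\<^bsub>P\<^esub> p) = - ev p" if "p \<in> carrier P" for p
  proof -
    have "ev (\<ominus>\<^bsub>P\<^esub> p \<oplus>\<^bsub>P\<^esub> p) = ev \<zero>\<^bsub>P\<^esub>" using that by (simp add: U.P.l_neg)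
    then show ?thesis using that by (simp add: ev_zero ev_simps eq_neg_iff_add_eq_0)
  qed
  have coeff: "up_ring.coeff P p i \<in> cluster_ring D" if "p \<in> carrier P" for p i
    using U.coeff_closed[OF that] by (simp add: AD_simps)
  have ev_eq: "ev p = (\<Sum>i\<le>deg AD p. \<theta> (up_ring.coeff P p i) * y ^ i)" if "p \<in> carrier P" for p
    unfolding ev_def using that by (simp add: U.eval_on_carrier finsum_type_algebra nat_pow_type_algebra)
  have ev_A': "ev p \<in> A'" if "p \<in> carrier P" for p
    unfolding ev_eq[OF that] by (intro A'_intros \<theta>_A' coeff that y_A')
  have ev_inj: "p = q" if pq: "p \<in> carrier P" "q \<in> carrier P" and w: "ev p - ev q = indet s * w" "w \<in> A'" for p q w
  proof -
    let ?d = "p \<ominus>\<^bsub>P\<^esub> q"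
    have d: "?d \<in> carrier P" using pq by simp
    have "ev ?d = indet s * w" using pq w(1) by (simp add: U.P.minus_eq ev_simps ev_minus)
    then have eq: "(\<Sum>i\<le>deg AD ?d. \<theta> (up_ring.coeff P ?d i) * y ^ i) = indet s * w" by (simp add: ev_eq[OF d])
    have "up_ring.coeff P ?d i = up_ring.coeff P \<zero>\<^bsub>P\<^esub> i" for i
    proof (cases "i \<le> deg AD ?d")
      case True
      then have "up_ring.coeff P ?d i = 0" using polynomial_independent[OF _ eq w(2) True] coeff[OF d] by blast
      then show ?thesis by (simp add: AD_simps)
    next
      case False
      then show ?thesis using U.deg_aboveD[OF _ d, of i] by simp
    qed
    then have "?d = \<zero>\<^bsub>P\<^esub>" by (intro U.up_eqI d) simp_all
    then show ?thesis using pq by (simp add: U.P.r_right_minus_eq)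
  qed
  have ev_surj: "\<exists>p\<in>carrier P. ev p = e" if "e \<in> ring_span (C \<union> {y})" for e
    using that
  proof (induction rule: ring_span_induct)
    case (incl x)
    then consider d where "d \<in> cluster_ring D" "x = \<theta> d" | "x = y" by blast
    then show ?case
    proof cases
      case 1
      then show ?thesis
        using U.eval_const[of y d] U.monom_closed[of d 0] by (intro bexI[of _ "up_ring.monom P d 0"]) (simp_all add: ev_def AD_simps)
    next
      case 2
      then show ?thesis
        using U.eval_monom1[of y] U.monom_closed[OF U.R.one_closed, of 1]
        by (intro bexI[of _ "up_ring.monom P \<one>\<^bsub>AD\<^esub> 1"]) (simp_all add: ev_def)
    qed
  next
    case one show ?case by (rule bexI[of _ "\<one>\<^bsub>P\<^esub>"]) (simp_all add: ev_one)
  next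
    case (minus x) then show ?case by (metis ev_minus U.P.a_inv_closed)
  next
    case (add x x') then show ?case by (metis ev_simps(1) U.P.a_closed)
  next
    case (mult x x') then show ?case by (metis ev_simps(2) U.P.m_closed)
  qed
  define E where "E f = (THE p. p \<in> carrier P \<and> (\<exists>w\<in>A'. f - ev p = indet s * w))" for f
  have E_eq: "E f = p" if "p \<in> carrier P" "w \<in> A'" "f - ev p = indet s * w" for f p w
    unfolding E_def
  proof (rule the_equality)
    show "p \<in> carrier P \<and> (\<exists>w\<in>A'. f - ev p = indet s * w)" using that by blast
    fix q assume "q \<in> carrier P \<and> (\<exists>w\<in>A'. f - ev q = indet s * w)"
    then obtain v where v: "q \<in> carrier P" "v \<in> A'" "f - ev q = indet s * v" by blast
    have "ev q - ev p = indet s * (w - v)" using that(3) v(3) by (simp add: algebra_simps)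
    then show "q = p" using ev_inj[of q p "w - v"] v(1) that(1,2) v(2) by (blast intro: A'_intros)
  qed
  have E_spec: "E f \<in> carrier P" "\<exists>w\<in>A'. f - ev (E f) = indet s * w" if "f \<in> cluster_ring S" for f
  proof -
    obtain e w where e: "e \<in> ring_span (C \<union> {y})" "w \<in> A'" "f = e + indet s * w"
      using A'_mod_xs[of f] cluster_ring_A' \<open>f \<in> _\<close> by blast
    obtain p where p: "p \<in> carrier P" "ev p = e" using ev_surj[OF e(1)] by blast
    have "f - ev p = indet s * w" by (simp add: e(3) p(2))
    moreover from E_eq[OF p(1) e(2) this] have "E f = p" .
    ultimately show "E f \<in> carrier P" "\<exists>w\<in>A'. f - ev (E f) = indet s * w" using p e(2) by auto
  qed
  let ?A = "cluster_algebra S"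
  have A_simps: "carrier ?A = cluster_ring S" "monoid.mult ?A = (*)" "add ?A = (+)" "\<one>\<^bsub>?A\<^esub> = 1"
    by (simp_all add: cluster_algebra_eq)
  have E_hom: "E \<in> ring_hom ?A P"
  proof (rule ring_hom_memI)
    fix f g assume "f \<in> carrier ?A" "g \<in> carrier ?A"
    then have fg: "f \<in> cluster_ring S" "g \<in> cluster_ring S" by (simp_all add: A_simps)
    obtain v w where v: "v \<in> A'" "f - ev (E f) = indet s * v" and w: "w \<in> A'" "g - ev (E g) = indet s * w"
      using E_spec(2)[OF fg(1)] E_spec(2)[OF fg(2)] by blast
    note c = E_spec(1)[OF fg(1)] E_spec(1)[OF fg(2)]
    have "f * g - ev (E f \<otimes>\<^bsub>P\<^esub> E g) = (f - ev (E f)) * g + ev (E f) * (g - ev (E g))"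
      by (simp add: ev_simps c algebra_simps)
    also have "\<dots> = indet s * (v * g + ev (E f) * w)" unfolding v(2) w(2) by (simp add: algebra_simps)
    finally show "E (f \<otimes>\<^bsub>?A\<^esub> g) = E f \<otimes>\<^bsub>P\<^esub> E g"
      using cluster_ring_A' fg v(1) w(1) c ev_A'
      by (intro E_eq[of _ "v * g + ev (E f) * w"]) (auto simp: A_simps intro!: A'_intros)
    have "f + g - ev (E f \<oplus>\<^bsub>P\<^esub> E g) = (f - ev (E f)) + (g - ev (E g))"
      by (simp add: ev_simps c algebra_simps)
    also have "\<dots> = indet s * (v + w)" unfolding v(2) w(2) by (simp add: algebra_simps)
    finally show "E (f \<oplus>\<^bsub>?A\<^esub> g) = E f \<oplus>\<^bsub>P\<^esub> E g"
      using v(1) w(1) c by (intro E_eq[of _ "v + w"]) (auto simp: A_simps intro!: A'_intros)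
  next
    show "E \<one>\<^bsub>?A\<^esub> = \<one>\<^bsub>P\<^esub>"
      by (rule E_eq[of _ 0]) (simp_all add: A_simps ev_one A'_intros)
  qed (simp add: A_simps E_spec)
  show ?thesis
  proof (rule that[of E, folded AD_def, folded P_def])
    show "E \<in> ring_hom ?A P" by (rule E_hom)
    show "E ` carrier ?A = carrier P"
    proof (intro equalityI subsetI)
      fix p assume p: "p \<in> carrier P"
      obtain x v where x: "x \<in> cluster_ring S" "v \<in> A'" "ev p = x + indet s * v"
        using A'_cluster_ring(1)[OF ev_A'[OF p]] by blast
      have "x - ev p = indet s * (- v)" by (simp add: x(3))
      then have "E x = p" using E_eq[OF p _ , of "- v" x] x(2) by (simp add: A'_intros)
      then show "p \<in> E ` carrier ?A" using x(1) by (auto simp: A_simps)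
    qed (auto simp: A_simps E_spec)
    show "E (indet s) = \<zero>\<^bsub>P\<^esub>"
      by (rule E_eq[of _ 1]) (simp_all add: ev_zero A'_intros)
    fix f assume f: "f \<in> carrier ?A" "E f = \<zero>\<^bsub>P\<^esub>"
    then obtain w where w: "w \<in> A'" "f = indet s * w" using E_spec(2)[of f] by (auto simp: A_simps ev_zero)
    have "w \<in> cluster_ring S" using A'_cluster_ring(2)[OF w(1)] f(1) w(2) by (simp add: A_simps)
    then show "f \<in> PIdl\<^bsub>?A\<^esub> (indet s)" unfolding cgenideal_def w(2) by (auto simp: A_simps mult.commute)
  qed
qed

end

lemma sink_deletion_exists:
  assumes S: "is_seed S" and rank: "really_full_rank S" and sink: "is_sink S s" and D: "is_deletion S s D"
  shows "\<exists>\<pi> c \<iota> a b l. sink_deletion S D s \<pi> c \<iota> a b l"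
proof -
  let ?F = "frozen S \<union> N_in S s"
  have sm: "s \<in> mutable S" using sink by (simp add: is_sink_def)
  have T: "frozen (freeze (N_in S s) S) = ?F" "exch (freeze (N_in S s) S) = exch S" by simp_all
  obtain \<pi> where mutD: "mutable D = mutable S - N_in S s - {s}" and finD: "finite (frozen D)"
    and disjD: "mutable D \<inter> frozen D = {}" and symmD: "\<And>i. i \<in> mutable D \<Longrightarrow> symm D i = symm S i"
    and exchD: "\<And>i j. i \<in> mutable D \<Longrightarrow> j \<in> mutable D \<Longrightarrow> exch D i j = exch S i j"
    and quot: "quotient_basis ?F (\<lambda>f. exch S f s) (frozen D) \<pi>"
    and exchD': "\<And>g j. g \<in> frozen D \<Longrightarrow> j \<in> mutable D \<Longrightarrow> exch D g j = (\<Sum>f\<in>?F. \<pi> g f * exch S f j)"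
    using D unfolding is_deletion_def Let_def freeze_simps by blast
  have sub: "mutable D \<subseteq> mutable S" using mutD by blast
  have seedD: "is_seed D"
  proof -
    have "finite (mutable D)" using sub S finite_subset unfolding is_seed_def by blast
    moreover have "0 < symm D i" if "i \<in> mutable D" for i
      using seed_symm_pos[OF S] sub that by (auto simp: symmD)
    moreover have "symm D j * exch D i j = - (symm D i * exch D j i)" if "i \<in> mutable D" "j \<in> mutable D" for i j
      using seed_symm[OF S, of i j] sub that by (auto simp: symmD exchD)
    ultimately show ?thesis using finD disjD unfolding is_seed_def by blast
  qed
  have col: "exch S i s = 0" if "i \<in> mutable D \<union> {s}" for i
    using that mutD sink seed_diag[OF S sm] sm by (force simp: N_in_def arrow_def is_sink_def)
  have row: "exch S s j = 0" if "j \<in> mutable D \<union> {s}" for j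
    using col[OF that] seed_zero[OF S sm, of j] that sub sm by auto
  have sets: "vertices S = insert s (mutable D \<union> ?F)" "s \<notin> mutable D \<union> ?F" "mutable D \<inter> ?F = {}" "finite (mutable D)" "finite ?F"
  proof -
    have "mutable S \<inter> frozen S = {}" "finite (mutable S)" "finite (frozen S)" using S unfolding is_seed_def by blast+
    moreover have "s \<notin> N_in S s" using seed_diag[OF S sm] by (auto simp: N_in_def arrow_def)
    ultimately show "vertices S = insert s (mutable D \<union> ?F)" "s \<notin> mutable D \<union> ?F" "mutable D \<inter> ?F = {}"
      "finite (mutable D)" "finite ?F"
      using mutD sm N_in_subset[of S s] by (auto simp: vertices_def intro: finite_subset)
  qed
  have "\<exists>c. \<forall>j\<in>mutable S. (if j = s then 1 else 0) = (\<Sum>i\<in>vertices S. c i * exch S i j)"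
    using rank unfolding really_full_rank_def by (rule allE[of _ "\<lambda>j. if j = s then 1 else 0"])
  then obtain c where c: "\<And>j. j \<in> mutable S \<Longrightarrow> (\<Sum>i\<in>vertices S. c i * exch S i j) = (if j = s then 1 else 0)"
    by metis
  have weight: "(\<Sum>i\<in>mutable D \<union> ?F. c i * exch S i j) = (if j = s then 1 else 0)" if "j \<in> mutable D \<union> {s}" for j
  proof -
    have "j \<in> mutable S" using that sub sm by blast
    from c[OF this] show ?thesis
      unfolding sets(1) using sets(2,4,5) row[OF that] by simp
  qed
  have "(\<Sum>i\<in>mutable D. c i * exch S i s) = 0" by (intro sum.neutral) (use col in auto)
  then have chi: "(\<Sum>f\<in>?F. c f * exch S f s) = 1"
    using weight[of s] sets(3-5) by (simp add: sum.union_disjoint)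
  note proj_chi = quotient_basis_projection[OF quot]
  have "\<exists>v. \<forall>g'\<in>frozen D. (\<Sum>f\<in>?F. \<pi> g' f * v f) = (if g' = g then 1 else 0)" for g
    using quot unfolding quotient_basis_def by (elim conjE) (erule allE[of _ "\<lambda>g'. if g' = g then 1 else 0"])
  then obtain v where v: "\<And>g g'. g' \<in> frozen D \<Longrightarrow> (\<Sum>f\<in>?F. \<pi> g' f * v g f) = (if g' = g then 1 else 0)"
    by metis
  \<comment> \<open>Subtracting this multiple of the column of s brings the lift to weight zero and
    keeps its projection, since \<pi> kills that column.\<close>
  define \<iota> where "\<iota> g f = v g f - (\<Sum>f\<in>?F. c f * v g f) * exch S f s" for g f
  have lin: "(\<Sum>f\<in>?F. w f * \<iota> g f) = (\<Sum>f\<in>?F. w f * v g f) - (\<Sum>f\<in>?F. c f * v g f) * (\<Sum>f\<in>?F. w f * exch S f s)" for w g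
    by (simp add: \<iota>_def right_diff_distrib sum_subtractf sum_distrib_left mult.left_commute)
  have finV: "finite (vertices D)" "finite (vertices S)" using seed_finite seedD S by blast+
  obtain a where a: "a \<notin> vertices D" using ex_new_if_finite[OF infinite_UNIV_nat finV(1)] by blast
  obtain b where b: "b \<notin> insert a (vertices D)"
    using ex_new_if_finite[OF infinite_UNIV_nat, of "insert a (vertices D)"] finV(1) by blast
  obtain l where l: "\<forall>i\<in>vertices S. i < l" using finV(2) finite_nat_set_iff_bounded by blast
  have "sink_deletion S D s \<pi> c \<iota> a b l"
  proof
    show "(\<Sum>f\<in>?F. \<pi> g' f * \<iota> g f) = (if g' = g then 1 else 0)" if "g \<in> frozen D" "g' \<in> frozen D" for g g'
      unfolding lin using that by (simp add: v proj_chi)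
    show "(\<Sum>f\<in>?F. c f * \<iota> g f) = 0" for g unfolding lin by (simp add: chi)
  qed (use S rank sink mutD seedD exchD exchD' quot weight a b l in auto)
  then show ?thesis by blast
qed

theorem proposition4p16:
  fixes k :: "'k ring" and \<Sigma> \<Sigma>s :: seed and s :: nat
  assumes "field k"
    and "is_seed \<Sigma>"
    and "really_full_rank \<Sigma>"
    and "sink_recurrent_at \<Sigma> s"
    and "is_deletion \<Sigma> s \<Sigma>s"
  shows "isomorphic_over k
           (vanishing_locus (cluster_algebra_over k \<Sigma>) (cluster_function k \<Sigma> s))
           (affine_line_times k (cluster_algebra_over k \<Sigma>s))"
proof -
  have sink: "is_sink \<Sigma> s" and recurrent: "sink_recurrent (freeze (N_in \<Sigma> s \<union> {s}) \<Sigma>)"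
    using assms(4) by (simp_all add: sink_recurrent_at_def)
  obtain \<pi> c \<iota> a b l where "sink_deletion \<Sigma> \<Sigma>s s \<pi> c \<iota> a b l"
    using sink_deletion_exists[OF assms(2,3) sink assms(5)] by blast
  then interpret sink_deletion_recurrent \<Sigma> \<Sigma>s s \<pi> c \<iota> a b l
    by (rule sink_deletion_recurrent.intro) (unfold_locales, rule recurrent)
  have k: "cring k" by (rule fieldE(1)[OF assms(1)])
  have A: "cring (cluster_algebra \<Sigma>)" and D: "cring (cluster_algebra \<Sigma>s)"
    unfolding cluster_algebra_eq cluster_ring_def by (rule cring_ring_span)+
  have x: "indet s \<in> carrier (cluster_algebra \<Sigma>)"
    using s_mutable by (simp add: cluster_algebra_eq cluster_ring_indet vertices_def)
  obtain E where E: "E \<in> ring_hom (cluster_algebra \<Sigma>) (UP (cluster_algebra \<Sigma>s))"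
    "E ` carrier (cluster_algebra \<Sigma>) = carrier (UP (cluster_algebra \<Sigma>s))"
    "\<And>f. f \<in> carrier (cluster_algebra \<Sigma>) \<Longrightarrow> E f = \<zero>\<^bsub>UP (cluster_algebra \<Sigma>s)\<^esub> \<Longrightarrow>
      f \<in> PIdl\<^bsub>cluster_algebra \<Sigma>\<^esub> (indet s)"
    "E (indet s) = \<zero>\<^bsub>UP (cluster_algebra \<Sigma>s)\<^esub>"
    by (rule fiber_map) blast
  note iso = fiber_iso[OF k A D x E]
  then obtain G where G: "G \<in> ring_iso (tensor_alg k (poly_alg k) (cluster_algebra_over k \<Sigma>s))
      (quotient_alg (cluster_algebra_over k \<Sigma>) (cluster_function k \<Sigma> s))"
    "\<And>c. c \<in> carrier k \<Longrightarrow> scalar_map (tensor_alg k (poly_alg k) (cluster_algebra_over k \<Sigma>s)) c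
        \<in> carrier (tensor_alg k (poly_alg k) (cluster_algebra_over k \<Sigma>s)) \<and>
      G (scalar_map (tensor_alg k (poly_alg k) (cluster_algebra_over k \<Sigma>s)) c)
        = scalar_map (quotient_alg (cluster_algebra_over k \<Sigma>) (cluster_function k \<Sigma> s)) c"
    unfolding cluster_algebra_over_def cluster_function_def by blast
  show ?thesis
    unfolding vanishing_locus_def affine_line_times_def
    by (rule Spec_isomorphic[OF _ _ G])
      (use iso(1,2) in \<open>simp_all add: cluster_algebra_over_def cluster_function_def\<close>)
qed

end
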